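(* Let $1<p<\infty$. Let $\mathcal{T}_{0,p}$ be the restriction of $\mathcal{T}_{\max,p}$ to the domain $\mathscr{D}(\mathcal{T}_{0,p})=\{\psi\in\mathscr{D}(\mathcal{T}_{\max,p}):\mathsf{B}^-\psi=0\}$. Then the operator $(\mathcal{T}_{0,p},\mathscr{D}(\mathcal{T}_{0,p}))$ is the generator of a nonnegative $C_0$-semigroup of contractions $(U_0(t))_{t\geq0}$ in $L^p(\Omega,\mu)$ given by $$U_0(t)f(x)=f(\Phi(x,-t))\,\chi_{\{t<\tau_-(x)\}}(x),\qquad x\in\Omega,\ f\in L^p(\Omega,\mu),$$ where $\chi_A$ denotes the characteristic function of a set $A$.
   Context: Setting. $\mathbb{R}^N$ is endowed with a positive Radon measure $\mu$, $\Omega\subset\mathbb{R}^N$ is a sufficiently smooth open set, $\mathscr{F}:\mathbb{R}^N\to\mathbb{R}^N$ is a globally Lipschitz vector field, and $\Phi:\mathbb{R}^N\times\mathbb{R}\to\mathbb{R}^N$ is its flow: $t\mapsto\Phi(x,t)$ is the unique solution of $\dot{\mathbf X}=\mathscr{F}(\mathbf X)$, $\mathbf X(0)=x$. With $T_t=\Phi(\cdot,t)$, it is assumed that $\mu(T_tA)=\mu(A)$ for all measurable $A\subset\mathbb{R}^N$ and all $t\in\mathbb{R}$. Functions are real-valued. For $x\in\Omega$, $\tau_\pm(x)=\inf\{s>0:\Phi(x,\pm s)\notin\Omega\}$ ($\inf\varnothing=\infty$); $\Omega_\pm=\{x\in\Omega:\tau_\pm(x)<\infty\}$, $\Omega_{\pm\infty}=\Omega\setminus\Omega_\pm$;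 $\Gamma_\pm=\{y\in\partial\Omega:\exists x\in\Omega,\ \tau_\pm(x)<\infty,\ y=\Phi(x,\pm\tau_\pm(x))\}$. For $y\in\Gamma_\pm$, $\tau_\mp(y)=\inf\{s>0:\Phi(y,\mp s)\notin\Omega\}$, and $\Gamma_{\pm\infty}=\{y\in\Gamma_\pm:\tau_\mp(y)=\infty\}$. $\mu_\pm$ are the unique positive Borel measures on $\Gamma_\pm$ such that for all $h\in L^1(\Omega,\mu)$, $\int_{\Omega_\pm}h\,d\mu=\int_{\Gamma_\pm}d\mu_\pm(y)\int_0^{\tau_\mp(y)}h(\Phi(y,\mp s))\,ds$ and $\int_{\Omega_\pm\cap\Omega_{\mp\infty}}h\,d\mu=\int_{\Gamma_{\pm\infty}}d\mu_\pm(y)\int_0^\infty h(\Phi(y,\mp s))\,ds$. Test functions: $\mathfrak{Y}$ is the set of measurable bounded $\psi:\Omega\to\mathbb{R}$ with compact support in $\Omega$ such that for any $x\in\Omega$ the map $s\in(-\tau_-(x),\tau_+(x))\mapsto\psi(\Phi(x,s))$ is $C^1$ and $x\mapsto\frac{d}{ds}\psi(\Phi(x,s))|_{s=0}$ is measurable and bounded. $\mathscr{D}(\mathcal{T}_{\max,p})$ is the set of $f\in L^p(\Omega,\mu)$ for which there is $g\in L^p(\Omega,\mu)$ with $\int_\Omega g\psi\,d\mu=\int_\Omega f(x)\frac{d}{ds}\psi(\Phi(x,s))|_{s=0}\,d\mu(x)$ for all $\psi\in\mathfrak{Y}$; then $\mathcal{T}_{\max,p}f:=g$. Traces: every $f\in\mathscr{D}(\mathcal{T}_{\max,p})$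 has a representative $f^\sharp$ with $f^\sharp(\Phi(x,t_1))-f^\sharp(\Phi(x,t_2))=\int_{t_1}^{t_2}[\mathcal{T}_{\max,p}f](\Phi(x,s))\,ds$ for $\mu$-a.e. $x\in\Omega$ and all $-\tau_-(x)<t_1\leq t_2<\tau_+(x)$, and the limits $\mathsf{B}^\pm f(y):=\lim_{t\to0+}f^\sharp(\Phi(y,\mp t))$ exist for $\mu_\pm$-a.e. $y\in\Gamma_\pm$. *)

theory Defs
  imports "HOL-Analysis.Analysis"
begin

text \<open>
  Elements of L^p are represented by functions; classes are obtained by identifying functions
  that agree almost everywhere. Operators in L^p are represented by their graphs, i.e. by sets
  of pairs of functions.
\<close>

definition lp_space :: "'a measure \<Rightarrow> real \<Rightarrow> ('a \<Rightarrow> real) set" where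
  "lp_space M p = {f \<in> borel_measurable M. integrable M (\<lambda>x. \<bar>f x\<bar> powr p)}"

definition lp_norm :: "'a measure \<Rightarrow> real \<Rightarrow> ('a \<Rightarrow> real) \<Rightarrow> real" where
  "lp_norm M p f = (LINT x|M. \<bar>f x\<bar> powr p) powr (1 / p)"

definition lp_bounded_operator ::
    "'a measure \<Rightarrow> real \<Rightarrow> (('a \<Rightarrow> real) \<Rightarrow> ('a \<Rightarrow> real)) \<Rightarrow> bool" where
  "lp_bounded_operator M p T \<longleftrightarrow>
     (\<forall>f\<in>lp_space M p. T f \<in> lp_space M p) \<and>
     (\<forall>f\<in>lp_space M p. \<forall>g\<in>lp_space M p.
        (AE x in M. f x = g x) \<longrightarrow> (AE x in M. T f x = T g x)) \<and>
     (\<forall>f\<in>lp_space M p. \<forall>g\<in>lp_space M p. \<forall>a b.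
        AE x in M. T (\<lambda>z. a * f z + b * g z) x = a * T f x + b * T g x) \<and>
     (\<exists>C. \<forall>f\<in>lp_space M p. lp_norm M p (T f) \<le> C * lp_norm M p f)"

definition c0_semigroup_lp ::
    "'a measure \<Rightarrow> real \<Rightarrow> (real \<Rightarrow> ('a \<Rightarrow> real) \<Rightarrow> ('a \<Rightarrow> real)) \<Rightarrow> bool" where
  "c0_semigroup_lp M p U \<longleftrightarrow>
     (\<forall>t\<ge>0. lp_bounded_operator M p (U t)) \<and>
     (\<forall>f\<in>lp_space M p. AE x in M. U 0 f x = f x) \<and>
     (\<forall>s\<ge>0. \<forall>t\<ge>0. \<forall>f\<in>lp_space M p. AE x in M. U (s + t) f x = U s (U t f) x) \<and>
     (\<forall>f\<in>lp_space M p. ((\<lambda>t. lp_norm M p (\<lambda>x. U t f x - f x)) \<longlongrightarrow> 0) (at_right 0))"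

definition lp_contractive ::
    "'a measure \<Rightarrow> real \<Rightarrow> (real \<Rightarrow> ('a \<Rightarrow> real) \<Rightarrow> ('a \<Rightarrow> real)) \<Rightarrow> bool" where
  "lp_contractive M p U \<longleftrightarrow>
     (\<forall>t\<ge>0. \<forall>f\<in>lp_space M p. lp_norm M p (U t f) \<le> lp_norm M p f)"

definition lp_nonnegative ::
    "'a measure \<Rightarrow> real \<Rightarrow> (real \<Rightarrow> ('a \<Rightarrow> real) \<Rightarrow> ('a \<Rightarrow> real)) \<Rightarrow> bool" where
  "lp_nonnegative M p U \<longleftrightarrow>
     (\<forall>t\<ge>0. \<forall>f\<in>lp_space M p. (AE x in M. 0 \<le> f x) \<longrightarrow> (AE x in M. 0 \<le> U t f x))"

definition generator_lp ::
    "'a measure \<Rightarrow> real \<Rightarrow> (real \<Rightarrow> ('a \<Rightarrow> real) \<Rightarrow> ('a \<Rightarrow> real)) \<Rightarrow>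
      (('a \<Rightarrow> real) \<times> ('a \<Rightarrow> real)) set" where
  "generator_lp M p U =
     {(f, g). f \<in> lp_space M p \<and> g \<in> lp_space M p \<and>
        ((\<lambda>t. lp_norm M p (\<lambda>x. (U t f x - f x) / t - g x)) \<longlongrightarrow> 0) (at_right 0)}"

text \<open>On R^N a Borel measure that is finite on compact sets is automatically regular.\<close>

definition radon_measure :: "(real ^ 'n) measure \<Rightarrow> bool" where
  "radon_measure M \<longleftrightarrow> sets M = sets borel \<and> (\<forall>K. compact K \<longrightarrow> emeasure M K < \<infinity>)"

text \<open>For Lipschitz F the solutions of the Cauchy problem are unique, so F determines Phi.\<close>

definition is_flow ::
    "(real ^ 'n \<Rightarrow> real ^ 'n) \<Rightarrow> (real ^ 'n \<Rightarrow> real \<Rightarrow> real ^ 'n) \<Rightarrow> bool" where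
  "is_flow F \<Phi> \<longleftrightarrow>
     (\<forall>x. \<Phi> x 0 = x \<and> (\<forall>t. (\<Phi> x has_vector_derivative F (\<Phi> x t)) (at t)))"

text \<open>
  In the following the parameter \<open>\<sigma>\<close> is a sign: \<open>\<sigma> = 1\<close> gives the objects with index plus
  and \<open>\<sigma> = -1\<close> those with index minus. In the extended reals the infimum of the empty set
  is infinity.
\<close>

definition exit_time ::
    "(real ^ 'n \<Rightarrow> real \<Rightarrow> real ^ 'n) \<Rightarrow> (real ^ 'n) set \<Rightarrow> real \<Rightarrow> real ^ 'n \<Rightarrow> ereal" where
  "exit_time \<Phi> \<Omega> \<sigma> x = Inf (ereal ` {s. 0 < s \<and> \<Phi> x (\<sigma> * s) \<notin> \<Omega>})"

definition finite_exit ::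
    "(real ^ 'n \<Rightarrow> real \<Rightarrow> real ^ 'n) \<Rightarrow> (real ^ 'n) set \<Rightarrow> real \<Rightarrow> (real ^ 'n) set" where
  "finite_exit \<Phi> \<Omega> \<sigma> = {x \<in> \<Omega>. exit_time \<Phi> \<Omega> \<sigma> x < \<infinity>}"

definition infinite_exit ::
    "(real ^ 'n \<Rightarrow> real \<Rightarrow> real ^ 'n) \<Rightarrow> (real ^ 'n) set \<Rightarrow> real \<Rightarrow> (real ^ 'n) set" where
  "infinite_exit \<Phi> \<Omega> \<sigma> = \<Omega> - finite_exit \<Phi> \<Omega> \<sigma>"

definition exit_boundary ::
    "(real ^ 'n \<Rightarrow> real \<Rightarrow> real ^ 'n) \<Rightarrow> (real ^ 'n) set \<Rightarrow> real \<Rightarrow> (real ^ 'n) set" where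
  "exit_boundary \<Phi> \<Omega> \<sigma> =
     {y \<in> frontier \<Omega>. \<exists>x\<in>\<Omega>. exit_time \<Phi> \<Omega> \<sigma> x < \<infinity> \<and>
        y = \<Phi> x (\<sigma> * real_of_ereal (exit_time \<Phi> \<Omega> \<sigma> x))}"

definition infinite_exit_boundary ::
    "(real ^ 'n \<Rightarrow> real \<Rightarrow> real ^ 'n) \<Rightarrow> (real ^ 'n) set \<Rightarrow> real \<Rightarrow> (real ^ 'n) set" where
  "infinite_exit_boundary \<Phi> \<Omega> \<sigma> =
     {y \<in> exit_boundary \<Phi> \<Omega> \<sigma>. exit_time \<Phi> \<Omega> (- \<sigma>) y = \<infinity>}"

text \<open>
  Bochner integrals of non-integrable functions are 0 by convention, so the integrability that
  is implicit in the first integration formula is stated explicitly; for the second one it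
  is then inherited by restriction.
\<close>

definition boundary_measure ::
    "(real ^ 'n \<Rightarrow> real \<Rightarrow> real ^ 'n) \<Rightarrow> (real ^ 'n) set \<Rightarrow> (real ^ 'n) measure \<Rightarrow> real \<Rightarrow>
      (real ^ 'n) measure \<Rightarrow> bool" where
  "boundary_measure \<Phi> \<Omega> M \<sigma> \<nu> \<longleftrightarrow>
     sets \<nu> = sets (restrict_space borel (exit_boundary \<Phi> \<Omega> \<sigma>)) \<and>
     (\<forall>h :: real ^ 'n \<Rightarrow> real. integrable (restrict_space M \<Omega>) h \<longrightarrow>
        (AE y in \<nu>. set_integrable lborel {s. 0 < s \<and> ereal s < exit_time \<Phi> \<Omega> (- \<sigma>) y}
           (\<lambda>s. h (\<Phi> y (- \<sigma> * s)))) \<and>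
        integrable \<nu> (\<lambda>y. (LINT s:{s. 0 < s \<and> ereal s < exit_time \<Phi> \<Omega> (- \<sigma>) y}|lborel.
           h (\<Phi> y (- \<sigma> * s)))) \<and>
        (LINT x:finite_exit \<Phi> \<Omega> \<sigma>|M. h x) =
          (LINT y|\<nu>. (LINT s:{s. 0 < s \<and> ereal s < exit_time \<Phi> \<Omega> (- \<sigma>) y}|lborel.
             h (\<Phi> y (- \<sigma> * s)))) \<and>
        (LINT x:finite_exit \<Phi> \<Omega> \<sigma> \<inter> infinite_exit \<Phi> \<Omega> (- \<sigma>)|M. h x) =
          (LINT y:infinite_exit_boundary \<Phi> \<Omega> \<sigma>|\<nu>. (LINT s:{0<..}|lborel.
             h (\<Phi> y (- \<sigma> * s)))))"

definition flow_deriv ::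
    "(real ^ 'n \<Rightarrow> real \<Rightarrow> real ^ 'n) \<Rightarrow> (real ^ 'n \<Rightarrow> real) \<Rightarrow> real ^ 'n \<Rightarrow> real" where
  "flow_deriv \<Phi> \<psi> x = deriv (\<lambda>s. \<psi> (\<Phi> x s)) 0"

text \<open>Only the values on \<open>\<Omega>\<close> of a test function matter.\<close>

definition test_functions ::
    "(real ^ 'n \<Rightarrow> real \<Rightarrow> real ^ 'n) \<Rightarrow> (real ^ 'n) set \<Rightarrow> (real ^ 'n \<Rightarrow> real) set" where
  "test_functions \<Phi> \<Omega> =
     {\<psi>. \<psi> \<in> borel_measurable (restrict_space borel \<Omega>) \<and> bounded (\<psi> ` \<Omega>) \<and>
        compact (\<Omega> \<inter> closure {x \<in> \<Omega>. \<psi> x \<noteq> 0}) \<and>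
        (\<forall>x\<in>\<Omega>. (\<lambda>s. \<psi> (\<Phi> x s)) C1_differentiable_on
           {s. - exit_time \<Phi> \<Omega> (-1) x < ereal s \<and> ereal s < exit_time \<Phi> \<Omega> 1 x}) \<and>
        flow_deriv \<Phi> \<psi> \<in> borel_measurable (restrict_space borel \<Omega>) \<and>
        bounded (flow_deriv \<Phi> \<psi> ` \<Omega>)}"

definition T_max ::
    "(real ^ 'n \<Rightarrow> real \<Rightarrow> real ^ 'n) \<Rightarrow> (real ^ 'n) set \<Rightarrow> (real ^ 'n) measure \<Rightarrow> real \<Rightarrow>
      ((real ^ 'n \<Rightarrow> real) \<times> (real ^ 'n \<Rightarrow> real)) set" where
  "T_max \<Phi> \<Omega> M p =
     {(f, g). f \<in> lp_space (restrict_space M \<Omega>) p \<and> g \<in> lp_space (restrict_space M \<Omega>) p \<and>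
        (\<forall>\<psi>\<in>test_functions \<Phi> \<Omega>.
           (LINT x|restrict_space M \<Omega>. g x * \<psi> x) =
           (LINT x|restrict_space M \<Omega>. f x * flow_deriv \<Phi> \<psi> x))}"

text \<open>
  \<open>fs\<close> is a representative of \<open>f\<close> that is absolutely continuous along almost every
  characteristic; \<open>g\<close> plays the role of the image of \<open>f\<close> under the maximal operator.
\<close>

definition sharp_representative ::
    "(real ^ 'n \<Rightarrow> real \<Rightarrow> real ^ 'n) \<Rightarrow> (real ^ 'n) set \<Rightarrow> (real ^ 'n) measure \<Rightarrow>
      (real ^ 'n \<Rightarrow> real) \<Rightarrow> (real ^ 'n \<Rightarrow> real) \<Rightarrow> (real ^ 'n \<Rightarrow> real) \<Rightarrow> bool" where
  "sharp_representative \<Phi> \<Omega> M f g fs \<longleftrightarrow>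
     fs \<in> borel_measurable (restrict_space M \<Omega>) \<and>
     (AE x in restrict_space M \<Omega>. fs x = f x) \<and>
     (AE x in restrict_space M \<Omega>. \<forall>t1 t2.
        - exit_time \<Phi> \<Omega> (-1) x < ereal t1 \<and> t1 \<le> t2 \<and> ereal t2 < exit_time \<Phi> \<Omega> 1 x \<longrightarrow>
        set_integrable lborel {t1..t2} (\<lambda>s. g (\<Phi> x s)) \<and>
        fs (\<Phi> x t1) - fs (\<Phi> x t2) = (LINT s:{t1..t2}|lborel. g (\<Phi> x s)))"

text \<open>
  The trace is a relation, because it is determined only up to \<open>\<nu>\<close>-null sets: \<open>b\<close> is
  (a version of) the trace of \<open>f\<close> on the part of the boundary with sign \<open>\<sigma>\<close>. It does not
  depend on the choice of the representative.
\<close>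

definition has_trace ::
    "(real ^ 'n \<Rightarrow> real \<Rightarrow> real ^ 'n) \<Rightarrow> (real ^ 'n) set \<Rightarrow> (real ^ 'n) measure \<Rightarrow> real \<Rightarrow>
      (real ^ 'n) measure \<Rightarrow> (real ^ 'n \<Rightarrow> real) \<Rightarrow> (real ^ 'n \<Rightarrow> real) \<Rightarrow>
      (real ^ 'n \<Rightarrow> real) \<Rightarrow> bool" where
  "has_trace \<Phi> \<Omega> M \<sigma> \<nu> f g b \<longleftrightarrow>
     (\<exists>fs. sharp_representative \<Phi> \<Omega> M f g fs \<and>
        (AE y in \<nu>. ((\<lambda>t. fs (\<Phi> y (- \<sigma> * t))) \<longlongrightarrow> b y) (at_right 0)))"

definition T_zero ::
    "(real ^ 'n \<Rightarrow> real \<Rightarrow> real ^ 'n) \<Rightarrow> (real ^ 'n) set \<Rightarrow> (real ^ 'n) measure \<Rightarrow>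
      (real ^ 'n) measure \<Rightarrow> real \<Rightarrow> ((real ^ 'n \<Rightarrow> real) \<times> (real ^ 'n \<Rightarrow> real)) set" where
  "T_zero \<Phi> \<Omega> M \<nu> p = {(f, g) \<in> T_max \<Phi> \<Omega> M p. has_trace \<Phi> \<Omega> M (-1) \<nu> f g (\<lambda>_. 0)}"

definition U_zero ::
    "(real ^ 'n \<Rightarrow> real \<Rightarrow> real ^ 'n) \<Rightarrow> (real ^ 'n) set \<Rightarrow> real \<Rightarrow>
      (real ^ 'n \<Rightarrow> real) \<Rightarrow> real ^ 'n \<Rightarrow> real" where
  "U_zero \<Phi> \<Omega> t f x = f (\<Phi> x (- t)) * indicator {z. ereal t < exit_time \<Phi> \<Omega> (-1) z} x"

end

theory Submission
  imports Defs
begin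

text \<open>Write \<open>U\<^sub>t\<close> for the shift along the characteristics that puts the value 0 where the backward
characteristic has left \<open>\<Omega>\<close> by time \<open>t\<close>. As a semigroup it is easy to handle: the semigroup
law holds pointwise because the exit time drops by \<open>s\<close> along the backward flow, contractivity comes
from the invariance of the measure, and strong continuity needs to be checked only for indicators of
compact sets.

The generator is identified through an intermediate condition on a pair \<open>(f, g)\<close>, called
\<open>integral_equation\<close> below: for every \<open>t > 0\<close>, almost everywhere, \<open>U\<^sub>t f - f\<close> is the
integral of \<open>U\<^sub>s g\<close> over \<open>0 \<le> s \<le> t\<close>. It is equivalent to membership in the generator
(\<open>generator_if_integral_equation\<close>, \<open>integral_equation_if_generator\<close>). The integral is taken
pointwise, and an estimate by Jensen's inequality and Tonelli's theorem
(\<open>lp_mass_time_integral_le\<close>) takes the place of vector-valued integration.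

Read along one characteristic, the condition says two things. As long as \<open>t < \<tau> x\<close>, the
difference \<open>f (\<Phi> x (- t)) - f x\<close> is the integral of \<open>g (\<Phi> x (- s))\<close> over \<open>0 \<le> s \<le> t\<close>,
that is, \<open>f\<close> is absolutely continuous along the characteristic with derivative \<open>- g\<close>. For
\<open>t \<ge> \<tau> x\<close>, the value \<open>- f x\<close> is the integral of \<open>g (\<Phi> x (- s))\<close> over
\<open>0 \<le> s \<le> \<tau> x\<close>, that is, \<open>f\<close> tends to 0 at the point where the characteristic enters \<open>\<Omega>\<close>.
Up to null sets the condition therefore expresses that \<open>f\<close> has an absolutely continuous
representative with vanishing trace (\<open>integral_equation_if_trace\<close>,
\<open>trace_if_integral_equation\<close>).

The null sets are the delicate point. The integral equation holds for each \<open>t\<close> outside a null set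
that depends on \<open>t\<close>; Fubini's theorem turns this into a statement for almost every point and almost
every \<open>t\<close>, and averaging \<open>f\<close> over short backward pieces of characteristics produces a
representative for which it holds for all \<open>t\<close>. The trace is an almost-everywhere statement for the
boundary measure, and the integration formula that defines this measure carries null sets of \<open>\<Omega>\<close> to
null sets of the boundary and back (\<open>AE_boundary_avoids_null_set\<close>, \<open>AE_exit_point\<close>).

That a pair in the generator satisfies the weak equation against test functions follows by moving the
shift onto the test function, again with the invariance of the measure
(\<open>generator_weak_formulation\<close>).\<close>

section \<open>Powers of the norm\<close>

text \<open>The power \<open>p\<close> of the norm, with values in the extended nonnegative reals so that it can be
estimated before integrability is known. The triangle inequality holds only up to a constant factor,
which is harmless in limits.\<close>

definition lp_mass :: "'a measure \<Rightarrow> real \<Rightarrow> ('a \<Rightarrow> real) \<Rightarrow> ennreal" where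
  "lp_mass M p f = (\<integral>\<^sup>+x. ennreal (\<bar>f x\<bar> powr p) \<partial>M)"

lemma lp_space_iff_mass:
  "f \<in> lp_space M p \<longleftrightarrow> f \<in> borel_measurable M \<and> lp_mass M p f < \<infinity>"
  by (auto simp: lp_space_def lp_mass_def integrable_iff_bounded)

lemma lp_norm_eq_mass:
  assumes "f \<in> borel_measurable M"
  shows "lp_norm M p f = enn2real (lp_mass M p f) powr (1 / p)"
  using assms by (simp add: lp_norm_def lp_mass_def integral_eq_nn_integral)

lemma lp_norm_mono:
  assumes "f \<in> borel_measurable M" "g \<in> lp_space M p" "lp_mass M p f \<le> lp_mass M p g" "0 < p"
  shows "lp_norm M p f \<le> lp_norm M p g"
  using assms
  by (auto simp: lp_norm_eq_mass lp_space_iff_mass intro!: powr_mono2 enn2real_mono)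

lemma lp_norm_tendsto_0_iff:
  assumes f: "\<forall>\<^sub>F t in F. f t \<in> lp_space M p" and p: "0 < p"
  shows "((\<lambda>t. lp_norm M p (f t)) \<longlongrightarrow> 0) F \<longleftrightarrow> ((\<lambda>t. lp_mass M p (f t)) \<longlongrightarrow> 0) F"
proof -
  have norm: "\<forall>\<^sub>F t in F. lp_norm M p (f t) = enn2real (lp_mass M p (f t)) powr (1 / p)"
    using f by eventually_elim (simp add: lp_norm_eq_mass lp_space_iff_mass)
  have mass: "\<forall>\<^sub>F t in F. lp_mass M p (f t) = ennreal (lp_norm M p (f t) powr p)"
    using f norm by eventually_elim
      (use p in \<open>simp add: powr_powr lp_space_iff_mass ennreal_enn2real\<close>)
  show ?thesis
  proof
    assume "((\<lambda>t. lp_norm M p (f t)) \<longlongrightarrow> 0) F"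
    then have "((\<lambda>t. lp_norm M p (f t) powr p) \<longlongrightarrow> 0) F"
      using p by (intro tendsto_zero_powrI[where b = p]) (auto simp: lp_norm_def)
    then have "((\<lambda>t. ennreal (lp_norm M p (f t) powr p)) \<longlongrightarrow> 0) F"
      using tendsto_ennrealI by fastforce
    then show "((\<lambda>t. lp_mass M p (f t)) \<longlongrightarrow> 0) F"
      using mass by (subst tendsto_cong) auto
  next
    assume "((\<lambda>t. lp_mass M p (f t)) \<longlongrightarrow> 0) F"
    then have "((\<lambda>t. enn2real (lp_mass M p (f t))) \<longlongrightarrow> 0) F"
      by (intro tendsto_enn2real) auto
    then have "((\<lambda>t. enn2real (lp_mass M p (f t)) powr (1 / p)) \<longlongrightarrow> 0) F"
      using p by (intro tendsto_zero_powrI[where b = "1 / p"]) auto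
    then show "((\<lambda>t. lp_norm M p (f t)) \<longlongrightarrow> 0) F"
      using norm by (subst tendsto_cong) auto
  qed
qed

lemma powr_add_le:
  fixes a b p :: real
  assumes "0 < p"
  shows "\<bar>a + b\<bar> powr p \<le> 2 powr p * (\<bar>a\<bar> powr p + \<bar>b\<bar> powr p)"
proof -
  have "\<bar>a + b\<bar> powr p \<le> (2 * max \<bar>a\<bar> \<bar>b\<bar>) powr p"
    using assms by (intro powr_mono2) auto
  also have "\<dots> = 2 powr p * max \<bar>a\<bar> \<bar>b\<bar> powr p"
    by (simp add: powr_mult)
  also have "max \<bar>a\<bar> \<bar>b\<bar> powr p \<le> \<bar>a\<bar> powr p + \<bar>b\<bar> powr p"
    by (auto simp: max_def)
  finally show ?thesis by simp
qed

lemma lp_mass_add_le: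
  assumes [measurable]: "f \<in> borel_measurable M" "g \<in> borel_measurable M" and p: "0 < p"
  shows "lp_mass M p (\<lambda>x. f x + g x) \<le> ennreal (2 powr p) * (lp_mass M p f + lp_mass M p g)"
proof -
  have "lp_mass M p (\<lambda>x. f x + g x) \<le>
      (\<integral>\<^sup>+x. ennreal (2 powr p) * (ennreal (\<bar>f x\<bar> powr p) + ennreal (\<bar>g x\<bar> powr p)) \<partial>M)"
    unfolding lp_mass_def using powr_add_le[OF p]
    by (intro nn_integral_mono) (simp flip: ennreal_plus ennreal_mult)
  also have "\<dots> = ennreal (2 powr p) * (lp_mass M p f + lp_mass M p g)"
    by (simp add: lp_mass_def nn_integral_cmult nn_integral_add)
  finally show ?thesis .
qed

lemma lp_mass_cmult:
  assumes [measurable]: "f \<in> borel_measurable M"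
  shows "lp_mass M p (\<lambda>x. c * f x) = ennreal (\<bar>c\<bar> powr p) * lp_mass M p f"
  by (simp add: lp_mass_def abs_mult powr_mult ennreal_mult nn_integral_cmult)

lemma lp_mass_cong_AE:
  "AE x in M. f x = g x \<Longrightarrow> lp_mass M p f = lp_mass M p g"
  unfolding lp_mass_def by (rule nn_integral_cong_AE) auto

lemma lp_mass_eq_0_AE:
  assumes [measurable]: "f \<in> borel_measurable M" and "lp_mass M p f = 0" "0 < p"
  shows "AE x in M. f x = 0"
proof -
  have "AE x in M. ennreal (\<bar>f x\<bar> powr p) = 0"
    using assms by (subst (asm) lp_mass_def) (simp add: nn_integral_0_iff_AE)
  then show ?thesis by eventually_elim simp
qed

lemma lp_space_add:
  assumes "f \<in> lp_space M p" "g \<in> lp_space M p" "0 < p"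
  shows "(\<lambda>x. f x + g x) \<in> lp_space M p"
proof -
  have "lp_mass M p (\<lambda>x. f x + g x) \<le> ennreal (2 powr p) * (lp_mass M p f + lp_mass M p g)"
    using assms by (intro lp_mass_add_le) (auto simp: lp_space_iff_mass)
  also have "\<dots> < \<infinity>"
    using assms by (auto simp: lp_space_iff_mass ennreal_mult_less_top)
  finally show ?thesis
    using assms by (auto simp: lp_space_iff_mass)
qed

lemma lp_space_cmult:
  assumes "f \<in> lp_space M p"
  shows "(\<lambda>x. c * f x) \<in> lp_space M p"
  using assms by (auto simp: lp_space_iff_mass lp_mass_cmult ennreal_mult_less_top)

lemma lp_space_diff:
  assumes "f \<in> lp_space M p" "g \<in> lp_space M p" "0 < p"
  shows "(\<lambda>x. f x - g x) \<in> lp_space M p"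
  using lp_space_add[OF assms(1) lp_space_cmult[OF assms(2), of "-1"] assms(3)] by simp

lemma set_integral_nonneg:
  fixes f :: "'a \<Rightarrow> real"
  assumes "\<And>x. x \<in> A \<Longrightarrow> 0 \<le> f x"
  shows "0 \<le> (LINT x:A|M. f x)"
  using assms unfolding set_lebesgue_integral_def
  by (intro integral_nonneg_AE) (auto simp: indicator_def)

lemma powr_ge_tangent:
  fixes x m p :: real
  assumes "0 \<le> x" "0 < m" "1 < p"
  shows "m powr p + p * m powr (p - 1) * (x - m) \<le> x powr p"
proof (cases "x = 0")
  case True
  have "m powr p = m powr (p - 1) * m"
    using assms by (simp add: powr_diff)
  then have "m powr p + p * m powr (p - 1) * (x - m) = (1 - p) * m powr p"
    using True by (simp add: algebra_simps)
  then show ?thesis using True assms by (simp add: mult_nonpos_nonneg)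
next
  case False
  have "((\<lambda>x. x powr p) has_real_derivative p * m powr (p - 1)) (at m within {0<..})"
    using assms by (auto intro!: derivative_eq_intros)
  then have "x powr p - m powr p \<ge> p * m powr (p - 1) * (x - m)"
    using assms False
    by (intro convex_on_imp_above_tangent[where A = "{0<..}"] convex_on_subset[OF powr_convex])
       (auto simp: interior_open)
  then show ?thesis by simp
qed

text \<open>Jensen's inequality: integrate the tangent inequality at the mean \<open>m\<close> of \<open>\<bar>w\<bar>\<close>; the linear term
has integral 0.\<close>

lemma powr_set_integral_le:
  fixes w :: "real \<Rightarrow> real"
  assumes t: "0 < t" and p: "1 < p"
    and w: "set_integrable lborel {0..t} w"
    and wp: "set_integrable lborel {0..t} (\<lambda>s. \<bar>w s\<bar> powr p)"
  shows "\<bar>LINT s:{0..t}|lborel. w s\<bar> powr p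
    \<le> t powr (p - 1) * (LINT s:{0..t}|lborel. \<bar>w s\<bar> powr p)"
proof -
  define m where "m = (LINT s:{0..t}|lborel. \<bar>w s\<bar>) / t"
  have absw: "set_integrable lborel {0..t} (\<lambda>s. \<bar>w s\<bar>)"
    using set_integrable_abs[OF w] by simp
  have le: "\<bar>LINT s:{0..t}|lborel. w s\<bar> \<le> t * m"
    using set_integral_norm_bound[OF w] t by (simp add: m_def)
  have m0: "0 \<le> m"
    unfolding m_def using t by (intro divide_nonneg_pos set_integral_nonneg) auto
  have const: "set_integrable lborel {0..t} (\<lambda>_. c)" for c :: real
    using t by (auto simp: set_integrable_def intro!: integrable_real_indicator)
  have cint: "(LINT s:{0..t}|lborel. c) = t * c" for c :: real
    using t by (simp add: set_lebesgue_integral_def)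
  have *: "t * m powr p \<le> (LINT s:{0..t}|lborel. \<bar>w s\<bar> powr p)"
  proof (cases "m = 0")
    case True
    then show ?thesis using p by (simp add: set_integral_nonneg)
  next
    case False
    with m0 have m: "0 < m" by simp
    have c1: "set_integrable lborel {0..t} (\<lambda>s. p * m powr (p - 1) * (\<bar>w s\<bar> - m))"
      using const absw by (intro set_integrable_mult_right set_integral_diff) auto
    have c2: "set_integrable lborel {0..t} (\<lambda>s. m powr p + p * m powr (p - 1) * (\<bar>w s\<bar> - m))"
      using const c1 by (rule set_integral_add)
    have "(LINT s:{0..t}|lborel. m powr p + p * m powr (p - 1) * (\<bar>w s\<bar> - m))
        = t * m powr p + p * m powr (p - 1) * ((LINT s:{0..t}|lborel. \<bar>w s\<bar>) - t * m)"
      by (simp add: set_integral_add(2)[OF const c1] set_integral_diff(2)[OF absw const] cint)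
    also have "\<dots> = t * m powr p" using t by (simp add: m_def)
    finally show ?thesis
      using set_integral_mono[OF c2 wp] powr_ge_tangent[OF _ m p] by simp
  qed
  have "\<bar>LINT s:{0..t}|lborel. w s\<bar> powr p \<le> (t * m) powr p"
    using le p by (intro powr_mono2) auto
  also have "\<dots> = t powr (p - 1) * (t * m powr p)"
    using t m0 by (simp add: powr_mult powr_diff)
  also have "\<dots> \<le> t powr (p - 1) * (LINT s:{0..t}|lborel. \<bar>w s\<bar> powr p)"
    using * by (intro mult_left_mono) auto
  finally show ?thesis .
qed

text \<open>Minkowski's inequality for time integrals: the norm of the integral of \<open>v s\<close> over \<open>0 \<le> s \<le> t\<close> is
at most \<open>t\<close> times the supremum of the norms. Jensen's inequality is applied for each \<open>x\<close> and
then the integrals are exchanged. Measurability is asked for nonnegative times only, because \<open>U\<^sub>s f\<close>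
with \<open>s < 0\<close> may evaluate \<open>f\<close> outside of the domain.\<close>

lemma lp_time_integral:
  fixes v :: "real \<Rightarrow> 'a \<Rightarrow> real"
  assumes "sigma_finite_measure M"
    and v: "(\<lambda>(s, x). indicator {0..} s *\<^sub>R v s x) \<in> borel_measurable (lborel \<Otimes>\<^sub>M M)"
    and t: "0 < t" and p: "1 < p" and c: "c < \<infinity>"
    and bound: "\<And>s. 0 \<le> s \<Longrightarrow> s \<le> t \<Longrightarrow> lp_mass M p (v s) \<le> c"
  shows lp_time_integrable: "AE x in M. set_integrable lborel {0..t} (\<lambda>s. v s x)"
    and lp_mass_time_integral_le:
      "lp_mass M p (\<lambda>x. LINT s:{0..t}|lborel. v s x) \<le> ennreal (t powr p) * c"
proof -
  interpret M: sigma_finite_measure M by fact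
  interpret pair_sigma_finite lborel M ..
  define w where "w = (\<lambda>s x. indicator {0..t} s * v s x)"
  have "(\<lambda>(s, x). indicator {0..t} s * (indicator {0..} s *\<^sub>R v s x))
      \<in> borel_measurable (lborel \<Otimes>\<^sub>M M)"
    using v by (simp add: split_beta')
  also have "(\<lambda>(s, x). indicator {0..t} s * (indicator {0..} s *\<^sub>R v s x)) = (\<lambda>(s, x). w s x)"
    by (auto simp: w_def fun_eq_iff indicator_def)
  finally have w [measurable]: "(\<lambda>(s, x). w s x) \<in> borel_measurable (lborel \<Otimes>\<^sub>M M)" .
  have wx [measurable]: "(\<lambda>s. w s x) \<in> borel_measurable lborel" if "x \<in> space M" for x
    using measurable_compose[OF _ w, of "\<lambda>s. (s, x)" lborel] that by simp
  define P where "P = (\<lambda>x. \<integral>\<^sup>+s. ennreal (\<bar>w s x\<bar> powr p) \<partial>lborel)"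
  have [measurable]: "P \<in> borel_measurable M"
    unfolding P_def by measurable
  have "(\<integral>\<^sup>+x. P x \<partial>M) = (\<integral>\<^sup>+s. (\<integral>\<^sup>+x. ennreal (\<bar>w s x\<bar> powr p) \<partial>M) \<partial>lborel)"
    unfolding P_def by (rule Fubini') measurable
  also have "\<dots> \<le> (\<integral>\<^sup>+s. c * indicator {0..t} s \<partial>lborel)"
    using bound by (intro nn_integral_mono) (auto simp: w_def lp_mass_def indicator_def)
  also have "\<dots> = c * ennreal t"
    using t by (simp add: nn_integral_cmult_indicator)
  finally have PI: "(\<integral>\<^sup>+x. P x \<partial>M) \<le> c * ennreal t" .
  also have "\<dots> < \<infinity>" using c by (simp add: ennreal_mult_less_top)
  finally have "AE x in M. P x \<noteq> \<infinity>"
    by (intro nn_integral_PInf_AE) auto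
  then have fin: "AE x in M. P x < \<infinity>"
    by eventually_elim (simp add: less_top)
  have int: "set_integrable lborel {0..t} (\<lambda>s. v s x)"
    and intp: "set_integrable lborel {0..t} (\<lambda>s. \<bar>v s x\<bar> powr p)"
    and P_eq: "P x = ennreal (LINT s:{0..t}|lborel. \<bar>v s x\<bar> powr p)"
    if x: "x \<in> space M" and "P x < \<infinity>" for x
  proof -
    have wp: "integrable lborel (\<lambda>s. \<bar>w s x\<bar> powr p)"
      using that by (simp add: integrable_iff_bounded P_def)
    have eq: "\<bar>w s x\<bar> powr p = indicator {0..t} s *\<^sub>R (\<bar>v s x\<bar> powr p)" for s
      by (auto simp: w_def indicator_def)
    show intp: "set_integrable lborel {0..t} (\<lambda>s. \<bar>v s x\<bar> powr p)"
      using wp by (simp add: set_integrable_def eq)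
    have "integrable lborel (\<lambda>s. indicator {0..t} s + \<bar>w s x\<bar> powr p :: real)"
      using wp t by (intro Bochner_Integration.integrable_add integrable_real_indicator) auto
    moreover have "\<bar>w s x\<bar> \<le> indicator {0..t} s + \<bar>w s x\<bar> powr p" for s
    proof (cases "\<bar>w s x\<bar> \<le> 1")
      case True
      then show ?thesis by (auto simp: w_def indicator_def intro: add_increasing2)
    next
      case False
      then have "\<bar>w s x\<bar> powr 1 \<le> \<bar>w s x\<bar> powr p"
        using p by (intro powr_mono) auto
      then show ?thesis using False by (auto simp: indicator_def)
    qed
    ultimately have "integrable lborel (\<lambda>s. w s x)"
      using wx[OF x] by (elim Bochner_Integration.integrable_bound) auto
    then show "set_integrable lborel {0..t} (\<lambda>s. v s x)"
      by (simp add: set_integrable_def w_def)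
    have "P x = ennreal (LINT s|lborel. \<bar>w s x\<bar> powr p)"
      unfolding P_def using wp by (intro nn_integral_eq_integral) auto
    then show "P x = ennreal (LINT s:{0..t}|lborel. \<bar>v s x\<bar> powr p)"
      by (simp add: eq set_lebesgue_integral_def)
  qed
  show "AE x in M. set_integrable lborel {0..t} (\<lambda>s. v s x)"
    using fin AE_space by eventually_elim (rule int)
  have "lp_mass M p (\<lambda>x. LINT s:{0..t}|lborel. v s x)
      \<le> (\<integral>\<^sup>+x. ennreal (t powr (p - 1)) * P x \<partial>M)"
    unfolding lp_mass_def
  proof (rule nn_integral_mono_AE)
    show "AE x in M. ennreal (\<bar>LINT s:{0..t}|lborel. v s x\<bar> powr p) \<le> ennreal (t powr (p - 1)) * P x"
      using fin AE_space
    proof eventually_elim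
      case (elim x)
      have nn: "0 \<le> (LINT s:{0..t}|lborel. \<bar>v s x\<bar> powr p)"
        by (intro set_integral_nonneg) auto
      show ?case
        using powr_set_integral_le[OF t p int[OF elim(2,1)] intp[OF elim(2,1)]] nn
        by (simp add: P_eq[OF elim(2,1)] flip: ennreal_mult)
    qed
  qed
  also have "\<dots> = ennreal (t powr (p - 1)) * (\<integral>\<^sup>+x. P x \<partial>M)"
    by (simp add: nn_integral_cmult)
  also have "\<dots> \<le> ennreal (t powr (p - 1)) * (c * ennreal t)"
    using PI by (intro mult_left_mono) auto
  also have "\<dots> = ennreal (t powr (p - 1) * t) * c"
    using t by (simp add: ennreal_mult mult_ac)
  also have "t powr (p - 1) * t = t powr p"
    using t by (simp add: powr_diff)
  finally show "lp_mass M p (\<lambda>x. LINT s:{0..t}|lborel. v s x) \<le> ennreal (t powr p) * c" .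
qed

section \<open>Flows of Lipschitz vector fields\<close>

text \<open>Gronwall's argument: by the Cauchy-Schwarz inequality \<open>\<bar>X - Y\<bar>\<^sup>2 exp (- 2 L s)\<close> is nonincreasing in
\<open>s\<close>.\<close>

lemma lipschitz_solutions_diff_le_forward:
  fixes X Y :: "real \<Rightarrow> 'a::real_inner"
  assumes G: "L-lipschitz_on UNIV G"
    and X: "\<And>s. (X has_vector_derivative G (X s)) (at s)"
    and Y: "\<And>s. (Y has_vector_derivative G (Y s)) (at s)"
    and t: "0 \<le> t"
  shows "norm (X t - Y t) \<le> exp (L * t) * norm (X 0 - Y 0)"
proof -
  define w where "w = (\<lambda>s. (X s - Y s) \<bullet> (X s - Y s) * exp (- (2 * L) * s))"
  have D: "(w has_real_derivative
      (2 * ((X s - Y s) \<bullet> (G (X s) - G (Y s))) - 2 * L * ((X s - Y s) \<bullet> (X s - Y s)))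
        * exp (- (2 * L) * s)) (at s)" for s
  proof -
    have XY: "((\<lambda>s. X s - Y s) has_vector_derivative G (X s) - G (Y s)) (at s)"
      using X Y by (intro has_vector_derivative_diff)
    have "((\<lambda>s. (X s - Y s) \<bullet> (X s - Y s)) has_vector_derivative
        (X s - Y s) \<bullet> (G (X s) - G (Y s)) + (G (X s) - G (Y s)) \<bullet> (X s - Y s)) (at s)"
      using bounded_bilinear.has_vector_derivative[OF bounded_bilinear_inner XY XY] .
    then have "((\<lambda>s. (X s - Y s) \<bullet> (X s - Y s)) has_real_derivative
        2 * ((X s - Y s) \<bullet> (G (X s) - G (Y s)))) (at s)"
      by (simp add: has_real_derivative_iff_has_vector_derivative inner_commute)
    moreover have "((\<lambda>s. exp (- (2 * L) * s)) has_real_derivative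
        exp (- (2 * L) * s) * (- (2 * L))) (at s)"
      by (auto intro!: derivative_eq_intros)
    ultimately show ?thesis
      unfolding w_def by (rule DERIV_cong[OF DERIV_mult]) (simp add: left_diff_distrib right_diff_distrib mult_ac)
  qed
  have neg: "2 * ((X s - Y s) \<bullet> (G (X s) - G (Y s))) - 2 * L * ((X s - Y s) \<bullet> (X s - Y s)) \<le> 0" for s
  proof -
    have "(X s - Y s) \<bullet> (G (X s) - G (Y s)) \<le> norm (X s - Y s) * norm (G (X s) - G (Y s))"
      by (rule norm_cauchy_schwarz)
    also have "\<dots> \<le> norm (X s - Y s) * (L * norm (X s - Y s))"
      using lipschitz_onD[OF G, of "X s" "Y s"] by (intro mult_left_mono) (auto simp: dist_norm)
    also have "\<dots> = L * ((X s - Y s) \<bullet> (X s - Y s))"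
      by (simp add: dot_square_norm power2_eq_square)
    finally show ?thesis by simp
  qed
  have "w t \<le> w 0"
  proof (rule DERIV_nonpos_imp_nonincreasing[OF t])
    fix s
    show "\<exists>y. (w has_real_derivative y) (at s) \<and> y \<le> 0"
      using D[of s] neg[of s] by (intro exI conjI) (auto simp: mult_nonpos_nonneg)
  qed
  then have "(norm (X t - Y t))\<^sup>2 * exp (- (2 * L) * t) \<le> (norm (X 0 - Y 0))\<^sup>2"
    by (simp add: w_def dot_square_norm)
  then have "(norm (X t - Y t))\<^sup>2 \<le> (norm (X 0 - Y 0))\<^sup>2 * exp (2 * L * t)"
    by (simp add: exp_minus field_simps)
  also have "\<dots> = (exp (L * t) * norm (X 0 - Y 0))\<^sup>2"
    by (simp add: power_mult_distrib exp_double[symmetric] mult_ac)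
  finally show ?thesis
    by (rule power2_le_imp_le) auto
qed

text \<open>Going backwards in time means following the vector field \<open>- G\<close>.\<close>

lemma lipschitz_solutions_diff_le:
  fixes X Y :: "real \<Rightarrow> 'a::real_inner"
  assumes G: "L-lipschitz_on UNIV G"
    and X: "\<And>s. (X has_vector_derivative G (X s)) (at s)"
    and Y: "\<And>s. (Y has_vector_derivative G (Y s)) (at s)"
  shows "norm (X t - Y t) \<le> exp (L * \<bar>t\<bar>) * norm (X 0 - Y 0)"
proof (cases "0 \<le> t")
  case True
  then show ?thesis using lipschitz_solutions_diff_le_forward[OF G X Y] by simp
next
  case False
  have neg: "((\<lambda>s. Z (- s)) has_vector_derivative - G (Z (- s))) (at s)"
    if "\<And>s. (Z has_vector_derivative G (Z s)) (at s)" for Z s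
  proof -
    have "(uminus has_vector_derivative -1) (at s)"
      by (auto intro!: derivative_eq_intros)
    from vector_diff_chain_at[OF this that] show ?thesis by (simp add: o_def)
  qed
  have "norm (X (- (- t)) - Y (- (- t))) \<le> exp (L * - t) * norm (X (- 0) - Y (- 0))"
    using False G neg[OF X] neg[OF Y]
    by (intro lipschitz_solutions_diff_le_forward[where G = "\<lambda>z. - G z"])
       (auto simp: lipschitz_on_def dist_norm norm_minus_commute)
  then show ?thesis using False by simp
qed

locale lipschitz_flow =
  fixes F :: "real ^ 'n \<Rightarrow> real ^ 'n" and \<Phi> :: "real ^ 'n \<Rightarrow> real \<Rightarrow> real ^ 'n" and L :: real
  assumes lipschitz: "L-lipschitz_on UNIV F" and is_flow: "is_flow F \<Phi>"
begin

lemma flow_0 [simp]: "\<Phi> x 0 = x"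
  using is_flow by (simp add: is_flow_def)

lemma flow_has_vector_derivative: "(\<Phi> x has_vector_derivative F (\<Phi> x t)) (at t)"
  using is_flow by (simp add: is_flow_def)

text \<open>Both sides solve the same Cauchy problem.\<close>

lemma flow_flow: "\<Phi> (\<Phi> x s) t = \<Phi> x (s + t)"
proof -
  have "((\<lambda>t. \<Phi> x (s + t)) has_vector_derivative F (\<Phi> x (s + t))) (at t)" for t
  proof -
    have "((\<lambda>t. s + t) has_vector_derivative 1) (at t)"
      by (auto intro!: derivative_eq_intros)
    from vector_diff_chain_at[OF this flow_has_vector_derivative] show ?thesis by (simp add: o_def)
  qed
  from lipschitz_solutions_diff_le[OF lipschitz flow_has_vector_derivative[of "\<Phi> x s"] this, of t]
  show ?thesis by simp
qed

lemma flow_diff_le: "norm (\<Phi> x t - \<Phi> y t) \<le> exp (L * \<bar>t\<bar>) * norm (x - y)"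
  using lipschitz_solutions_diff_le[OF lipschitz flow_has_vector_derivative[of x] flow_has_vector_derivative[of y], of t] by simp

text \<open>Continuity in time for fixed \<open>x\<close> becomes joint continuity because the Lipschitz constant in \<open>x\<close>
is locally bounded in time.\<close>

lemma continuous_on_flow: "continuous_on UNIV (\<lambda>z. \<Phi> (fst z) (snd z))"
proof (subst continuous_on_def, intro ballI)
  fix z :: "(real ^ 'n) \<times> real"
  obtain x t where z: "z = (x, t)" by (cases z)
  have cont: "continuous (at t) (\<Phi> x)"
    using flow_has_vector_derivative has_vector_derivative_continuous by blast
  have s: "((\<lambda>w. snd w) \<longlongrightarrow> t) (at z)" "((\<lambda>w. fst w) \<longlongrightarrow> x) (at z)"
    unfolding z by (auto intro!: tendsto_eq_intros)
  have k: "((\<lambda>w. \<Phi> x (snd w)) \<longlongrightarrow> \<Phi> x t) (at z)"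
    using isCont_tendsto_compose[OF cont s(1)] .
  have "((\<lambda>w. exp (L * \<bar>snd w\<bar>) * norm (fst w - x) + norm (\<Phi> x (snd w) - \<Phi> x t)) \<longlongrightarrow>
      exp (L * \<bar>t\<bar>) * norm (x - x) + norm (\<Phi> x t - \<Phi> x t)) (at z)"
    by (intro tendsto_intros s k)
  then have *: "((\<lambda>w. exp (L * \<bar>snd w\<bar>) * norm (fst w - x) + norm (\<Phi> x (snd w) - \<Phi> x t)) \<longlongrightarrow> 0) (at z)"
    by simp
  have "((\<lambda>w. \<Phi> (fst w) (snd w) - \<Phi> x t) \<longlongrightarrow> 0) (at z)"
  proof (rule Lim_null_comparison[OF _ *], intro always_eventually allI)
    fix w :: "(real ^ 'n) \<times> real"
    have "norm (\<Phi> (fst w) (snd w) - \<Phi> x t)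
        \<le> norm (\<Phi> (fst w) (snd w) - \<Phi> x (snd w)) + norm (\<Phi> x (snd w) - \<Phi> x t)"
      using norm_triangle_ineq[of "\<Phi> (fst w) (snd w) - \<Phi> x (snd w)" "\<Phi> x (snd w) - \<Phi> x t"]
      by simp
    then show "norm (\<Phi> (fst w) (snd w) - \<Phi> x t)
        \<le> exp (L * \<bar>snd w\<bar>) * norm (fst w - x) + norm (\<Phi> x (snd w) - \<Phi> x t)"
      using flow_diff_le[of "fst w" "snd w" x] by simp
  qed
  then show "((\<lambda>w. \<Phi> (fst w) (snd w)) \<longlongrightarrow> \<Phi> (fst z) (snd z)) (at z)"
    by (simp add: z LIM_zero_iff)
qed

lemma continuous_on_flow_compose [continuous_intros]:
  "continuous_on A f \<Longrightarrow> continuous_on A g \<Longrightarrow> continuous_on A (\<lambda>z. \<Phi> (f z) (g z))"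
  using continuous_on_compose2[OF continuous_on_flow, of A "\<lambda>z. (f z, g z)"]
  by (auto intro: continuous_on_Pair)

lemma measurable_flow [measurable (raw)]:
  assumes [measurable]: "f \<in> borel_measurable N" "g \<in> borel_measurable N"
  shows "(\<lambda>z. \<Phi> (f z) (g z)) \<in> borel_measurable N"
proof -
  have "(\<lambda>z. \<Phi> (fst z) (snd z)) \<in> borel_measurable borel"
    by (rule borel_measurable_continuous_onI[OF continuous_on_flow])
  then have "(\<lambda>z. \<Phi> (fst z) (snd z)) \<in> borel_measurable (borel \<Otimes>\<^sub>M borel)"
    by (simp add: borel_prod)
  from measurable_compose[OF _ this, of "\<lambda>z. (f z, g z)" N] show ?thesis
    by simp
qed

lemma flow_inverse [simp]: "\<Phi> (\<Phi> x t) (- t) = x" "\<Phi> (\<Phi> x (- t)) t = x"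
  by (simp_all add: flow_flow)

text \<open>The compact set has positive distance \<open>d\<close> to the complement of the open set, and by uniform
continuity no point of it moves by \<open>d\<close> within a short time.\<close>

lemma short_time_in_open:
  assumes "compact K" "K \<subseteq> A" "open A"
  obtains \<delta> where "0 < \<delta>" "\<And>x t. x \<in> K \<Longrightarrow> \<bar>t\<bar> \<le> \<delta> \<Longrightarrow> \<Phi> x t \<in> A"
proof -
  have "\<exists>d>0. \<forall>x\<in>K. \<forall>y\<in>- A. d \<le> dist x y"
    using assms by (intro separate_compact_closed) auto
  then obtain d where d: "0 < d" "\<And>x y. x \<in> K \<Longrightarrow> y \<notin> A \<Longrightarrow> d \<le> dist x y"
    by auto
  have "uniformly_continuous_on (K \<times> {-1..1}) (\<lambda>z. \<Phi> (fst z) (snd z))"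
    using assms by (intro compact_uniformly_continuous continuous_on_subset[OF continuous_on_flow])
      (auto intro: compact_Times)
  then obtain e where e: "0 < e" "\<And>z w. z \<in> K \<times> {-1..1} \<Longrightarrow> w \<in> K \<times> {-1..1} \<Longrightarrow> dist w z < e \<Longrightarrow>
      dist (\<Phi> (fst w) (snd w)) (\<Phi> (fst z) (snd z)) < d"
    unfolding uniformly_continuous_on_def using d(1) by metis
  show ?thesis
  proof (rule that[of "min 1 (e / 2)"])
    fix x t assume x: "x \<in> K" and t: "\<bar>t\<bar> \<le> min 1 (e / 2)"
    have "dist (\<Phi> x t) (\<Phi> x 0) < d"
      using e(2)[of "(x, 0)" "(x, t)"] x t e(1) by (simp add: dist_Pair_Pair abs_le_iff)
    then show "\<Phi> x t \<in> A"
      using d(2)[OF x, of "\<Phi> x t"] by (auto simp: dist_commute)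
  qed (use e in auto)
qed

end

section \<open>Exit times and the transport semigroup\<close>

locale flow_domain = lipschitz_flow F \<Phi> L
  for F :: "real ^ 'n \<Rightarrow> real ^ 'n" and \<Phi> :: "real ^ 'n \<Rightarrow> real \<Rightarrow> real ^ 'n" and L :: real +
  fixes M :: "(real ^ 'n) measure" and \<Omega> :: "(real ^ 'n) set" and p :: real
  assumes radon: "radon_measure M"
    and open_domain: "open \<Omega>"
    and invariant: "\<And>A t. A \<in> sets M \<Longrightarrow> emeasure M ((\<lambda>x. \<Phi> x t) ` A) = emeasure M A"
    and p_gt_1: "1 < p"
begin

abbreviation "R \<equiv> restrict_space M \<Omega>"
abbreviation "\<tau> \<equiv> exit_time \<Phi> \<Omega> (- 1)"
abbreviation "U \<equiv> U_zero \<Phi> \<Omega>"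

lemma sets_M [simp, measurable_cong]: "sets M = sets borel"
  using radon by (simp add: radon_measure_def)

lemma space_M [simp]: "space M = UNIV"
  using sets_eq_imp_space_eq[OF sets_M] by simp

lemma domain_sets [measurable, simp]: "\<Omega> \<in> sets borel"
  using open_domain by simp

lemma space_R [simp]: "space R = \<Omega>"
  by (simp add: space_restrict_space)

lemma compact_finite: "compact K \<Longrightarrow> emeasure M K < \<infinity>"
  using radon by (simp add: radon_measure_def)

sublocale M: sigma_finite_measure M
proof
  show "\<exists>A. countable A \<and> A \<subseteq> sets M \<and> \<Union> A = space M \<and> (\<forall>a\<in>A. emeasure M a \<noteq> \<infinity>)"
  proof (intro exI[of _ "range (\<lambda>n::nat. cball 0 (real n))"] conjI)
    show "\<Union> (range (\<lambda>n::nat. cball 0 (real n))) = space M"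
      by (auto simp: real_arch_simple)
    show "\<forall>a\<in>range (\<lambda>n::nat. cball 0 (real n)). emeasure M a \<noteq> \<infinity>"
      using compact_finite by (auto simp: less_top)
  qed auto
qed

sublocale R: sigma_finite_measure R
  by (rule sigma_finite_measure_restrict_space) (auto intro: M.sigma_finite_measure_axioms)

sublocale LR: pair_sigma_finite lborel R ..

lemma AE_R_iff: "(AE x in R. P x) \<longleftrightarrow> (AE x in M. x \<in> \<Omega> \<longrightarrow> P x)"
  by (subst AE_restrict_space_iff) auto

lemma vimage_flow: "(\<lambda>x. \<Phi> x t) -` A = (\<lambda>x. \<Phi> x (- t)) ` A"
  by (force simp: image_iff)

lemma distr_flow: "distr M M (\<lambda>x. \<Phi> x t) = M"
proof (rule measure_eqI)
  fix A assume "A \<in> sets (distr M M (\<lambda>x. \<Phi> x t))"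
  then show "emeasure (distr M M (\<lambda>x. \<Phi> x t)) A = emeasure M A"
    using invariant[of A "- t"] by (simp add: emeasure_distr vimage_flow[symmetric])
qed simp

lemma nn_integral_flow:
  assumes [measurable]: "h \<in> borel_measurable borel"
  shows "(\<integral>\<^sup>+x. h (\<Phi> x t) \<partial>M) = (\<integral>\<^sup>+x. h x \<partial>M)"
  by (subst (2) distr_flow[of t, symmetric], subst nn_integral_distr) auto

lemma integral_flow:
  fixes h :: "real ^ 'n \<Rightarrow> real"
  assumes [measurable]: "h \<in> borel_measurable borel"
  shows "(LINT x|M. h (\<Phi> x t)) = (LINT x|M. h x)"
  by (subst (2) distr_flow[of t, symmetric], subst integral_distr) auto

lemma null_sets_flow:
  assumes "N \<in> null_sets M"
  shows "(\<lambda>x. \<Phi> x t) -` N \<in> null_sets M"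
  using assms invariant[of N "- t"] measurable_sets[of "\<lambda>x. \<Phi> x t" borel borel N]
  by (auto simp: null_sets_def vimage_flow[symmetric])

lemma AE_flow:
  assumes "AE x in M. P x"
  shows "AE x in M. P (\<Phi> x t)"
proof -
  from assms obtain N where N: "N \<in> null_sets M" "{x. \<not> P x} \<subseteq> N"
    by (auto elim!: AE_E simp: null_sets_def)
  show ?thesis
    by (rule AE_I'[OF null_sets_flow[OF N(1), of t]]) (use N(2) in auto)
qed

lemma less_exit_timeD:
  assumes "ereal t < exit_time \<Phi> \<Omega> \<sigma> x" "0 < s" "s \<le> t"
  shows "\<Phi> x (\<sigma> * s) \<in> \<Omega>"
proof (rule ccontr)
  assume "\<Phi> x (\<sigma> * s) \<notin> \<Omega>"
  then have "exit_time \<Phi> \<Omega> \<sigma> x \<le> ereal s"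
    unfolding exit_time_def using assms by (intro Inf_lower) auto
  also have "\<dots> \<le> ereal t" using assms by simp
  finally show False using assms(1) by simp
qed

text \<open>A finite infimum in the exit time is attained since \<open>\<Omega>\<close> is open; this is why the strict inequality
corresponds to a closed time interval.\<close>

lemma less_exit_time_iff:
  assumes "x \<in> \<Omega>" "0 \<le> t"
  shows "ereal t < exit_time \<Phi> \<Omega> \<sigma> x \<longleftrightarrow> (\<forall>s\<in>{0..t}. \<Phi> x (\<sigma> * s) \<in> \<Omega>)"
proof
  assume "ereal t < exit_time \<Phi> \<Omega> \<sigma> x"
  then show "\<forall>s\<in>{0..t}. \<Phi> x (\<sigma> * s) \<in> \<Omega>"
    using less_exit_timeD[of t \<sigma> x] assms by (force simp: less_le)
next
  assume *: "\<forall>s\<in>{0..t}. \<Phi> x (\<sigma> * s) \<in> \<Omega>"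
  have "open ((\<lambda>s. \<Phi> x (\<sigma> * s)) -` \<Omega>)"
    using open_domain by (intro open_vimage continuous_intros)
  moreover have "t \<in> (\<lambda>s. \<Phi> x (\<sigma> * s)) -` \<Omega>"
    using * assms by auto
  ultimately obtain e where e: "0 < e" "\<And>s. dist s t < e \<Longrightarrow> \<Phi> x (\<sigma> * s) \<in> \<Omega>"
    by (auto simp: open_dist)
  have "ereal (t + e) \<le> exit_time \<Phi> \<Omega> \<sigma> x"
    unfolding exit_time_def
  proof (intro Inf_greatest, clarsimp)
    fix s assume s: "0 < s" "\<Phi> x (\<sigma> * s) \<notin> \<Omega>"
    show "t + e \<le> s"
      using * e(2)[of s] s by (cases "s \<le> t") (force simp: dist_real_def not_less)+
  qed
  then show "ereal t < exit_time \<Phi> \<Omega> \<sigma> x"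
    using e(1) by (auto intro: less_le_trans[of _ "ereal (t + e)"])
qed

lemma exit_time_pos: "x \<in> \<Omega> \<Longrightarrow> 0 < exit_time \<Phi> \<Omega> \<sigma> x"
  using less_exit_time_iff[of x 0 \<sigma>] by (simp add: zero_ereal_def)

lemma exit_point_notin:
  assumes "x \<in> \<Omega>" "exit_time \<Phi> \<Omega> \<sigma> x = ereal T"
  shows "0 < T" "\<Phi> x (\<sigma> * T) \<notin> \<Omega>"
proof -
  show T: "0 < T" using exit_time_pos[OF assms(1), of \<sigma>] assms(2) by simp
  show "\<Phi> x (\<sigma> * T) \<notin> \<Omega>"
  proof
    assume *: "\<Phi> x (\<sigma> * T) \<in> \<Omega>"
    have "\<forall>s\<in>{0..T}. \<Phi> x (\<sigma> * s) \<in> \<Omega>"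
    proof
      fix s assume s: "s \<in> {0..T}"
      show "\<Phi> x (\<sigma> * s) \<in> \<Omega>"
        using less_exit_time_iff[OF assms(1), of s \<sigma>] s * assms(2) by (cases "s = T") auto
    qed
    then show False
      using less_exit_time_iff[OF assms(1), of T \<sigma>] assms(2) T by simp
  qed
qed

text \<open>Along the backward flow the exit time decreases at unit speed.\<close>

lemma less_tau_flow_iff:
  assumes "x \<in> \<Omega>" "0 \<le> s" "ereal s < \<tau> x" "0 \<le> t"
  shows "ereal t < \<tau> (\<Phi> x (- s)) \<longleftrightarrow> ereal (s + t) < \<tau> x"
proof -
  have s: "\<Phi> x (- r) \<in> \<Omega>" if "0 \<le> r" "r \<le> s" for r
    using assms less_exit_time_iff[of x s "-1"] that by auto
  have "ereal t < \<tau> (\<Phi> x (- s)) \<longleftrightarrow> (\<forall>r\<in>{0..t}. \<Phi> x (- (s + r)) \<in> \<Omega>)"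
    using s[of s] assms by (subst less_exit_time_iff) (auto simp: flow_flow)
  also have "\<dots> \<longleftrightarrow> (\<forall>r\<in>{0..s + t}. \<Phi> x (- r) \<in> \<Omega>)"
  proof safe
    fix r assume *: "\<forall>r\<in>{0..t}. \<Phi> x (- (s + r)) \<in> \<Omega>" and r: "r \<in> {0..s + t}"
    show "\<Phi> x (- r) \<in> \<Omega>"
      using *[rule_format, of "r - s"] s[of r] r by (cases "r \<le> s") auto
  next
    fix r assume *: "\<forall>r\<in>{0..s + t}. \<Phi> x (- r) \<in> \<Omega>" and r: "r \<in> {0..t}"
    show "\<Phi> x (- (s + r)) \<in> \<Omega>"
      using *[rule_format, of "s + r"] r assms(2) by simp
  qed
  also have "\<dots> \<longleftrightarrow> ereal (s + t) < \<tau> x"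
    using assms by (subst less_exit_time_iff) auto
  finally show ?thesis .
qed

lemma U_eq: "ereal t < \<tau> x \<Longrightarrow> U t f x = f (\<Phi> x (- t))"
  and U_eq_0: "\<not> ereal t < \<tau> x \<Longrightarrow> U t f x = 0"
  by (simp_all add: U_zero_def)

lemma U_0: "x \<in> \<Omega> \<Longrightarrow> U 0 f x = f x"
  using exit_time_pos[of x "-1"] by (simp add: U_eq zero_ereal_def)

lemma U_add:
  assumes "x \<in> \<Omega>" "0 \<le> s" "0 \<le> t"
  shows "U (s + t) f x = U s (U t f) x"
proof (cases "ereal s < \<tau> x")
  case True
  then show ?thesis
    using less_tau_flow_iff[OF assms(1,2) True assms(3)]
    by (simp add: U_zero_def flow_flow indicator_def)
next
  case False
  then have "\<not> ereal (s + t) < \<tau> x"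
    using assms by (meson ereal_less_eq(3) le_add_same_cancel1 le_less_trans)
  then show ?thesis using False by (simp add: U_eq_0)
qed

lemma U_lin: "U t (\<lambda>z. a * f z + b * g z) x = a * U t f x + b * U t g x"
  and U_diff: "U t (\<lambda>z. f z - g z) x = U t f x - U t g x"
  and U_divide: "U t (\<lambda>z. f z / c) x = U t f x / c"
  by (simp_all add: U_zero_def algebra_simps)

lemma flow_in_domain: "x \<in> \<Omega> \<Longrightarrow> 0 \<le> t \<Longrightarrow> ereal t < \<tau> x \<Longrightarrow> \<Phi> x (- t) \<in> \<Omega>"
  using less_exit_time_iff[of x t "-1"] by auto

text \<open>The complement is the projection, along the compact time interval, of a closed set.\<close>

lemma open_less_exit_time:
  assumes "0 \<le> t"
  shows "open {x \<in> \<Omega>. ereal t < \<tau> x}"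
proof -
  have "{x \<in> \<Omega>. ereal t < \<tau> x} = - {x. \<exists>s. s \<in> {0..t} \<and> (s, x) \<in> {z. \<Phi> (snd z) (- fst z) \<in> - \<Omega>}}"
    using assms less_exit_time_iff[of _ t "-1"] by force
  moreover have "closed {z. \<Phi> (snd z) (- fst z) \<in> - \<Omega>}"
    using closed_vimage[of "- \<Omega>" "\<lambda>z. \<Phi> (snd z) (- fst z)"] open_domain
    by (simp add: vimage_def closed_Compl continuous_intros)
  ultimately show ?thesis
    using closed_compact_projection[of "{0..t}" "{z. \<Phi> (snd z) (- fst z) \<in> - \<Omega>}"]
    by (simp add: open_closed)
qed

lemma measurable_tau [measurable]: "\<tau> \<in> borel_measurable R"
proof (rule borel_measurableI_greater)
  fix a :: ereal
  have "{x \<in> \<Omega>. a < \<tau> x} \<in> sets borel"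
  proof (cases "0 \<le> a")
    case True
    then show ?thesis
      using open_less_exit_time by (cases a) auto
  next
    case False
    then have "{x \<in> \<Omega>. a < \<tau> x} = \<Omega>"
      using exit_time_pos[of _ "-1"] by (auto intro: less_trans[of a 0])
    then show ?thesis by simp
  qed
  then show "{x \<in> space R. a < \<tau> x} \<in> sets R"
    by (subst sets_restrict_space_iff) auto
qed

text \<open>Functions in \<open>lp_space R p\<close> are arbitrary outside of \<open>\<Omega>\<close>; the extension by 0 is a Borel function
on the whole space and may be composed with the flow.\<close>

definition extend :: "(real ^ 'n \<Rightarrow> real) \<Rightarrow> real ^ 'n \<Rightarrow> real" where
  "extend f x = indicator \<Omega> x * f x"

lemma measurable_extend [measurable]: "f \<in> borel_measurable R \<Longrightarrow> extend f \<in> borel_measurable borel"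
  using borel_measurable_restrict_space_iff[of \<Omega> M f]
  by (simp add: extend_def[abs_def] cong: measurable_cong_sets)

lemma measurable_U_joint:
  assumes [measurable]: "f \<in> borel_measurable R"
  shows "(\<lambda>(s, x). indicator {0..} s *\<^sub>R U s f x) \<in> borel_measurable (lborel \<Otimes>\<^sub>M R)"
proof -
  have [measurable]: "(\<lambda>z. snd z) \<in> borel_measurable (lborel \<Otimes>\<^sub>M R)"
    by (rule measurable_compose[OF measurable_snd]) (simp add: measurable_restrict_space1)
  have "(\<lambda>z. if 0 \<le> fst z \<and> ereal (fst z) < \<tau> (snd z) then extend f (\<Phi> (snd z) (- fst z)) else 0)
      \<in> borel_measurable (lborel \<Otimes>\<^sub>M R)"
    by measurable
  also have "?this \<longleftrightarrow> ?thesis"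
    by (intro measurable_cong)
      (auto simp: space_pair_measure U_zero_def extend_def indicator_def flow_in_domain)
  finally show ?thesis .
qed

lemma measurable_U [measurable]:
  assumes [measurable]: "f \<in> borel_measurable R" and "0 \<le> t"
  shows "U t f \<in> borel_measurable R"
  using measurable_compose[OF measurable_Pair1' measurable_U_joint[OF assms(1)], of t] assms(2)
  by simp

lemma lp_mass_R: "f \<in> borel_measurable R \<Longrightarrow>
   lp_mass R p f = (\<integral>\<^sup>+x. ennreal (\<bar>extend f x\<bar> powr p) \<partial>M)"
  using p_gt_1 by (auto simp: lp_mass_def nn_integral_restrict_space extend_def indicator_def
      intro!: nn_integral_cong)

lemma lp_mass_U_le:
  assumes [measurable]: "f \<in> borel_measurable R" and "0 \<le> t"
  shows "lp_mass R p (U t f) \<le> lp_mass R p f"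
proof -
  have "lp_mass R p (U t f) \<le> (\<integral>\<^sup>+x. ennreal (\<bar>extend f (\<Phi> x (- t))\<bar> powr p) \<partial>M)"
    using assms p_gt_1
    by (subst lp_mass_R)
      (auto intro!: nn_integral_mono simp: extend_def indicator_def U_zero_def flow_in_domain)
  also have "\<dots> = lp_mass R p f"
    by (subst nn_integral_flow) (auto simp: lp_mass_R)
  finally show ?thesis .
qed

lemma lp_space_U:
  assumes "f \<in> lp_space R p" "0 \<le> t"
  shows "U t f \<in> lp_space R p"
  using assms lp_mass_U_le[of f t] by (auto simp: lp_space_iff_mass intro: le_less_trans)

lemma AE_U:
  assumes "AE x in R. P x"
  shows "AE x in R. 0 \<le> t \<longrightarrow> ereal t < \<tau> x \<longrightarrow> P (\<Phi> x (- t))"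
proof -
  have "AE x in M. \<Phi> x (- t) \<in> \<Omega> \<longrightarrow> P (\<Phi> x (- t))"
    using assms unfolding AE_R_iff by (rule AE_flow)
  then show ?thesis
    unfolding AE_R_iff by eventually_elim (auto simp: flow_in_domain)
qed

end

section \<open>Strong continuity\<close>

lemma ennreal_tendsto_0I:
  fixes u :: "'a \<Rightarrow> ennreal"
  assumes C: "C < \<infinity>" and u: "\<And>e::real. 0 < e \<Longrightarrow> \<forall>\<^sub>F t in F. u t \<le> C * ennreal e"
  shows "(u \<longlongrightarrow> 0) F"
proof (rule order_tendstoI)
  fix a :: ennreal assume a: "0 < a"
  obtain c where c: "C = ennreal c" "0 \<le> c" using C by (cases C) auto
  obtain z where z: "0 < z" "z < a" using dense[OF a] by auto
  then obtain b where b: "0 < b" "ennreal b < a" by (cases z) auto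
  have "\<forall>\<^sub>F t in F. u t \<le> C * ennreal (b / (c + 1))"
    using u[of "b / (c + 1)"] b c by simp
  then show "\<forall>\<^sub>F t in F. u t < a"
  proof eventually_elim
    case (elim t)
    have "C * ennreal (b / (c + 1)) = ennreal (c * (b / (c + 1)))"
      unfolding c(1) using b c by (intro ennreal_mult[symmetric]) auto
    also have "\<dots> \<le> ennreal b"
      using b c by (intro ennreal_leI) (simp add: field_simps)
    finally show ?case using elim b(2) by auto
  qed
qed simp

context flow_domain
begin

text \<open>The functions at which the semigroup is strongly continuous form a closed linear subspace. That it is
the whole space is shown in steps: indicators of compact sets, indicators of sets of finite measure,
simple functions, and finally limits of these.\<close>

definition strongly_continuous_at :: "(real ^ 'n \<Rightarrow> real) \<Rightarrow> bool" where
  "strongly_continuous_at f \<longleftrightarrow>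
     f \<in> lp_space R p \<and> ((\<lambda>t. lp_mass R p (\<lambda>x. U t f x - f x)) \<longlongrightarrow> 0) (at_right 0)"

lemma p_pos: "0 < p" using p_gt_1 by simp

lemma eventually_nonneg: "\<forall>\<^sub>F t in at_right 0. 0 \<le> (t::real)"
  by (auto simp: eventually_at_right_less intro: eventually_mono[OF eventually_at_right_less])

lemma U_cong: "(\<And>x. x \<in> \<Omega> \<Longrightarrow> f x = g x) \<Longrightarrow> x \<in> \<Omega> \<Longrightarrow> 0 \<le> t \<Longrightarrow> U t f x = U t g x"
  by (simp add: U_zero_def indicator_def flow_in_domain)

lemma strongly_continuous_at_cong:
  assumes "strongly_continuous_at f" and eq: "\<And>x. x \<in> \<Omega> \<Longrightarrow> f x = g x"
  shows "strongly_continuous_at g"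
proof -
  have mass: "lp_mass R p f = lp_mass R p g"
    using eq by (auto simp: lp_mass_def intro!: nn_integral_cong)
  have "f \<in> borel_measurable R \<longleftrightarrow> g \<in> borel_measurable R"
    using eq by (intro measurable_cong) auto
  then have "g \<in> lp_space R p"
    using assms mass by (simp add: strongly_continuous_at_def lp_space_iff_mass)
  moreover have "\<forall>\<^sub>F t in at_right 0. lp_mass R p (\<lambda>x. U t f x - f x) = lp_mass R p (\<lambda>x. U t g x - g x)"
    using eventually_nonneg by eventually_elim
      (use U_cong[OF eq] eq in \<open>auto simp: lp_mass_def intro!: nn_integral_cong\<close>)
  ultimately show ?thesis
    using assms(1) by (auto simp: strongly_continuous_at_def tendsto_cong)
qed

lemma strongly_continuous_at_add:
  assumes "strongly_continuous_at f" "strongly_continuous_at g"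
  shows "strongly_continuous_at (\<lambda>x. f x + g x)"
proof -
  have [measurable]: "f \<in> borel_measurable R" "g \<in> borel_measurable R"
    using assms by (auto simp: strongly_continuous_at_def lp_space_iff_mass)
  have "((\<lambda>t. ennreal (2 powr p) *
      (lp_mass R p (\<lambda>x. U t f x - f x) + lp_mass R p (\<lambda>x. U t g x - g x))) \<longlongrightarrow>
      ennreal (2 powr p) * (0 + 0)) (at_right 0)"
    using assms by (intro ennreal_tendsto_cmult tendsto_add) (auto simp: strongly_continuous_at_def)
  then have lim: "((\<lambda>t. ennreal (2 powr p) *
      (lp_mass R p (\<lambda>x. U t f x - f x) + lp_mass R p (\<lambda>x. U t g x - g x))) \<longlongrightarrow> 0) (at_right 0)"
    by simp
  have "((\<lambda>t. lp_mass R p (\<lambda>x. U t (\<lambda>x. f x + g x) x - (f x + g x))) \<longlongrightarrow> 0) (at_right 0)"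
  proof (rule tendsto_sandwich[OF _ _ tendsto_const lim])
    show "\<forall>\<^sub>F t in at_right 0. lp_mass R p (\<lambda>x. U t (\<lambda>x. f x + g x) x - (f x + g x))
      \<le> ennreal (2 powr p) *
      (lp_mass R p (\<lambda>x. U t f x - f x) + lp_mass R p (\<lambda>x. U t g x - g x))"
      using eventually_nonneg
    proof eventually_elim
      case (elim t)
      have "(\<lambda>x. U t (\<lambda>x. f x + g x) x - (f x + g x)) = (\<lambda>x. (U t f x - f x) + (U t g x - g x))"
        using U_lin[of t 1 f 1 g] by (auto simp: fun_eq_iff)
      moreover have "\<dots> \<in> borel_measurable R"
        using elim by measurable
      ultimately show ?case
        using elim p_pos by (auto intro!: lp_mass_add_le)
    qed
  qed auto
  then show ?thesis
    using assms lp_space_add[of f R p g] p_pos by (auto simp: strongly_continuous_at_def)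
qed

lemma strongly_continuous_at_cmult:
  assumes "strongly_continuous_at f"
  shows "strongly_continuous_at (\<lambda>x. c * f x)"
proof -
  have [measurable]: "f \<in> borel_measurable R"
    using assms by (auto simp: strongly_continuous_at_def lp_space_iff_mass)
  have "((\<lambda>t. ennreal (\<bar>c\<bar> powr p) * lp_mass R p (\<lambda>x. U t f x - f x)) \<longlongrightarrow>
      ennreal (\<bar>c\<bar> powr p) * 0) (at_right 0)"
    using assms by (intro ennreal_tendsto_cmult) (auto simp: strongly_continuous_at_def)
  moreover have "\<forall>\<^sub>F t in at_right 0. ennreal (\<bar>c\<bar> powr p) * lp_mass R p (\<lambda>x. U t f x - f x)
      = lp_mass R p (\<lambda>x. U t (\<lambda>x. c * f x) x - c * f x)"
    using eventually_nonneg
  proof eventually_elim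
    case (elim t)
    have "(\<lambda>x. U t (\<lambda>x. c * f x) x - c * f x) = (\<lambda>x. c * (U t f x - f x))"
      using U_lin[of t c f 0 f] by (auto simp: fun_eq_iff algebra_simps)
    then show ?case using elim by (simp add: lp_mass_cmult)
  qed
  ultimately show ?thesis
    using assms lp_space_cmult[of f R p c] by (simp add: strongly_continuous_at_def tendsto_cong)
qed

text \<open>Closedness: split \<open>U\<^sub>t f - f = U\<^sub>t (f - h) + (U\<^sub>t h - h) + (h - f)\<close> and use that \<open>U\<^sub>t\<close> is a
contraction.\<close>

lemma strongly_continuous_at_approx:
  assumes f: "f \<in> lp_space R p"
    and approx: "\<And>e::real. 0 < e \<Longrightarrow> \<exists>h. strongly_continuous_at h \<and> lp_mass R p (\<lambda>x. f x - h x) \<le> ennreal e"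
  shows "strongly_continuous_at f"
proof -
  let ?c = "ennreal (2 powr p)"
  have "((\<lambda>t. lp_mass R p (\<lambda>x. U t f x - f x)) \<longlongrightarrow> 0) (at_right 0)"
  proof (rule ennreal_tendsto_0I)
    fix e :: real assume e: "0 < e"
    obtain h where h: "strongly_continuous_at h" "lp_mass R p (\<lambda>x. f x - h x) \<le> ennreal e"
      using approx[OF e] by auto
    have [measurable]: "f \<in> borel_measurable R" "h \<in> borel_measurable R"
      using h(1) f by (auto simp: strongly_continuous_at_def lp_space_iff_mass)
    have "\<forall>\<^sub>F t in at_right 0. lp_mass R p (\<lambda>x. U t h x - h x) < ennreal e"
      using h(1) e by (auto simp: strongly_continuous_at_def order_tendsto_iff)
    then show "\<forall>\<^sub>F t in at_right 0. lp_mass R p (\<lambda>x. U t f x - f x) \<le> ?c * (1 + ?c * (1 + 1)) * ennreal e"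
      using eventually_nonneg
    proof eventually_elim
      case (elim t)
      have [measurable]: "U t f \<in> borel_measurable R" "U t h \<in> borel_measurable R"
          "U t (\<lambda>x. f x - h x) \<in> borel_measurable R"
        using elim by measurable
      have "lp_mass R p (\<lambda>x. h x - f x) = lp_mass R p (\<lambda>x. f x - h x)"
        by (simp add: lp_mass_def abs_minus_commute)
      then have 1: "lp_mass R p (\<lambda>x. (U t h x - h x) + (h x - f x)) \<le> ?c * (ennreal e + ennreal e)"
        using h(2) elim p_pos
        by (intro order_trans[OF lp_mass_add_le] mult_left_mono add_mono) auto
      have "lp_mass R p (\<lambda>x. U t f x - f x)
          = lp_mass R p (\<lambda>x. U t (\<lambda>x. f x - h x) x + ((U t h x - h x) + (h x - f x)))"
        by (simp add: U_diff)
      also have "\<dots> \<le> ?c * (lp_mass R p (U t (\<lambda>x. f x - h x))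
          + lp_mass R p (\<lambda>x. (U t h x - h x) + (h x - f x)))"
        using p_pos by (intro lp_mass_add_le) auto
      also have "\<dots> \<le> ?c * (ennreal e + ?c * (ennreal e + ennreal e))"
        using 1 h(2) lp_mass_U_le[of "\<lambda>x. f x - h x" t] elim
        by (intro mult_left_mono add_mono) auto
      also have "\<dots> = ?c * (1 + ?c * (1 + 1)) * ennreal e"
        by (simp only: distrib_left distrib_right mult_1_left mult_1_right
            mult.assoc mult.commute mult.left_commute)
      finally show ?case .
    qed
  qed (auto simp: ennreal_mult_less_top)
  then show ?thesis using f by (simp add: strongly_continuous_at_def)
qed

lemma lp_mass_indicator:
  assumes "A \<in> sets borel"
  shows "lp_mass R p (indicator A) = emeasure M (A \<inter> \<Omega>)"
proof -
  have "lp_mass R p (indicator A) = (\<integral>\<^sup>+x. indicator (A \<inter> \<Omega>) x \<partial>M)"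
    using p_pos unfolding lp_mass_def
    by (subst nn_integral_restrict_space) (auto intro!: nn_integral_cong simp: indicator_def)
  then show ?thesis using assms by simp
qed

lemma measurable_R: "f \<in> borel_measurable borel \<Longrightarrow> f \<in> borel_measurable R"
  by (rule measurable_restrict_space1) (simp cong: measurable_cong_sets)

lemma measurable_indicator_R [measurable]:
  "A \<in> sets borel \<Longrightarrow> (indicator A :: _ \<Rightarrow> real) \<in> borel_measurable R"
  by (intro measurable_R borel_measurable_indicator)

text \<open>For short times the translate of \<open>K\<close> stays inside \<open>\<Omega>\<close>, so \<open>U\<^sub>t\<close> maps the indicator of
\<open>K\<close> to that of the translate \<open>Kt t\<close>. As the flow preserves the measure, the two halves of the
symmetric difference of \<open>K\<close> and \<open>Kt t\<close> are equally large, and the half outside of \<open>K\<close>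
shrinks to the empty set because \<open>K\<close> is closed.\<close>

lemma strongly_continuous_at_compact:
  assumes K: "compact K" "K \<subseteq> \<Omega>"
  shows "strongly_continuous_at (indicator K)"
proof -
  have [measurable]: "K \<in> sets borel" using K by (simp add: compact_imp_closed borel_closed)
  obtain \<delta> where \<delta>: "0 < \<delta>" "\<And>x t. x \<in> K \<Longrightarrow> \<bar>t\<bar> \<le> \<delta> \<Longrightarrow> \<Phi> x t \<in> \<Omega>"
    using short_time_in_open[OF K open_domain] by blast
  define Kt where "Kt = (\<lambda>t. (\<lambda>x. \<Phi> x (- t)) -` K)"
  have Kt [measurable]: "Kt t \<in> sets borel" for t
    using measurable_sets[of "\<lambda>x. \<Phi> x (- t)" borel borel K] by (simp add: Kt_def)
  have in_domain: "x \<in> \<Omega>" "ereal t < \<tau> x" if "x \<in> Kt t" "0 \<le> t" "t \<le> \<delta>" for x t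
  proof -
    have *: "\<forall>s\<in>{0..t}. \<Phi> x (- 1 * s) \<in> \<Omega>"
    proof
      fix s assume "s \<in> {0..t}"
      then show "\<Phi> x (- 1 * s) \<in> \<Omega>"
        using \<delta>(2)[of "\<Phi> x (- t)" "t - s"] that by (simp add: Kt_def flow_flow)
    qed
    from this[rule_format, of 0] show "x \<in> \<Omega>" using that by simp
    then show "ereal t < \<tau> x" using * less_exit_time_iff[of x t "- 1"] that by simp
  qed
  have fin: "emeasure M K < \<infinity>" using K compact_finite by auto
  have Kt_mass: "emeasure M (Kt t) = emeasure M K" for t
    using invariant[of K t] vimage_flow[of "- t" K] by (simp add: Kt_def)
  have eq: "lp_mass R p (\<lambda>x. U t (indicator K) x - indicator K x) = 2 * emeasure M (Kt t - K)"
    if t: "0 \<le> t" "t \<le> \<delta>" for t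
  proof -
    have "U t (indicator K) x = indicator (Kt t) x" if "x \<in> \<Omega>" for x
      using in_domain(2)[of x t] t by (auto simp: U_zero_def indicator_def Kt_def)
    then have *: "ennreal (\<bar>U t (indicator K) x - indicator K x\<bar> powr p) * indicator \<Omega> x
        = indicator (Kt t - K) x + indicator (K - Kt t) x" for x
      using in_domain(1)[of x t] t K p_pos by (cases "x \<in> \<Omega>") (auto simp: indicator_def)
    have "lp_mass R p (\<lambda>x. U t (indicator K) x - indicator K x)
        = (\<integral>\<^sup>+x. indicator (Kt t - K) x + indicator (K - Kt t) x \<partial>M)"
      unfolding lp_mass_def *[symmetric] by (rule nn_integral_restrict_space) simp
    also have "\<dots> = emeasure M (Kt t - K) + emeasure M (K - Kt t)"
      by (subst nn_integral_add) auto
    finally have "lp_mass R p (\<lambda>x. U t (indicator K) x - indicator K x)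
        = emeasure M (Kt t - K) + emeasure M (K - Kt t)" .
    moreover have "emeasure M (K - Kt t) = emeasure M (Kt t - K)"
    proof -
      have "emeasure M (K \<inter> Kt t) \<noteq> \<infinity>"
        using fin emeasure_mono[of "K \<inter> Kt t" K M] by (auto simp: less_top top_unique)
      then have "emeasure M (K - K \<inter> Kt t) = emeasure M K - emeasure M (K \<inter> Kt t)"
        "emeasure M (Kt t - K \<inter> Kt t) = emeasure M (Kt t) - emeasure M (K \<inter> Kt t)"
        by (auto intro!: emeasure_Diff)
      moreover have "K - K \<inter> Kt t = K - Kt t" "Kt t - K \<inter> Kt t = Kt t - K" by auto
      ultimately show ?thesis by (simp add: Kt_mass)
    qed
    ultimately show ?thesis by (simp add: mult_2)
  qed
  have lim: "((\<lambda>t. emeasure M (Kt t - K)) \<longlongrightarrow> 0) (at_right 0)"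
  proof (rule tendsto_at_right_sequentially[OF \<delta>(1)])
    fix S :: "nat \<Rightarrow> real"
    assume S: "\<And>n. 0 < S n" "\<And>n. S n < \<delta>" "S \<longlonglongrightarrow> 0"
    define K' where "K' = (\<lambda>z. \<Phi> (fst z) (snd z)) ` (K \<times> {0..\<delta>})"
    have "compact K'"
      unfolding K'_def using K
      by (intro compact_continuous_image continuous_on_subset[OF continuous_on_flow] compact_Times) auto
    then have [measurable]: "K' \<in> sets borel" and "emeasure M K' < \<infinity>"
      using compact_finite by (auto simp: compact_imp_closed borel_closed)
    have sub: "Kt (S n) \<subseteq> K'" for n
    proof
      fix x assume "x \<in> Kt (S n)"
      then have "(\<Phi> x (- S n), S n) \<in> K \<times> {0..\<delta>}"
        using S(1,2)[of n] by (auto simp: Kt_def)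
      then show "x \<in> K'"
        unfolding K'_def by (intro image_eqI[of _ _ "(\<Phi> x (- S n), S n)"]) auto
    qed
    have "(\<lambda>n. \<integral>\<^sup>+x. indicator (Kt (S n) - K) x \<partial>M) \<longlonglongrightarrow> (\<integral>\<^sup>+x. 0 \<partial>M)"
    proof (rule nn_integral_dominated_convergence[where w = "indicator K'"])
      show "AE x in M. (\<lambda>n. indicator (Kt (S n) - K) x :: ennreal) \<longlonglongrightarrow> 0"
      proof (intro AE_I2)
        fix x
        have "\<forall>\<^sub>F n in sequentially. indicator (Kt (S n) - K) x = (0::ennreal)"
        proof (cases "x \<in> K")
          case False
          have "isCont (\<lambda>t. \<Phi> x (- t)) 0"
            using continuous_on_flow_compose[of UNIV "\<lambda>_. x" "\<lambda>t. - t"]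
            by (auto simp: continuous_on_eq_continuous_at continuous_intros)
          then have "(\<lambda>n. \<Phi> x (- S n)) \<longlonglongrightarrow> \<Phi> x (- 0)"
            using isCont_tendsto_compose S(3) by blast
          then have "\<forall>\<^sub>F n in sequentially. \<Phi> x (- S n) \<in> - K"
            using False K by (intro topological_tendstoD) (auto simp: compact_imp_closed)
          then show ?thesis by eventually_elim (auto simp: Kt_def)
        qed auto
        then show "(\<lambda>n. indicator (Kt (S n) - K) x :: ennreal) \<longlonglongrightarrow> 0"
          by (rule tendsto_eventually)
      qed
      show "(\<integral>\<^sup>+x. indicator K' x \<partial>M) < \<infinity>" using \<open>emeasure M K' < \<infinity>\<close> by simp
      show "AE x in M. indicator (Kt (S n) - K) x \<le> (indicator K' x :: ennreal)" for n
        using sub[of n] by (intro AE_I2) (auto simp: indicator_def)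
    qed auto
    then show "(\<lambda>n. emeasure M (Kt (S n) - K)) \<longlonglongrightarrow> 0" by simp
  qed
  have "((\<lambda>t. 2 * emeasure M (Kt t - K)) \<longlongrightarrow> 2 * 0) (at_right 0)"
    using lim by (intro ennreal_tendsto_cmult) auto
  moreover have "\<forall>\<^sub>F t in at_right 0. 2 * emeasure M (Kt t - K)
      = lp_mass R p (\<lambda>x. U t (indicator K) x - indicator K x)"
    using \<delta>(1) by (auto simp: eventually_at_right[of 0 1] eq intro!: exI[of _ \<delta>])
  ultimately have "((\<lambda>t. lp_mass R p (\<lambda>x. U t (indicator K) x - indicator K x)) \<longlongrightarrow> 0) (at_right 0)"
    by (simp add: tendsto_cong)
  moreover have "indicator K \<in> lp_space R p"
    using fin K by (auto simp: lp_space_iff_mass lp_mass_indicator Int_absorb2)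
  ultimately show ?thesis
    by (simp add: strongly_continuous_at_def)
qed

text \<open>Inner regularity, applied to the finite measure obtained by restricting \<open>M\<close> to \<open>A\<close>.\<close>

lemma strongly_continuous_at_indicator:
  assumes A [measurable]: "A \<in> sets borel" and "A \<subseteq> \<Omega>" and fin: "emeasure M A < \<infinity>"
  shows "strongly_continuous_at (indicator A)"
proof (rule strongly_continuous_at_approx)
  show "indicator A \<in> lp_space R p"
    using assms by (auto simp: lp_space_iff_mass lp_mass_indicator Int_absorb2)
  fix e :: real assume e: "0 < e"
  define N where "N = density M (indicator A)"
  have [simp]: "sets N = sets borel" by (simp add: N_def)
  have N: "emeasure N B = emeasure M (A \<inter> B)" if "B \<in> sets borel" for B
    using that by (simp add: N_def emeasure_restricted)
  have NA: "emeasure N A = (SUP K\<in>{K. K \<subseteq> A \<and> compact K}. emeasure N K)"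
    by (rule inner_regular) (use fin N[of UNIV] sets_eq_imp_space_eq[of N borel] in auto)
  obtain K where K: "compact K" "K \<subseteq> A" "emeasure M A \<le> emeasure M K + ennreal e"
  proof (cases "emeasure M A = 0")
    case True
    then show ?thesis using that[of "{}"] by simp
  next
    case False
    have "emeasure M A - ennreal e < emeasure N A"
      using False fin e by (simp add: N ennreal_between zero_less_iff_neq_zero)
    then obtain K where K: "K \<subseteq> A" "compact K" "emeasure M A - ennreal e < emeasure N K"
      unfolding NA less_SUP_iff by auto
    then have "emeasure N K = emeasure M K"
      by (simp add: N compact_imp_closed borel_closed Int_absorb1)
    then show ?thesis
      using K that[of K] by (auto simp: ennreal_minus_le_iff add.commute dest: less_imp_le)
  qed
  have [measurable]: "K \<in> sets borel" using K by (simp add: compact_imp_closed borel_closed)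
  have "(\<lambda>x. indicator A x - indicator K x :: real) = indicator (A - K)"
    using K by (auto simp: fun_eq_iff indicator_def)
  then have "lp_mass R p (\<lambda>x. indicator A x - indicator K x) = emeasure M (A - K)"
    using assms by (simp add: lp_mass_indicator) (metis Diff_subset Int_absorb2 order_trans)
  also have "\<dots> = emeasure M A - emeasure M K"
    using K compact_finite[of K] by (intro emeasure_Diff) auto
  also have "\<dots> \<le> ennreal e"
    using K(3) fin by (auto simp: ennreal_minus_le_iff add.commute)
  finally show "\<exists>h. strongly_continuous_at h \<and> lp_mass R p (\<lambda>x. indicator A x - h x) \<le> ennreal e"
    using strongly_continuous_at_compact[of K] K assms(2) by blast
qed

lemma strongly_continuous_at_simple:
  assumes s: "simple_function R s" "s \<in> lp_space R p"
  shows "strongly_continuous_at s"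
proof -
  define A where "A = (\<lambda>y. s -` {y} \<inter> \<Omega>)"
  have A [measurable]: "A y \<in> sets borel" for y
  proof -
    have "A y \<in> sets R"
      using simple_functionD(2)[OF s(1), of "{y}"] unfolding A_def by (simp only: space_R)
    then show ?thesis by (subst (asm) sets_restrict_space_iff) auto
  qed
  have fin: "finite (s ` \<Omega>)" using simple_functionD(1)[OF s(1)] by simp
  have zero: "strongly_continuous_at (\<lambda>x. 0)"
    using strongly_continuous_at_indicator[of "{}"] by (simp add: indicator_def[abs_def])
  have scaled: "strongly_continuous_at (\<lambda>x. y * indicator (A y) x)" for y
  proof (cases "y = 0")
    case False
    have "ennreal (\<bar>y\<bar> powr p) * emeasure M (A y) = (\<integral>\<^sup>+x. ennreal (\<bar>y\<bar> powr p) * indicator (A y) x \<partial>M)"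
      by (simp add: nn_integral_cmult_indicator)
    also have "\<dots> \<le> lp_mass R p s"
      unfolding lp_mass_def
      by (subst nn_integral_restrict_space) (auto intro!: nn_integral_mono simp: A_def indicator_def)
    also have "\<dots> < \<infinity>" using s(2) by (simp add: lp_space_iff_mass)
    finally have "emeasure M (A y) < \<infinity>"
      using False p_pos by (auto simp: ennreal_mult_less_top ennreal_eq_0_iff powr_eq_0_iff)
    moreover have "A y \<subseteq> \<Omega>" by (simp add: A_def)
    ultimately show ?thesis
      using A by (intro strongly_continuous_at_cmult strongly_continuous_at_indicator)
  qed (use zero in simp)
  have "strongly_continuous_at (\<lambda>x. \<Sum>y\<in>Y. y * indicator (A y) x)" if "finite Y" for Y
    using that
  proof (induction Y)
    case (insert y Y)
    show ?case
      unfolding sum.insert[OF insert(1,2)] by (intro strongly_continuous_at_add scaled insert.IH)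
  qed (use zero in simp)
  from this[OF fin] show ?thesis
  proof (rule strongly_continuous_at_cong)
    fix x assume "x \<in> \<Omega>"
    then have "(\<Sum>y\<in>s ` \<Omega>. y * indicator (A y) x) = (\<Sum>y\<in>{s x}. y * indicator (A y) x)"
      using fin by (intro sum.mono_neutral_right) (auto simp: A_def indicator_def)
    then show "(\<Sum>y\<in>s ` \<Omega>. y * indicator (A y) x) = s x"
      using \<open>x \<in> \<Omega>\<close> by (simp add: A_def)
  qed
qed

text \<open>Simple functions that converge to \<open>f\<close> pointwise and are bounded by \<open>2 \<bar>f\<bar>\<close> also converge in
the \<open>p\<close>-th mean, by dominated convergence.\<close>

lemma U_strongly_continuous:
  assumes f: "f \<in> lp_space R p"
  shows "((\<lambda>t. lp_mass R p (\<lambda>x. U t f x - f x)) \<longlongrightarrow> 0) (at_right 0)"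
proof -
  have [measurable]: "f \<in> borel_measurable R" using f by (simp add: lp_space_iff_mass)
  obtain s where "\<forall>i. simple_function R (s i)" "\<forall>x\<in>space R. (\<lambda>i. s i x) \<longlonglongrightarrow> f x"
    "\<forall>i. \<forall>x\<in>space R. dist (s i x) 0 \<le> 2 * dist (f x) 0"
    using borel_measurable_implies_sequence_metric[of f R 0] by auto
  note s = this[rule_format]
  have [measurable]: "s i \<in> borel_measurable R" for i
    using s(1) by (rule borel_measurable_simple_function)
  have bound: "lp_mass R p (\<lambda>x. c * f x) < \<infinity>" for c
    using lp_space_cmult[OF f, of c] by (simp add: lp_space_iff_mass)
  have "s i \<in> lp_space R p" for i
  proof -
    have "lp_mass R p (s i) \<le> lp_mass R p (\<lambda>x. 2 * f x)"
      unfolding lp_mass_def using s(3)[of _ i] p_pos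
      by (intro nn_integral_mono ennreal_leI powr_mono2) (auto simp: abs_mult)
    then show ?thesis using bound[of 2] by (auto simp: lp_space_iff_mass)
  qed
  then have sc: "strongly_continuous_at (s i)" for i
    using strongly_continuous_at_simple s(1) by blast
  have "(\<lambda>i. \<integral>\<^sup>+x. ennreal (\<bar>f x - s i x\<bar> powr p) \<partial>R) \<longlonglongrightarrow> (\<integral>\<^sup>+x. 0 \<partial>R)"
  proof (rule nn_integral_dominated_convergence[where w = "\<lambda>x. ennreal (\<bar>3 * f x\<bar> powr p)"])
    show "AE x in R. ennreal (\<bar>f x - s i x\<bar> powr p) \<le> ennreal (\<bar>3 * f x\<bar> powr p)" for i
    proof (intro AE_I2 ennreal_leI powr_mono2)
      fix x assume "x \<in> space R"
      from s(3)[OF this, of i] show "\<bar>f x - s i x\<bar> \<le> \<bar>3 * f x\<bar>" by simp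
    qed (use p_pos in auto)
    show "(\<integral>\<^sup>+x. ennreal (\<bar>3 * f x\<bar> powr p) \<partial>R) < \<infinity>"
      using bound[of 3] by (simp add: lp_mass_def)
    show "AE x in R. (\<lambda>i. ennreal (\<bar>f x - s i x\<bar> powr p)) \<longlonglongrightarrow> 0"
    proof (intro AE_I2)
      fix x assume "x \<in> space R"
      from s(2)[OF this] have "(\<lambda>i. \<bar>f x - s i x\<bar>) \<longlonglongrightarrow> \<bar>f x - f x\<bar>"
        by (intro tendsto_intros)
      then have "(\<lambda>i. \<bar>f x - s i x\<bar> powr p) \<longlonglongrightarrow> 0"
        using p_pos by (intro tendsto_zero_powrI[where b = p]) auto
      from tendsto_ennrealI[OF this] show "(\<lambda>i. ennreal (\<bar>f x - s i x\<bar> powr p)) \<longlonglongrightarrow> 0" by simp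
    qed
  qed auto
  then have lim: "(\<lambda>i. lp_mass R p (\<lambda>x. f x - s i x)) \<longlonglongrightarrow> 0" by (simp add: lp_mass_def)
  have "strongly_continuous_at f"
  proof (rule strongly_continuous_at_approx[OF f])
    fix e :: real assume "0 < e"
    then have "\<forall>\<^sub>F i in sequentially. lp_mass R p (\<lambda>x. f x - s i x) < ennreal e"
      using lim by (auto simp: order_tendsto_iff)
    then obtain i where "lp_mass R p (\<lambda>x. f x - s i x) < ennreal e"
      by (auto simp: eventually_sequentially)
    then show "\<exists>h. strongly_continuous_at h \<and> lp_mass R p (\<lambda>x. f x - h x) \<le> ennreal e"
      using sc[of i] by (auto intro: less_imp_le)
  qed
  then show ?thesis by (simp add: strongly_continuous_at_def)
qed

end

section \<open>The integral equation for the generator\<close>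

lemma set_integrable_Icc_shift:
  fixes u :: "real \<Rightarrow> real"
  assumes u: "set_integrable lborel {0..a + b} u" and a: "0 \<le> a" and b: "0 \<le> b"
  shows "set_integrable lborel {0..b} (\<lambda>s. u (a + s))"
    and set_integral_Icc_shift:
      "(LINT s:{0..b}|lborel. u (a + s)) = (LINT s:{0..a + b}|lborel. u s) - (LINT s:{0..a}|lborel. u s)"
proof -
  have ab: "set_integrable lborel {a..a + b} u" and a0: "set_integrable lborel {0..a} u"
    using a b by (auto intro!: set_integrable_subset[OF u])
  have shift: "indicator {a..a + b} (a + 1 * s) *\<^sub>R u (a + 1 * s) = indicator {0..b} s *\<^sub>R u (a + s)" for s
    by (auto simp: indicator_def)
  show "set_integrable lborel {0..b} (\<lambda>s. u (a + s))"
    using lborel_integrable_real_affine[of "\<lambda>s. indicator {a..a + b} s *\<^sub>R u s" 1 a] ab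
    unfolding shift set_integrable_def by simp
  have "(LINT s:{0..b}|lborel. u (a + s)) = (LINT s:{a..a + b}|lborel. u s)"
    using lborel_integral_real_affine[of 1 "\<lambda>s. indicator {a..a + b} s *\<^sub>R u s" a]
    unfolding shift set_lebesgue_integral_def by simp
  also have "\<dots> = (LINT s:{0..a + b}|lborel. u s) - (LINT s:{0..a}|lborel. u s)"
  proof -
    have "(LINT s:{0..a} \<union> {a..a + b}|lborel. u s)
        = (LINT s:{0..a}|lborel. u s) + (LINT s:{a..a + b}|lborel. u s)"
    proof (rule set_integral_Un_AE)
      show "AE x in lborel. \<not> (x \<in> {0..a} \<and> x \<in> {a..a + b})"
        using AE_lborel_singleton[of a] by eventually_elim auto
    qed (use ab a0 in auto)
    moreover have "{0..a} \<union> {a..a + b} = {0..a + b}" using a b by auto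
    ultimately show ?thesis by simp
  qed
  finally show "(LINT s:{0..b}|lborel. u (a + s))
      = (LINT s:{0..a + b}|lborel. u s) - (LINT s:{0..a}|lborel. u s)" .
qed

context flow_domain
begin

lemma measurable_time_integral_joint:
  assumes [measurable]: "g \<in> borel_measurable R"
  shows "(\<lambda>z. LINT s:{0..fst z}|lborel. U s g (snd z)) \<in> borel_measurable (lborel \<Otimes>\<^sub>M R)"
proof -
  have J: "(\<lambda>w. indicator {0..} (fst w) *\<^sub>R U (fst w) g (snd w)) \<in> borel_measurable (lborel \<Otimes>\<^sub>M R)"
    using measurable_U_joint[OF assms] by (simp add: split_beta')
  have [measurable]: "(\<lambda>w. indicator {0..} (snd w) *\<^sub>R U (snd w) g (snd (fst w)))
      \<in> borel_measurable ((lborel \<Otimes>\<^sub>M R) \<Otimes>\<^sub>M lborel)"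
  proof -
    have sw: "(\<lambda>w. (snd w, snd (fst w))) \<in> (lborel \<Otimes>\<^sub>M R) \<Otimes>\<^sub>M lborel \<rightarrow>\<^sub>M lborel \<Otimes>\<^sub>M R"
      by measurable
    show ?thesis using measurable_compose[OF sw J] by simp
  qed
  have "(\<lambda>w. indicator {w. 0 \<le> snd w \<and> snd w \<le> fst (fst w)} w
        *\<^sub>R (indicator {0..} (snd w) *\<^sub>R U (snd w) g (snd (fst w))))
      \<in> borel_measurable ((lborel \<Otimes>\<^sub>M R) \<Otimes>\<^sub>M lborel)"
    by measurable
  then have "(\<lambda>z. LINT s|lborel. indicator {w. 0 \<le> snd w \<and> snd w \<le> fst (fst w)} (z, s)
        *\<^sub>R (indicator {0..} s *\<^sub>R U s g (snd z))) \<in> borel_measurable (lborel \<Otimes>\<^sub>M R)"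
    by (intro lborel.borel_measurable_lebesgue_integral) (simp add: split_beta')
  also have "(\<lambda>z. LINT s|lborel. indicator {w. 0 \<le> snd w \<and> snd w \<le> fst (fst w)} (z, s)
        *\<^sub>R (indicator {0..} s *\<^sub>R U s g (snd z))) = (\<lambda>z. LINT s:{0..fst z}|lborel. U s g (snd z))"
    by (auto simp: set_lebesgue_integral_def indicator_def fun_eq_iff intro!: Bochner_Integration.integral_cong)
  finally show ?thesis .
qed

lemma measurable_time_integral [measurable]:
  assumes "g \<in> borel_measurable R"
  shows "(\<lambda>x. LINT s:{0..t}|lborel. U s g x) \<in> borel_measurable R"
  using measurable_compose[OF measurable_Pair1' measurable_time_integral_joint[OF assms], of t] by simp

lemma AE_U_time_integrable:
  assumes g: "g \<in> lp_space R p" and t: "0 < t"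
  shows "AE x in R. set_integrable lborel {0..t} (\<lambda>s. U s g x)"
proof (rule lp_time_integrable[where c = "lp_mass R p g" and p = p])
  show "(\<lambda>(s, x). indicator {0..} s *\<^sub>R U s g x) \<in> borel_measurable (lborel \<Otimes>\<^sub>M R)"
    using g by (intro measurable_U_joint) (simp add: lp_space_iff_mass)
qed (use t p_gt_1 g lp_mass_U_le[of g] R.sigma_finite_measure_axioms in \<open>auto simp: lp_space_iff_mass\<close>)

text \<open>The mean of \<open>U\<^sub>s k\<close> over \<open>0 \<le> s \<le> h\<close> differs from \<open>k\<close> by the mean of \<open>U\<^sub>s k - k\<close>,
whose norm is at most the supremum of the norms of these differences.\<close>

lemma U_average_tendsto:
  assumes k: "k \<in> lp_space R p"
  shows "((\<lambda>h. lp_mass R p (\<lambda>x. (LINT s:{0..h}|lborel. U s k x) / h - k x)) \<longlongrightarrow> 0) (at_right 0)"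
proof (rule ennreal_tendsto_0I[where C = 1])
  have [measurable]: "k \<in> borel_measurable R" using k by (simp add: lp_space_iff_mass)
  fix e :: real assume e: "0 < e"
  have "\<forall>\<^sub>F t in at_right 0. lp_mass R p (\<lambda>x. U t k x - k x) < ennreal e"
    using U_strongly_continuous[OF k] e by (auto simp: order_tendsto_iff)
  then obtain b where b: "0 < b" "\<And>t. 0 < t \<Longrightarrow> t < b \<Longrightarrow> lp_mass R p (\<lambda>x. U t k x - k x) < ennreal e"
    by (auto simp: eventually_at_right[of 0 1])
  have zero: "lp_mass R p (\<lambda>x. U 0 k x - k x) = 0"
    by (subst lp_mass_cong_AE[where g = "\<lambda>_. 0"]) (auto intro!: AE_I2 simp: U_0 lp_mass_def)
  have "lp_mass R p (\<lambda>x. (LINT s:{0..h}|lborel. U s k x) / h - k x) \<le> ennreal e"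
    if h: "0 < h" "h < b" for h
  proof -
    define v where "v = (\<lambda>s x. U s k x - k x)"
    have v: "lp_mass R p (v s) \<le> ennreal e" if "0 \<le> s" "s \<le> h" for s
      using b(2)[of s] that h zero by (cases "s = 0") (auto simp: v_def)
    have vm: "(\<lambda>(s, x). indicator {0..} s *\<^sub>R v s x) \<in> borel_measurable (lborel \<Otimes>\<^sub>M R)"
    proof -
      have J: "(\<lambda>w. indicator {0..} (fst w) *\<^sub>R U (fst w) k (snd w)) \<in> borel_measurable (lborel \<Otimes>\<^sub>M R)"
        using measurable_U_joint[of k] by (simp add: split_beta')
      have "(\<lambda>w. indicator {0..} (fst w) *\<^sub>R U (fst w) k (snd w) - indicator {0..} (fst w) *\<^sub>R k (snd w))
          \<in> borel_measurable (lborel \<Otimes>\<^sub>M R)"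
        by (intro borel_measurable_diff J) measurable
      then show ?thesis
        by (simp add: v_def split_beta' right_diff_distrib)
    qed
    have le: "lp_mass R p (\<lambda>x. LINT s:{0..h}|lborel. v s x) \<le> ennreal (h powr p) * ennreal e"
      using R.sigma_finite_measure_axioms vm h(1) p_gt_1 v by (intro lp_mass_time_integral_le) auto
    have "AE x in R. (LINT s:{0..h}|lborel. U s k x) / h - k x = (1 / h) * (LINT s:{0..h}|lborel. v s x)"
      using AE_U_time_integrable[OF k h(1)]
    proof eventually_elim
      case (elim x)
      have const: "set_integrable lborel {0..h} (\<lambda>_. k x)"
        using h by (auto simp: set_integrable_def intro!: integrable_real_indicator)
      have "(LINT s:{0..h}|lborel. v s x) = (LINT s:{0..h}|lborel. U s k x) - (LINT s:{0..h}|lborel. k x)"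
        unfolding v_def by (rule set_integral_diff(2)[OF elim const])
      also have "(LINT s:{0..h}|lborel. k x) = h * k x"
        using h by (simp add: set_lebesgue_integral_def)
      finally show ?case using h by (simp add: field_simps)
    qed
    then have "lp_mass R p (\<lambda>x. (LINT s:{0..h}|lborel. U s k x) / h - k x)
        = lp_mass R p (\<lambda>x. (1 / h) * (LINT s:{0..h}|lborel. v s x))"
      by (rule lp_mass_cong_AE)
    also have "\<dots> = ennreal (\<bar>1 / h\<bar> powr p) * lp_mass R p (\<lambda>x. LINT s:{0..h}|lborel. v s x)"
    proof (rule lp_mass_cmult)
      have "(\<lambda>w. indicator {0..h} (snd w) * (indicator {0..} (snd w) *\<^sub>R v (snd w) (fst w)))
          \<in> borel_measurable (R \<Otimes>\<^sub>M lborel)"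
        using measurable_compose[OF measurable_pair_swap' vm]
        by (intro borel_measurable_times) (auto simp: split_beta')
      then have "(\<lambda>x. LINT s|lborel. indicator {0..h} s * (indicator {0..} s *\<^sub>R v s x)) \<in> borel_measurable R"
        by (intro lborel.borel_measurable_lebesgue_integral) (simp add: split_beta')
      also have "(\<lambda>x. LINT s|lborel. indicator {0..h} s * (indicator {0..} s *\<^sub>R v s x))
          = (\<lambda>x. LINT s:{0..h}|lborel. v s x)"
        by (auto simp: set_lebesgue_integral_def indicator_def fun_eq_iff
            intro!: Bochner_Integration.integral_cong)
      finally show "(\<lambda>x. LINT s:{0..h}|lborel. v s x) \<in> borel_measurable R" .
    qed
    also have "\<dots> \<le> ennreal (\<bar>1 / h\<bar> powr p) * (ennreal (h powr p) * ennreal e)"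
      using le by (rule mult_left_mono) simp
    also have "\<dots> = ennreal ((1 / h) powr p * h powr p) * ennreal e"
      using h by (simp add: ennreal_mult mult.assoc)
    also have "(1 / h) powr p * h powr p = 1"
      using h by (simp flip: powr_mult)
    finally show ?thesis by simp
  qed
  then show "\<forall>\<^sub>F h in at_right 0. lp_mass R p (\<lambda>x. (LINT s:{0..h}|lborel. U s k x) / h - k x) \<le> 1 * ennreal e"
    using b(1) by (auto simp: eventually_at_right[of 0 1] intro!: exI[of _ b])
qed simp

text \<open>The evolution equation \<open>d/dt U\<^sub>t f = U\<^sub>t g\<close> in integrated form, with the integral taken
pointwise.\<close>

definition integral_equation :: "(real ^ 'n \<Rightarrow> real) \<Rightarrow> (real ^ 'n \<Rightarrow> real) \<Rightarrow> bool" where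
  "integral_equation f g \<longleftrightarrow>
     (\<forall>t>0. AE x in R. U t f x - f x = (LINT s:{0..t}|lborel. U s g x))"

lemma difference_quotient_lp:
  assumes f: "f \<in> lp_space R p" and t: "0 \<le> t"
  shows "(\<lambda>x. (U t f x - f x) / t) \<in> lp_space R p"
  using lp_space_cmult[OF lp_space_diff[OF lp_space_U[OF f t] f p_pos], of "1 / t"] by simp

lemma generator_iff_mass:
  assumes f: "f \<in> lp_space R p" and g: "g \<in> lp_space R p"
  shows "(f, g) \<in> generator_lp R p U \<longleftrightarrow>
    ((\<lambda>t. lp_mass R p (\<lambda>x. (U t f x - f x) / t - g x)) \<longlongrightarrow> 0) (at_right 0)"
proof -
  have "\<forall>\<^sub>F t in at_right 0. (\<lambda>x. (U t f x - f x) / t - g x) \<in> lp_space R p"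
    using eventually_nonneg
    by eventually_elim (intro lp_space_diff difference_quotient_lp f g p_pos)
  from lp_norm_tendsto_0_iff[OF this p_pos] show ?thesis
    using f g by (simp add: generator_lp_def)
qed

lemma generator_if_integral_equation:
  assumes f: "f \<in> lp_space R p" and g: "g \<in> lp_space R p" and "integral_equation f g"
  shows "(f, g) \<in> generator_lp R p U"
proof -
  have "\<forall>\<^sub>F t in at_right 0. lp_mass R p (\<lambda>x. (LINT s:{0..t}|lborel. U s g x) / t - g x)
      = lp_mass R p (\<lambda>x. (U t f x - f x) / t - g x)"
    using eventually_at_right_less
  proof eventually_elim
    case (elim t)
    then have "AE x in R. U t f x - f x = (LINT s:{0..t}|lborel. U s g x)"
      using assms(3) by (auto simp: integral_equation_def)
    then show ?case
      by (intro lp_mass_cong_AE) (elim eventually_mono, simp)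
  qed
  then show ?thesis
    using U_average_tendsto[OF g] by (simp add: generator_iff_mass[OF f g] tendsto_cong)
qed

text \<open>Put \<open>A\<^sub>h = (U\<^sub>h f - f) / h\<close> and \<open>k = U\<^sub>t f - f\<close>. By the semigroup law the integral of
\<open>U\<^sub>s A\<^sub>h\<close> over \<open>0 \<le> s \<le> t\<close> telescopes to the mean of \<open>U\<^sub>s k\<close> over \<open>0 \<le> s \<le> h\<close>. As
\<open>h\<close> tends to 0, the former tends to the integral of \<open>U\<^sub>s g\<close> and the latter to \<open>k\<close>. So the
difference \<open>D\<close> of these two limits has mass 0.\<close>

lemma integral_equation_if_generator:
  assumes "(f, g) \<in> generator_lp R p U"
  shows "integral_equation f g"
  unfolding integral_equation_def
proof safe
  fix t :: real assume t: "0 < t"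
  have f: "f \<in> lp_space R p" and g: "g \<in> lp_space R p"
    using assms by (auto simp: generator_lp_def)
  then have [measurable]: "f \<in> borel_measurable R" "g \<in> borel_measurable R"
    by (auto simp: lp_space_iff_mass)
  define A where "A = (\<lambda>h x. (U h f x - f x) / h)"
  have A: "A h \<in> lp_space R p" if "0 \<le> h" for h
    unfolding A_def using f that by (rule difference_quotient_lp)
  have A_lim: "((\<lambda>h. lp_mass R p (\<lambda>x. A h x - g x)) \<longlongrightarrow> 0) (at_right 0)"
    using assms generator_iff_mass[OF f g] by (simp add: A_def)
  define k where "k = (\<lambda>x. U t f x - f x)"
  have k: "k \<in> lp_space R p"
    unfolding k_def using t by (intro lp_space_diff lp_space_U f p_pos) simp
  then have [measurable]: "k \<in> borel_measurable R" by (simp add: lp_space_iff_mass)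
  define D where "D = (\<lambda>x. U t f x - f x - (LINT s:{0..t}|lborel. U s g x))"
  have [measurable]: "D \<in> borel_measurable R"
    unfolding D_def using less_imp_le[OF t] by measurable
  have bound: "lp_mass R p D \<le> ennreal (2 powr p) *
      (lp_mass R p (\<lambda>x. (LINT s:{0..h}|lborel. U s k x) / h - k x)
        + ennreal (t powr p) * lp_mass R p (\<lambda>x. A h x - g x))" if h: "0 < h" for h
  proof -
    have [measurable]: "A h \<in> borel_measurable R"
      using A[of h] h by (simp add: lp_space_iff_mass)
    have Ag: "(\<lambda>x. A h x - g x) \<in> lp_space R p"
      using h by (intro lp_space_diff A g p_pos) simp
    have th: "0 < t + h" using t h by simp
    have "AE x in R. D x = - ((LINT s:{0..h}|lborel. U s k x) / h - k x)
        + (LINT s:{0..t}|lborel. U s (\<lambda>x. A h x - g x) x)"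
      using AE_U_time_integrable[OF f th] AE_U_time_integrable[OF g t] AE_space
    proof eventually_elim
      case (elim x)
      then have x: "x \<in> \<Omega>" by simp
      have fi: "set_integrable lborel {0..r} (\<lambda>s. U s f x)" if "r \<le> t + h" for r
        using set_integrable_subset[OF elim(1), of "{0..r}"] that by auto
      have fi': "set_integrable lborel {0..h + t} (\<lambda>s. U s f x)" using fi by simp
      have ft: "set_integrable lborel {0..t} (\<lambda>s. U s f x)"
        and fh: "set_integrable lborel {0..h} (\<lambda>s. U s f x)" using fi t h by simp_all
      let ?W = "\<lambda>r. LINT s:{0..r}|lborel. U s f x"
      have "U s k x = U (t + s) f x - U s f x" if "0 \<le> s" for s
        using U_add[OF x that, of t f] t by (simp add: k_def U_diff add.commute)
      then have "(LINT s:{0..h}|lborel. U s k x) = (LINT s:{0..h}|lborel. U (t + s) f x - U s f x)"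
        by (intro set_lebesgue_integral_cong) auto
      also have "\<dots> = ?W (t + h) - ?W t - ?W h"
        using set_integrable_Icc_shift[OF elim(1)] set_integral_Icc_shift[OF elim(1)] t h
        by (subst set_integral_diff(2)[OF _ fh]) auto
      finally have 1: "(LINT s:{0..h}|lborel. U s k x) = ?W (t + h) - ?W t - ?W h" .
      have shift: "set_integrable lborel {0..t} (\<lambda>s. U (h + s) f x)"
        using set_integrable_Icc_shift[OF fi'] t h by simp
      have quot: "set_integrable lborel {0..t} (\<lambda>s. (U (h + s) f x - U s f x) / h)"
        by (intro set_integrable_divide set_integral_diff(1)[OF shift ft])
      have "U s (\<lambda>x. A h x - g x) x = (U (h + s) f x - U s f x) / h - U s g x" if "0 \<le> s" for s
        using U_add[OF x that, of h f] h by (simp add: A_def U_diff U_divide add.commute)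
      then have "(LINT s:{0..t}|lborel. U s (\<lambda>x. A h x - g x) x)
          = (LINT s:{0..t}|lborel. (U (h + s) f x - U s f x) / h - U s g x)"
        by (intro set_lebesgue_integral_cong) auto
      also have "\<dots> = (LINT s:{0..t}|lborel. (U (h + s) f x - U s f x) / h)
          - (LINT s:{0..t}|lborel. U s g x)"
        by (rule set_integral_diff(2)[OF quot elim(2)])
      also have "(LINT s:{0..t}|lborel. (U (h + s) f x - U s f x) / h)
          = (LINT s:{0..t}|lborel. U (h + s) f x - U s f x) / h"
        by (rule set_integral_divide_zero)
      also have "(LINT s:{0..t}|lborel. U (h + s) f x - U s f x) = ?W (t + h) - ?W h - ?W t"
        using set_integral_Icc_shift[OF fi'] t h
        by (subst set_integral_diff(2)[OF shift ft]) (auto simp: add.commute)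
      finally have 2: "(LINT s:{0..t}|lborel. U s (\<lambda>x. A h x - g x) x)
          = (?W (t + h) - ?W h - ?W t) / h - (LINT s:{0..t}|lborel. U s g x)" .
      show ?case
        unfolding 1 2 by (simp add: D_def k_def diff_divide_distrib)
    qed
    then have "lp_mass R p D = lp_mass R p (\<lambda>x. - ((LINT s:{0..h}|lborel. U s k x) / h - k x)
        + (LINT s:{0..t}|lborel. U s (\<lambda>x. A h x - g x) x))"
      by (rule lp_mass_cong_AE)
    also have "\<dots> \<le> ennreal (2 powr p) *
        (lp_mass R p (\<lambda>x. - ((LINT s:{0..h}|lborel. U s k x) / h - k x))
          + lp_mass R p (\<lambda>x. LINT s:{0..t}|lborel. U s (\<lambda>x. A h x - g x) x))"
      using p_pos by (intro lp_mass_add_le) measurable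
    also have "lp_mass R p (\<lambda>x. - ((LINT s:{0..h}|lborel. U s k x) / h - k x))
        = lp_mass R p (\<lambda>x. (LINT s:{0..h}|lborel. U s k x) / h - k x)"
      by (simp add: lp_mass_def abs_minus_commute)
    also have "lp_mass R p (\<lambda>x. LINT s:{0..t}|lborel. U s (\<lambda>x. A h x - g x) x)
        \<le> ennreal (t powr p) * lp_mass R p (\<lambda>x. A h x - g x)"
      using Ag t p_gt_1
      by (intro lp_mass_time_integral_le[OF R.sigma_finite_measure_axioms measurable_U_joint] lp_mass_U_le)
        (auto simp: lp_space_iff_mass)
    finally show ?thesis by (simp add: add_left_mono mult_left_mono)
  qed
  have "((\<lambda>h. ennreal (2 powr p) *
      (lp_mass R p (\<lambda>x. (LINT s:{0..h}|lborel. U s k x) / h - k x)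
        + ennreal (t powr p) * lp_mass R p (\<lambda>x. A h x - g x))) \<longlongrightarrow>
      ennreal (2 powr p) * (0 + ennreal (t powr p) * 0)) (at_right 0)"
    by (intro ennreal_tendsto_cmult tendsto_add U_average_tendsto k A_lim) auto
  then have "((\<lambda>h. ennreal (2 powr p) *
      (lp_mass R p (\<lambda>x. (LINT s:{0..h}|lborel. U s k x) / h - k x)
        + ennreal (t powr p) * lp_mass R p (\<lambda>x. A h x - g x))) \<longlongrightarrow> 0) (at_right 0)"
    by simp
  then have "lp_mass R p D \<le> 0"
    by (rule tendsto_lowerbound) (auto simp: bound intro: eventually_mono[OF eventually_at_right_less])
  then have "AE x in R. D x = 0"
    using p_pos by (intro lp_mass_eq_0_AE) auto
  then show "AE x in R. U t f x - f x = (LINT s:{0..t}|lborel. U s g x)"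
    by eventually_elim (simp add: D_def)
qed

end

section \<open>The generator is a restriction of the maximal operator\<close>

context flow_domain
begin

lemma integral_R:
  fixes f g :: "real ^ 'n \<Rightarrow> real"
  shows "(LINT x|R. f x * g x) = (LINT x|M. extend f x * extend g x)"
  by (subst integral_restrict_space)
    (auto simp: set_lebesgue_integral_def extend_def indicator_def intro!: Bochner_Integration.integral_cong)

lemma integrable_extend_times:
  assumes f: "f \<in> lp_space R p" and [measurable]: "q \<in> borel_measurable borel" "K \<in> sets borel"
    and q: "\<And>x. \<bar>q x\<bar> \<le> B * indicator K x" and K: "emeasure M K < \<infinity>"
  shows "integrable M (\<lambda>x. extend f x * q x)"
proof -
  have [measurable]: "f \<in> borel_measurable R" using f by (simp add: lp_space_iff_mass)
  have "integrable M (\<lambda>x. \<bar>extend f x\<bar> powr p)"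
    using f by (simp add: integrable_iff_bounded lp_space_iff_mass lp_mass_R)
  then have "integrable M (\<lambda>x. B * indicator K x + \<bar>B\<bar> * \<bar>extend f x\<bar> powr p :: real)"
    using K by (intro Bochner_Integration.integrable_add integrable_mult_right integrable_real_indicator) auto
  then show ?thesis
  proof (rule Bochner_Integration.integrable_bound)
    show "AE x in M. norm (extend f x * q x) \<le> norm (B * indicator K x + \<bar>B\<bar> * \<bar>extend f x\<bar> powr p)"
    proof (intro AE_I2)
      fix x
      show "norm (extend f x * q x) \<le> norm (B * indicator K x + \<bar>B\<bar> * \<bar>extend f x\<bar> powr p)"
      proof (cases "x \<in> K")
        case True
        then have B: "0 \<le> B" using q[of x] by simp
        have "\<bar>extend f x\<bar> \<le> 1 + \<bar>extend f x\<bar> powr p"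
        proof (cases "\<bar>extend f x\<bar> \<le> 1")
          case False
          then have "\<bar>extend f x\<bar> powr 1 \<le> \<bar>extend f x\<bar> powr p"
            using p_gt_1 by (intro powr_mono) auto
          then show ?thesis by simp
        qed (simp add: add_increasing2)
        then have "\<bar>extend f x\<bar> * \<bar>q x\<bar> \<le> (1 + \<bar>extend f x\<bar> powr p) * B"
          using q[of x] True by (intro mult_mono) auto
        then show ?thesis using True B by (simp add: abs_mult algebra_simps)
      qed (use q[of x] in simp)
    qed
  qed measurable
qed

text \<open>On a set of finite measure convergence in the \<open>p\<close>-th mean implies convergence in the mean, because
\<open>\<bar>y\<bar> \<le> e + e powr (1 - p) * \<bar>y\<bar> powr p\<close> for every \<open>e > 0\<close>.\<close>

lemma lp_mass_tendsto_imp_nn_integral_tendsto: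
  fixes w :: "'i \<Rightarrow> real ^ 'n \<Rightarrow> real"
  assumes w: "\<And>i. w i \<in> borel_measurable R" and K [measurable]: "K \<in> sets borel"
    and fin: "emeasure M K < \<infinity>" and lim: "((\<lambda>i. lp_mass R p (w i)) \<longlongrightarrow> 0) G"
  shows "((\<lambda>i. \<integral>\<^sup>+x. ennreal \<bar>extend (w i) x\<bar> * indicator K x \<partial>M) \<longlongrightarrow> 0) G"
proof (rule ennreal_tendsto_0I[where C = "emeasure M K + 1"])
  fix e :: real assume e: "0 < e"
  have "\<forall>\<^sub>F i in G. lp_mass R p (w i) < ennreal (e powr p)"
    using lim e by (auto simp: order_tendsto_iff)
  then show "\<forall>\<^sub>F i in G. (\<integral>\<^sup>+x. ennreal \<bar>extend (w i) x\<bar> * indicator K x \<partial>M) \<le> (emeasure M K + 1) * ennreal e"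
  proof eventually_elim
    case (elim i)
    note [measurable] = w[of i]
    have le: "\<bar>y\<bar> \<le> e + e powr (1 - p) * \<bar>y\<bar> powr p" for y :: real
    proof (cases "\<bar>y\<bar> \<le> e")
      case False
      then have "\<bar>y\<bar> powr (1 - p) \<le> e powr (1 - p)"
        using e p_gt_1 by (intro powr_mono2') auto
      then have "\<bar>y\<bar> powr (1 - p) * \<bar>y\<bar> powr p \<le> e powr (1 - p) * \<bar>y\<bar> powr p"
        by (rule mult_right_mono) simp
      then show ?thesis using False e by (simp add: powr_add[symmetric])
    qed (simp add: add_increasing2)
    have "(\<integral>\<^sup>+x. ennreal \<bar>extend (w i) x\<bar> * indicator K x \<partial>M)
        \<le> (\<integral>\<^sup>+x. ennreal e * indicator K x + ennreal (e powr (1 - p)) * ennreal (\<bar>extend (w i) x\<bar> powr p) \<partial>M)"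
    proof (rule nn_integral_mono)
      fix x
      have "ennreal \<bar>extend (w i) x\<bar> \<le> ennreal e + ennreal (e powr (1 - p)) * ennreal (\<bar>extend (w i) x\<bar> powr p)"
        using le[of "extend (w i) x"] e by (simp flip: ennreal_mult ennreal_plus)
      then show "ennreal \<bar>extend (w i) x\<bar> * indicator K x
          \<le> ennreal e * indicator K x + ennreal (e powr (1 - p)) * ennreal (\<bar>extend (w i) x\<bar> powr p)"
        by (auto simp: indicator_def)
    qed
    also have "\<dots> = ennreal e * emeasure M K + ennreal (e powr (1 - p)) * lp_mass R p (w i)"
      by (simp add: nn_integral_add nn_integral_cmult lp_mass_R)
    also have "\<dots> \<le> ennreal e * emeasure M K + ennreal (e powr (1 - p)) * ennreal (e powr p)"
      using elim by (intro add_left_mono mult_left_mono) auto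
    also have "ennreal (e powr (1 - p)) * ennreal (e powr p) = ennreal e"
      using e by (simp add: powr_add[symmetric] flip: ennreal_mult)
    finally show ?case by (simp add: algebra_simps)
  qed
qed (use fin in \<open>auto simp: less_top\<close>)

text \<open>Test the difference quotients of \<open>U\<^sub>h f\<close> with \<open>\<psi>\<close>. By invariance of the measure the shift moves
from \<open>f\<close> to \<open>\<psi>\<close>, and the difference quotients of \<open>\<psi>\<close> converge boundedly, with supports in a
fixed compact set, to the derivative of \<open>\<psi>\<close> along the flow.\<close>

lemma generator_weak_formulation:
  assumes gen: "(f, g) \<in> generator_lp R p U" and \<psi>: "\<psi> \<in> test_functions \<Phi> \<Omega>"
  shows "(LINT x|R. g x * \<psi> x) = (LINT x|R. f x * flow_deriv \<Phi> \<psi> x)"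
proof -
  let ?d = "flow_deriv \<Phi> \<psi>"
  have f: "f \<in> lp_space R p" and g: "g \<in> lp_space R p"
    using gen by (auto simp: generator_lp_def)
  then have [measurable]: "f \<in> borel_measurable R" "g \<in> borel_measurable R"
    by (auto simp: lp_space_iff_mass)
  have sets_R: "sets (restrict_space borel \<Omega>) = sets R"
    by (simp cong: sets_restrict_space_cong)
  have meas [measurable]: "\<psi> \<in> borel_measurable R" "?d \<in> borel_measurable R"
    using \<psi> by (auto simp: test_functions_def cong: measurable_cong_sets[OF sets_R refl])
  define K where "K = \<Omega> \<inter> closure {x \<in> \<Omega>. \<psi> x \<noteq> 0}"
  have K: "compact K" "K \<subseteq> \<Omega>" using \<psi> by (auto simp: K_def test_functions_def)
  have K_supp: "x \<in> K" if "extend \<psi> x \<noteq> 0" for x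
    using that closure_subset[of "{x \<in> \<Omega>. \<psi> x \<noteq> 0}"] by (auto simp: K_def extend_def indicator_def split: if_splits)
  have "bounded (\<psi> ` \<Omega>)" "bounded (?d ` \<Omega>)" using \<psi> by (auto simp: test_functions_def)
  then obtain B C where "0 < B" and B': "\<And>x. x \<in> \<Omega> \<Longrightarrow> \<bar>\<psi> x\<bar> \<le> B"
    and "0 < C" and C: "\<And>x. x \<in> \<Omega> \<Longrightarrow> \<bar>?d x\<bar> \<le> C"
    by (auto simp: bounded_pos)
  then have B: "\<bar>extend \<psi> x\<bar> \<le> B" for x by (simp add: extend_def indicator_def)
  \<comment> \<open>For \<open>h < \<delta>\<close> a characteristic that is in \<open>K\<close> at one end of a time interval of length \<open>h\<close> stays in \<open>\<Omega>\<close> during this interval.\<close>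
  obtain \<delta> where \<delta>: "0 < \<delta>" "\<And>x t. x \<in> K \<Longrightarrow> \<bar>t\<bar> \<le> \<delta> \<Longrightarrow> \<Phi> x t \<in> \<Omega>"
    using short_time_in_open[OF K open_domain] by blast
  define K' where "K' = (\<lambda>z. \<Phi> (fst z) (snd z)) ` (K \<times> {-\<delta>..\<delta>})"
  have "compact K'"
    unfolding K'_def using K
    by (intro compact_continuous_image continuous_on_subset[OF continuous_on_flow] compact_Times) auto
  then have [measurable]: "K' \<in> sets borel" and K'_fin: "emeasure M K' < \<infinity>"
    using compact_finite by (auto simp: compact_imp_closed borel_closed)
  have K'I: "z \<in> K'" if "\<Phi> z t \<in> K" "\<bar>t\<bar> \<le> \<delta>" for z t
    unfolding K'_def using that by (intro image_eqI[of _ _ "(\<Phi> z t, - t)"]) auto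
  have K_sub: "K \<subseteq> K'" using K'I[of _ 0] \<delta>(1) by auto
  have [measurable]: "K \<in> sets borel" using K by (simp add: compact_imp_closed borel_closed)
  have deriv: "((\<lambda>r. \<psi> (\<Phi> x r)) has_real_derivative ?d (\<Phi> x s)) (at s)"
    if "\<Phi> x s \<in> \<Omega>" for x s
  proof -
    have "(\<lambda>r. \<psi> (\<Phi> (\<Phi> x s) r)) C1_differentiable_on
        {r. - exit_time \<Phi> \<Omega> (-1) (\<Phi> x s) < ereal r \<and> ereal r < exit_time \<Phi> \<Omega> 1 (\<Phi> x s)}"
      using \<psi> that by (auto simp: test_functions_def)
    moreover have "- exit_time \<Phi> \<Omega> (-1) (\<Phi> x s) < ereal 0" "ereal 0 < exit_time \<Phi> \<Omega> 1 (\<Phi> x s)"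
      using exit_time_pos[OF that] by (auto simp: ereal_uminus_less_reorder zero_ereal_def[symmetric])
    ultimately obtain D where "((\<lambda>r. \<psi> (\<Phi> (\<Phi> x s) r)) has_vector_derivative D) (at 0)"
      unfolding C1_differentiable_on_def by blast
    then have D: "((\<lambda>r. \<psi> (\<Phi> (\<Phi> x s) r)) has_real_derivative D) (at 0)"
      by (simp add: has_real_derivative_iff_has_vector_derivative)
    then have "?d (\<Phi> x s) = D"
      by (simp add: flow_deriv_def DERIV_imp_deriv)
    then show ?thesis
      using D DERIV_shift[of "\<lambda>r. \<psi> (\<Phi> x r)" D 0 s] by (simp add: flow_flow add.commute)
  qed
  have diff_le: "\<bar>extend \<psi> (\<Phi> z h) - extend \<psi> z\<bar> \<le> C * h * indicator K' z"
    if h: "0 < h" "h < \<delta>" for z h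
  proof (cases "extend \<psi> (\<Phi> z h) = 0 \<and> extend \<psi> z = 0")
    case True
    then show ?thesis using h \<open>0 < C\<close> by simp
  next
    case False
    then have zK: "\<Phi> z h \<in> K \<or> z \<in> K" using K_supp by auto
    then have "z \<in> K'" using K'I[of z h] K_sub h by auto
    have path: "\<Phi> z r \<in> \<Omega>" if "0 \<le> r" "r \<le> h" for r
      using \<delta>(2)[of "\<Phi> z h" "r - h"] \<delta>(2)[of z r] zK h that by (auto simp: flow_flow)
    have "\<exists>r>0. r < h \<and> \<psi> (\<Phi> z h) - \<psi> (\<Phi> z 0) = (h - 0) * ?d (\<Phi> z r)"
      using h path by (intro MVT2 deriv) auto
    then obtain r where r: "0 < r" "r < h" "\<psi> (\<Phi> z h) - \<psi> z = h * ?d (\<Phi> z r)" by auto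
    have "\<bar>\<psi> (\<Phi> z h) - \<psi> z\<bar> \<le> h * C"
      using C[OF path[of r]] r h by (simp add: abs_mult mult_left_mono)
    then show ?thesis
      using path[of 0] path[of h] h \<open>z \<in> K'\<close> by (simp add: extend_def mult.commute)
  qed
  \<comment> \<open>The substitution \<open>x = \<Phi> z h\<close>; where \<open>\<psi> x \<noteq> 0\<close> the backward characteristic has not left \<open>\<Omega>\<close> by time \<open>h\<close>.\<close>
  have duality: "(LINT x|R. U h f x * \<psi> x) = (LINT z|M. extend f z * extend \<psi> (\<Phi> z h))"
    if h: "0 < h" "h < \<delta>" for h
  proof -
    have "extend (U h f) x * extend \<psi> x = extend f (\<Phi> x (- h)) * extend \<psi> x" for x
    proof (cases "extend \<psi> x = 0")
      case False
      then have x: "x \<in> K" by (rule K_supp)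
      then have "ereal h < \<tau> x"
        using \<delta>(2)[OF x] K h by (subst less_exit_time_iff) auto
      then show ?thesis
        using x K \<delta>(2)[OF x, of "- h"] h by (auto simp: extend_def U_eq)
    qed simp
    then have "(LINT x|R. U h f x * \<psi> x) = (LINT x|M. extend f (\<Phi> x (- h)) * extend \<psi> x)"
      by (simp only: integral_R)
    also have "\<dots> = (LINT z|M. extend f z * extend \<psi> (\<Phi> z h))"
      by (subst integral_flow[of _ h, symmetric]) auto
    finally show ?thesis .
  qed
  define H where "H = (\<lambda>n. \<delta> / 2 * inverse (real (Suc n)))"
  have H: "0 < H n" "H n < \<delta>" for n using \<delta>(1) by (auto simp: H_def field_simps add_pos_nonneg)
  have H_lim: "H \<longlonglongrightarrow> 0"
    unfolding H_def by (intro tendsto_mult_right_zero LIMSEQ_inverse_real_of_nat)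
  then have H_right: "filterlim H (at_right 0) sequentially"
    using H(1) by (intro tendsto_imp_filterlim_at_right) auto
  define w where "w = (\<lambda>n x. (U (H n) f x - f x) / H n)"
  have w: "w n \<in> lp_space R p" for n
    unfolding w_def using H(1)[of n] by (intro difference_quotient_lp f) simp
  have wm: "w n \<in> borel_measurable R" for n using w[of n] by (simp add: lp_space_iff_mass)
  have int: "integrable M (\<lambda>x. extend u x * extend \<psi> x)" if "u \<in> lp_space R p" for u
  proof (rule integrable_extend_times[OF that, where B = B and K = K])
    show "\<bar>extend \<psi> x\<bar> \<le> B * indicator K x" for x
      using B[of x] K_supp[of x] by (cases "x \<in> K") auto
    show "emeasure M K < \<infinity>" using K compact_finite by auto
  qed auto
  have "(\<lambda>n. LINT x|R. w n x * \<psi> x) \<longlonglongrightarrow> (LINT x|R. g x * \<psi> x)"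
  proof -
    have "((\<lambda>t. lp_mass R p (\<lambda>x. (U t f x - f x) / t - g x)) \<longlongrightarrow> 0) (at_right 0)"
      using gen generator_iff_mass[OF f g] by simp
    from filterlim_compose[OF this H_right]
    have "(\<lambda>n. lp_mass R p (\<lambda>x. w n x - g x)) \<longlonglongrightarrow> 0" by (simp add: w_def)
    then have "(\<lambda>n. \<integral>\<^sup>+x. ennreal \<bar>extend (\<lambda>x. w n x - g x) x\<bar> * indicator K x \<partial>M) \<longlonglongrightarrow> 0"
      using K compact_finite wm by (intro lp_mass_tendsto_imp_nn_integral_tendsto) auto
    then have "(\<lambda>n. ennreal B * (\<integral>\<^sup>+x. ennreal \<bar>extend (\<lambda>x. w n x - g x) x\<bar> * indicator K x \<partial>M)) \<longlonglongrightarrow> ennreal B * 0"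
      by (intro ennreal_tendsto_cmult) auto
    then have lim0: "(\<lambda>n. ennreal B * (\<integral>\<^sup>+x. ennreal \<bar>extend (\<lambda>x. w n x - g x) x\<bar> * indicator K x \<partial>M)) \<longlonglongrightarrow> 0"
      by simp
    have "(\<lambda>n. ennreal \<bar>(LINT x|R. w n x * \<psi> x) - (LINT x|R. g x * \<psi> x)\<bar>) \<longlonglongrightarrow> 0"
    proof (rule tendsto_sandwich[OF _ _ tendsto_const lim0])
      show "\<forall>\<^sub>F n in sequentially. ennreal \<bar>(LINT x|R. w n x * \<psi> x) - (LINT x|R. g x * \<psi> x)\<bar>
        \<le> ennreal B * (\<integral>\<^sup>+x. ennreal \<bar>extend (\<lambda>x. w n x - g x) x\<bar> * indicator K x \<partial>M)"
      proof (intro always_eventually allI)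
        fix n
        have wg: "(\<lambda>x. w n x - g x) \<in> lp_space R p" by (intro lp_space_diff w g p_pos)
        have "(LINT x|R. w n x * \<psi> x) - (LINT x|R. g x * \<psi> x)
            = (LINT x|M. extend (w n) x * extend \<psi> x - extend g x * extend \<psi> x)"
          unfolding integral_R
          by (rule Bochner_Integration.integral_diff[OF int[OF w] int[OF g], symmetric])
        also have "\<dots> = (LINT x|M. extend (\<lambda>x. w n x - g x) x * extend \<psi> x)"
          by (simp add: extend_def algebra_simps)
        finally have "(LINT x|R. w n x * \<psi> x) - (LINT x|R. g x * \<psi> x)
            = (LINT x|M. extend (\<lambda>x. w n x - g x) x * extend \<psi> x)" .
        then have "ennreal \<bar>(LINT x|R. w n x * \<psi> x) - (LINT x|R. g x * \<psi> x)\<bar>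
            \<le> (\<integral>\<^sup>+x. ennreal \<bar>extend (\<lambda>x. w n x - g x) x * extend \<psi> x\<bar> \<partial>M)"
          using integral_norm_bound_ennreal[OF int[OF wg]] by simp
        also have "\<dots> \<le> (\<integral>\<^sup>+x. ennreal B * (ennreal \<bar>extend (\<lambda>x. w n x - g x) x\<bar> * indicator K x) \<partial>M)"
        proof (rule nn_integral_mono)
          fix x
          show "ennreal \<bar>extend (\<lambda>x. w n x - g x) x * extend \<psi> x\<bar>
              \<le> ennreal B * (ennreal \<bar>extend (\<lambda>x. w n x - g x) x\<bar> * indicator K x)"
          proof (cases "x \<in> K")
            case True
            have "\<bar>extend (\<lambda>x. w n x - g x) x * extend \<psi> x\<bar> \<le> B * \<bar>extend (\<lambda>x. w n x - g x) x\<bar>"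
              using B[of x] by (simp add: abs_mult mult.commute mult_right_mono)
            then show ?thesis using True \<open>0 < B\<close> by (simp flip: ennreal_mult)
          qed (use K_supp[of x] in auto)
        qed
        also have "\<dots> = ennreal B * (\<integral>\<^sup>+x. ennreal \<bar>extend (\<lambda>x. w n x - g x) x\<bar> * indicator K x \<partial>M)"
        proof (rule nn_integral_cmult)
          have [measurable]: "extend (\<lambda>x. w n x - g x) \<in> borel_measurable borel"
            using wm[of n] by (intro measurable_extend borel_measurable_diff) auto
          show "(\<lambda>x. ennreal \<bar>extend (\<lambda>x. w n x - g x) x\<bar> * indicator K x) \<in> borel_measurable M"
            by measurable
        qed
        finally show "ennreal \<bar>(LINT x|R. w n x * \<psi> x) - (LINT x|R. g x * \<psi> x)\<bar>
          \<le> ennreal B * (\<integral>\<^sup>+x. ennreal \<bar>extend (\<lambda>x. w n x - g x) x\<bar> * indicator K x \<partial>M)" .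
      qed
    qed auto
    then have "(\<lambda>n. \<bar>(LINT x|R. w n x * \<psi> x) - (LINT x|R. g x * \<psi> x)\<bar>) \<longlonglongrightarrow> 0"
      by (simp add: ennreal_tendsto_0_iff)
    then show ?thesis
      by (simp add: tendsto_rabs_zero_iff LIM_zero_iff)
  qed
  moreover have "(\<lambda>n. LINT x|R. w n x * \<psi> x) \<longlonglongrightarrow> (LINT x|R. f x * ?d x)"
  proof -
    have eq: "(LINT x|R. w n x * \<psi> x)
        = (LINT z|M. extend f z * ((extend \<psi> (\<Phi> z (H n)) - extend \<psi> z) / H n))" for n
    proof -
      have UR: "U (H n) f \<in> lp_space R p" using H(1)[of n] by (intro lp_space_U f) simp
      have shifted: "integrable M (\<lambda>z. extend f z * extend \<psi> (\<Phi> z (H n)))"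
      proof (rule integrable_extend_times[OF f, where B = B and K = K'])
        show "\<bar>extend \<psi> (\<Phi> z (H n))\<bar> \<le> B * indicator K' z" for z
          using B[of "\<Phi> z (H n)"] K_supp[of "\<Phi> z (H n)"] K'I[of z "H n"] H[of n] by (cases "z \<in> K'") auto
      qed (use K'_fin in auto)
      have "(LINT x|R. w n x * \<psi> x)
          = (LINT x|M. (extend (U (H n) f) x * extend \<psi> x - extend f x * extend \<psi> x) / H n)"
        unfolding integral_R by (simp add: w_def extend_def diff_divide_distrib algebra_simps)
      also have "\<dots> = ((LINT x|R. U (H n) f x * \<psi> x) - (LINT x|R. f x * \<psi> x)) / H n"
        unfolding integral_R by (simp add: int UR f)
      also have "\<dots> = ((LINT z|M. extend f z * extend \<psi> (\<Phi> z (H n))) - (LINT z|M. extend f z * extend \<psi> z)) / H n"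
        using duality[OF H] by (simp add: integral_R)
      also have "\<dots> = (LINT z|M. (extend f z * extend \<psi> (\<Phi> z (H n)) - extend f z * extend \<psi> z) / H n)"
        by (simp add: int f shifted)
      finally show ?thesis by (simp add: right_diff_distrib)
    qed
    have "(\<lambda>n. LINT z|M. extend f z * ((extend \<psi> (\<Phi> z (H n)) - extend \<psi> z) / H n))
        \<longlonglongrightarrow> (LINT z|M. extend f z * extend ?d z)"
    proof (rule integral_dominated_convergence[where w = "\<lambda>z. \<bar>extend f z * (C * indicator K' z)\<bar>"])
      show "integrable M (\<lambda>z. \<bar>extend f z * (C * indicator K' z)\<bar>)"
        using \<open>0 < C\<close> K'_fin
        by (intro integrable_abs integrable_extend_times[OF f, where B = C and K = K']) auto
      show "AE z in M. norm (extend f z * ((extend \<psi> (\<Phi> z (H n)) - extend \<psi> z) / H n))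
          \<le> \<bar>extend f z * (C * indicator K' z)\<bar>" for n
      proof (intro AE_I2)
        fix z
        have le: "\<bar>(extend \<psi> (\<Phi> z (H n)) - extend \<psi> z) / H n\<bar> \<le> C * indicator K' z"
          using diff_le[OF H, of z n] H(1)[of n] by (simp add: field_simps)
        show "norm (extend f z * ((extend \<psi> (\<Phi> z (H n)) - extend \<psi> z) / H n))
            \<le> \<bar>extend f z * (C * indicator K' z)\<bar>"
          using mult_left_mono[OF le, of "\<bar>extend f z\<bar>"] \<open>0 < C\<close> by (simp add: abs_mult)
      qed
      show "AE z in M. (\<lambda>n. extend f z * ((extend \<psi> (\<Phi> z (H n)) - extend \<psi> z) / H n))
          \<longlonglongrightarrow> extend f z * extend ?d z"
      proof (intro AE_I2)
        fix z
        show "(\<lambda>n. extend f z * ((extend \<psi> (\<Phi> z (H n)) - extend \<psi> z) / H n)) \<longlonglongrightarrow> extend f z * extend ?d z"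
        proof (cases "z \<in> \<Omega>")
          case True
          have "((\<lambda>h. (\<psi> (\<Phi> z (0 + h)) - \<psi> (\<Phi> z 0)) / h) \<longlongrightarrow> ?d (\<Phi> z 0)) (at 0)"
            using deriv[of z 0] True by (simp add: DERIV_def)
          then have "((\<lambda>h. (\<psi> (\<Phi> z h) - \<psi> z) / h) \<longlongrightarrow> ?d z) (at 0)" by simp
          moreover have "filterlim H (at 0) sequentially"
            using H_right by (rule filterlim_mono) (auto simp: at_le)
          ultimately have lim: "(\<lambda>n. (\<psi> (\<Phi> z (H n)) - \<psi> z) / H n) \<longlonglongrightarrow> ?d z"
            by (rule filterlim_compose)
          have "isCont (\<Phi> z) 0"
            using flow_has_vector_derivative has_vector_derivative_continuous by blast
          then have "(\<lambda>n. \<Phi> z (H n)) \<longlonglongrightarrow> \<Phi> z 0"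
            using isCont_tendsto_compose H_lim by blast
          then have "\<forall>\<^sub>F n in sequentially. \<Phi> z (H n) \<in> \<Omega>"
            using True open_domain by (intro topological_tendstoD) auto
          then have ev: "\<forall>\<^sub>F n in sequentially. (\<psi> (\<Phi> z (H n)) - \<psi> z) / H n
              = (extend \<psi> (\<Phi> z (H n)) - extend \<psi> z) / H n"
            by eventually_elim (use True in \<open>simp add: extend_def\<close>)
          have "(\<lambda>n. (extend \<psi> (\<Phi> z (H n)) - extend \<psi> z) / H n) \<longlonglongrightarrow> extend ?d z"
            using Lim_transform_eventually[OF lim ev] True by (simp add: extend_def)
          then show ?thesis by (intro tendsto_intros)
        qed (simp add: extend_def)
      qed
    qed measurable
    then show ?thesis by (simp add: eq integral_R)
  qed
  ultimately show ?thesis by (rule LIMSEQ_unique)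
qed

lemma generator_subset_T_max: "generator_lp R p U \<subseteq> T_max \<Phi> \<Omega> M p"
proof clarify
  fix f g assume "(f, g) \<in> generator_lp R p U"
  then show "(f, g) \<in> T_max \<Phi> \<Omega> M p"
    using generator_weak_formulation by (auto simp: T_max_def generator_lp_def)
qed

end

section \<open>Traces on the incoming boundary\<close>

lemma AE_lborel_shift:
  fixes P :: "real \<Rightarrow> bool"
  assumes "AE x in lborel. P x"
  shows "AE x in lborel. P (c + x)"
proof -
  from assms obtain N where N: "{x \<in> space lborel. \<not> P x} \<subseteq> N" "emeasure lborel N = 0" "N \<in> sets lborel"
    by (rule AE_E)
  have m: "(+) c -` N \<inter> space lborel \<in> sets lborel"
    using measurable_sets[of "\<lambda>x. c + x" borel borel N] N(3) by simp
  have "emeasure (distr lborel borel ((+) c)) N = 0"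
    using N(2) by (simp add: lborel_distr_plus)
  then have "emeasure lborel ((+) c -` N \<inter> space lborel) = 0"
    using N(3) by (subst (asm) emeasure_distr) auto
  with m have "(+) c -` N \<inter> space lborel \<in> null_sets lborel" by auto
  then show ?thesis
    by (rule AE_I') (use N(1) in auto)
qed

lemma AE_lborel_ex_between:
  fixes a b :: real
  assumes "AE s in lborel. P s" "a < b"
  obtains s where "a < s" "s < b" "P s"
proof -
  have "\<exists>s. a < s \<and> s < b \<and> P s"
  proof (rule ccontr)
    assume *: "\<nexists>s. a < s \<and> s < b \<and> P s"
    from assms(1) have "AE s in lborel. s \<notin> {a<..<b}"
      by eventually_elim (use * in auto)
    then have "emeasure lborel {a<..<b} = 0"
      by (subst (asm) AE_iff_measurable[of "{a<..<b}"]) auto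
    then show False using assms(2) by simp
  qed
  then show thesis using that by blast
qed

lemma set_integral_Icc_reflect:
  fixes u :: "real \<Rightarrow> real"
  shows set_integrable_Icc_reflect:
      "set_integrable lborel {0..b - a} (\<lambda>s. u (b - s)) \<longleftrightarrow> set_integrable lborel {a..b} u"
    and "(LINT s:{0..b - a}|lborel. u (b - s)) = (LINT s:{a..b}|lborel. u s)"
proof -
  have eq: "indicator {a..b} (b + (- 1) * s) *\<^sub>R u (b + (- 1) * s) = indicator {0..b - a} s *\<^sub>R u (b - s)" for s
    by (auto simp: indicator_def)
  show "set_integrable lborel {0..b - a} (\<lambda>s. u (b - s)) \<longleftrightarrow> set_integrable lborel {a..b} u"
    using lborel_integrable_real_affine_iff[of "- 1" "\<lambda>s. indicator {a..b} s *\<^sub>R u s" b]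
    unfolding eq set_integrable_def by simp
  show "(LINT s:{0..b - a}|lborel. u (b - s)) = (LINT s:{a..b}|lborel. u s)"
    using lborel_integral_real_affine[of "- 1" "\<lambda>s. indicator {a..b} s *\<^sub>R u s" b]
    unfolding eq set_lebesgue_integral_def by simp
qed

lemma continuous_on_set_integral_Icc:
  fixes u :: "real \<Rightarrow> real"
  assumes u: "set_integrable lborel {a..b} u"
  shows "continuous_on {a..b} (\<lambda>r. LINT s:{a..r}|lborel. u s)"
proof -
  have "continuous_on {a..b} (\<lambda>r. integral {a..r} u)"
    using set_borel_integral_eq_integral(1)[OF u] by (rule indefinite_integral_continuous_1)
  then show ?thesis
  proof (rule continuous_on_eq)
    fix r assume "r \<in> {a..b}"
    then show "integral {a..r} u = (LINT s:{a..r}|lborel. u s)"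
      by (intro set_borel_integral_eq_integral(2)[symmetric] set_integrable_subset[OF u]) auto
  qed
qed

text \<open>The fundamental theorem of calculus at the left end point.\<close>

lemma average_tendsto:
  fixes h :: "real \<Rightarrow> real"
  assumes h: "continuous_on {0..1} h"
  shows "(\<lambda>n. real (Suc n) * (LINT s:{0..inverse (real (Suc n))}|lborel. h s)) \<longlonglongrightarrow> h 0"
proof -
  have "((\<lambda>r. integral {0..r} h) has_vector_derivative h 0) (at 0 within {0..1})"
    by (rule integral_has_vector_derivative[OF h]) simp
  then have "((\<lambda>r. integral {0..r} h / r) \<longlongrightarrow> h 0) (at 0 within {0..1})"
    by (simp add: has_real_derivative_iff_has_vector_derivative[symmetric] has_field_derivative_iff)
  moreover have "filterlim (\<lambda>n. inverse (real (Suc n))) (at 0 within {0..1}) sequentially"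
    unfolding filterlim_at
    by (intro conjI always_eventually allI LIMSEQ_inverse_real_of_nat) (auto simp: field_simps)
  ultimately have "(\<lambda>n. integral {0..inverse (real (Suc n))} h / inverse (real (Suc n))) \<longlonglongrightarrow> h 0"
    by (rule filterlim_compose)
  moreover have "integral {0..inverse (real (Suc n))} h / inverse (real (Suc n))
      = real (Suc n) * (LINT s:{0..inverse (real (Suc n))}|lborel. h s)" for n
  proof -
    have "inverse (real (Suc n)) \<le> 1" by (simp add: field_simps)
    then have "continuous_on {0..inverse (real (Suc n))} h"
      by (intro continuous_on_subset[OF h]) auto
    then have "set_integrable lborel {0..inverse (real (Suc n))} h"
      using borel_integrable_atLeastAtMost' by blast
    then show ?thesis
      by (simp add: set_borel_integral_eq_integral(2) divide_inverse mult.commute)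
  qed
  ultimately show ?thesis by simp
qed

context flow_domain
begin

lemma time_integral_tail:
  assumes x: "x \<in> \<Omega>" and T: "\<tau> x = ereal T" "T \<le> t"
  shows "(LINT s:{0..t}|lborel. U s g x) = (LINT s:{0..T}|lborel. U s g x)"
  unfolding set_lebesgue_integral_def
  by (intro Bochner_Integration.integral_cong refl) (use T in \<open>auto simp: indicator_def U_eq_0\<close>)

lemma time_integral_left_limit:
  assumes u: "set_integrable lborel {0..T} u" and T: "0 < (T::real)"
  shows "((\<lambda>e. LINT s:{0..T - e}|lborel. u s) \<longlongrightarrow> (LINT s:{0..T}|lborel. u s :: real)) (at_right 0)"
proof -
  have "continuous_on {0..T} (\<lambda>e. T - e)" by (intro continuous_intros)
  from continuous_on_compose2[OF continuous_on_set_integral_Icc[OF u] this]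
  have c: "continuous_on {0..T} (\<lambda>e. LINT s:{0..T - e}|lborel. u s)" by auto
  then have "((\<lambda>e. LINT s:{0..T - e}|lborel. u s) \<longlongrightarrow> (LINT s:{0..T - 0}|lborel. u s)) (at 0 within {0..T})"
    using bspec[OF c[unfolded continuous_on_def], of 0] T by simp
  then show ?thesis
    using T by (simp add: at_within_Icc_at_right)
qed

lemma sharp_backward:
  assumes x: "x \<in> \<Omega>" and r: "0 \<le> r" "ereal r < \<tau> x"
    and sharp: "\<And>t1 t2. - \<tau> x < ereal t1 \<Longrightarrow> t1 \<le> t2 \<Longrightarrow> ereal t2 < exit_time \<Phi> \<Omega> 1 x \<Longrightarrow>
        fs (\<Phi> x t1) - fs (\<Phi> x t2) = (LINT s:{t1..t2}|lborel. g (\<Phi> x s))"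
  shows "fs (\<Phi> x (- r)) = fs x + (LINT s:{0..r}|lborel. U s g x)"
proof -
  have "fs (\<Phi> x (- r)) - fs (\<Phi> x 0) = (LINT s:{- r..0}|lborel. g (\<Phi> x s))"
    using r exit_time_pos[OF x, of 1]
    by (intro sharp) (auto simp: ereal_uminus_less_reorder zero_ereal_def[symmetric])
  also have "\<dots> = (LINT s:{0..r}|lborel. g (\<Phi> x (- s)))"
    using set_integral_Icc_reflect(2)[of 0 "- r" "\<lambda>s. g (\<Phi> x s)"] by simp
  also have "\<dots> = (LINT s:{0..r}|lborel. U s g x)"
  proof (intro set_lebesgue_integral_cong ballI allI impI)
    fix s assume "s \<in> {0..r}"
    then have "ereal s < \<tau> x" using r(2) by (auto intro: le_less_trans[of _ "ereal r"])
    then show "g (\<Phi> x (- s)) = U s g x" by (simp add: U_eq)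
  qed simp
  finally show ?thesis by simp
qed

lemma exit_point_in_boundary:
  assumes x: "x \<in> \<Omega>" and T: "\<tau> x = ereal T"
  shows "\<Phi> x (- T) \<in> exit_boundary \<Phi> \<Omega> (- 1)"
proof -
  have pos: "0 < T" and out: "\<Phi> x (- T) \<notin> \<Omega>" using exit_point_notin[OF x T] by auto
  define a where "a = (\<lambda>n. T - T * inverse (real (Suc n)))"
  have a: "0 \<le> a n" "a n < T" for n using pos by (auto simp: a_def field_simps)
  have "a \<longlonglongrightarrow> T - 0"
    unfolding a_def by (intro tendsto_diff tendsto_const tendsto_mult_right_zero LIMSEQ_inverse_real_of_nat)
  then have "(\<lambda>n. - a n) \<longlonglongrightarrow> - T" by (intro tendsto_minus) simp
  moreover have "isCont (\<Phi> x) (- T)"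
    using flow_has_vector_derivative has_vector_derivative_continuous by blast
  ultimately have "(\<lambda>n. \<Phi> x (- a n)) \<longlonglongrightarrow> \<Phi> x (- T)"
    using isCont_tendsto_compose by blast
  moreover have "\<Phi> x (- a n) \<in> \<Omega>" for n
    using flow_in_domain[OF x a(1), of n] a(2) T by simp
  ultimately have "\<Phi> x (- T) \<in> closure \<Omega>"
    unfolding closure_sequential by (intro exI[of _ "\<lambda>n. \<Phi> x (- a n)"]) auto
  then have "\<Phi> x (- T) \<in> frontier \<Omega>"
    using out open_domain by (simp add: frontier_def interior_open)
  then show ?thesis
    unfolding exit_boundary_def using x T by (auto intro!: bexI[of _ x])
qed

text \<open>An incoming boundary point lies outside of the open set \<open>\<Omega>\<close>, so the backward characteristic
through \<open>\<Phi> y s\<close> leaves \<open>\<Omega>\<close> for the first time when it reaches \<open>y\<close>.\<close>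

lemma entrance_time_eq:
  assumes y: "y \<in> exit_boundary \<Phi> \<Omega> (- 1)" and s: "0 < s" "ereal s < exit_time \<Phi> \<Omega> 1 y"
  shows "\<Phi> y s \<in> \<Omega>" "\<tau> (\<Phi> y s) = ereal s"
proof -
  have in_domain: "\<Phi> y r \<in> \<Omega>" if "0 < r" "r \<le> s" for r
    using less_exit_timeD[OF s(2) that] by simp
  then show z: "\<Phi> y s \<in> \<Omega>" using s by simp
  have "y \<notin> \<Omega>"
    using y open_domain by (auto simp: exit_boundary_def frontier_def interior_open)
  have "\<not> ereal s < \<tau> (\<Phi> y s)"
  proof
    assume "ereal s < \<tau> (\<Phi> y s)"
    then have "\<forall>r\<in>{0..s}. \<Phi> (\<Phi> y s) (- 1 * r) \<in> \<Omega>"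
      using less_exit_time_iff[OF z, of s "-1"] s(1) by simp
    from this[rule_format, of s] show False using s(1) \<open>y \<notin> \<Omega>\<close> by simp
  qed
  then obtain T where T: "\<tau> (\<Phi> y s) = ereal T" "T \<le> s"
    using exit_time_pos[OF z, of "-1"] by (cases "\<tau> (\<Phi> y s)") auto
  have "0 < T" "\<Phi> (\<Phi> y s) (- T) \<notin> \<Omega>" using exit_point_notin[OF z T(1)] by auto
  then have "\<not> T < s" using in_domain[of "s - T"] by (auto simp: flow_flow)
  then show "\<tau> (\<Phi> y s) = ereal s" using T by simp
qed

lemma entrance_exit_time_pos:
  assumes "y \<in> exit_boundary \<Phi> \<Omega> (- 1)"
  shows "0 < exit_time \<Phi> \<Omega> 1 y"
proof -
  from assms obtain x where x: "x \<in> \<Omega>" "\<tau> x < \<infinity>" "y = \<Phi> x (- real_of_ereal (\<tau> x))"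
    by (auto simp: exit_boundary_def)
  then obtain T where T: "\<tau> x = ereal T" "y = \<Phi> x (- T)" "0 < T"
    using exit_time_pos[OF x(1), of "-1"] by (cases "\<tau> x") auto
  have "ereal T \<le> exit_time \<Phi> \<Omega> 1 y"
    unfolding exit_time_def
  proof (intro Inf_greatest, clarsimp)
    fix s assume s: "0 < s" "\<Phi> y s \<notin> \<Omega>"
    show "T \<le> s"
    proof (rule ccontr)
      assume "\<not> T \<le> s"
      then show False
        using flow_in_domain[OF x(1), of "T - s"] s T by (simp add: flow_flow)
    qed
  qed
  then show ?thesis using T(3) by (auto intro: less_le_trans[of _ "ereal T"])
qed

end

locale flow_domain_boundary = flow_domain F \<Phi> L M \<Omega> p
  for F :: "real ^ 'n \<Rightarrow> real ^ 'n" and \<Phi> :: "real ^ 'n \<Rightarrow> real \<Rightarrow> real ^ 'n" and L :: real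
    and M :: "(real ^ 'n) measure" and \<Omega> :: "(real ^ 'n) set" and p :: real +
  fixes \<nu> :: "(real ^ 'n) measure"
  assumes boundary: "boundary_measure \<Phi> \<Omega> M (- 1) \<nu>"
begin

lemma space_boundary: "space \<nu> = exit_boundary \<Phi> \<Omega> (- 1)"
  and sets_boundary: "sets \<nu> = sets (restrict_space borel (exit_boundary \<Phi> \<Omega> (- 1)))"
proof -
  show s: "sets \<nu> = sets (restrict_space borel (exit_boundary \<Phi> \<Omega> (- 1)))"
    using boundary by (simp add: boundary_measure_def)
  show "space \<nu> = exit_boundary \<Phi> \<Omega> (- 1)"
    using sets_eq_imp_space_eq[OF s] by (simp add: space_restrict_space)
qed

lemma boundary_formula:
  fixes h :: "real ^ 'n \<Rightarrow> real"
  assumes "integrable R h"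
  defines "I \<equiv> (\<lambda>y. LINT s:{s. 0 < s \<and> ereal s < exit_time \<Phi> \<Omega> 1 y}|lborel. h (\<Phi> y s))"
  shows "AE y in \<nu>. set_integrable lborel {s. 0 < s \<and> ereal s < exit_time \<Phi> \<Omega> 1 y} (\<lambda>s. h (\<Phi> y s))"
    and "integrable \<nu> I"
    and "(LINT x:finite_exit \<Phi> \<Omega> (- 1)|M. h x) = (LINT y|\<nu>. I y)"
proof -
  note * = boundary[unfolded boundary_measure_def, THEN conjunct2, rule_format, OF assms(1)]
  show "AE y in \<nu>. set_integrable lborel {s. 0 < s \<and> ereal s < exit_time \<Phi> \<Omega> 1 y} (\<lambda>s. h (\<Phi> y s))"
    using * by simp
  show "integrable \<nu> I" using * by (simp add: I_def)
  show "(LINT x:finite_exit \<Phi> \<Omega> (- 1)|M. h x) = (LINT y|\<nu>. I y)" using * by (simp add: I_def)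
qed

text \<open>The integration formula for the indicator of the null set: the integral over \<open>\<Omega>\<close> vanishes, hence so
does the integral along almost every characteristic.\<close>

lemma AE_boundary_avoids_null_set:
  assumes N: "N \<in> null_sets M"
  shows "AE y in \<nu>. AE s in lborel. 0 < s \<and> ereal s < exit_time \<Phi> \<Omega> 1 y \<longrightarrow> \<Phi> y s \<notin> N"
proof -
  let ?S = "\<lambda>y. {s. 0 < s \<and> ereal s < exit_time \<Phi> \<Omega> 1 y}"
  define I where "I = (\<lambda>y. LINT s:?S y|lborel. indicator N (\<Phi> y s) :: real)"
  have [measurable]: "N \<in> sets borel" using N by auto
  have AE_N: "AE x in M. x \<notin> N" using N by (rule AE_not_in)
  have "integrable R (indicator N :: _ \<Rightarrow> real)"
  proof -
    have "AE x in R. indicator N x = (0::real)"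
      unfolding AE_R_iff using AE_N by eventually_elim auto
    then show ?thesis
      using integrable_cong_AE[of "indicator N" R "\<lambda>_. 0 :: real"] by simp
  qed
  note h = boundary_formula[OF this]
  have "(LINT x:finite_exit \<Phi> \<Omega> (- 1)|M. indicator N x :: real) = 0"
    unfolding set_lebesgue_integral_def
    by (rule integral_eq_zero_AE) (use AE_N in \<open>eventually_elim, auto\<close>)
  then have "(LINT y|\<nu>. I y) = 0" using h(3) by (simp add: I_def)
  moreover have "0 \<le> I y" for y unfolding I_def by (rule set_integral_nonneg) simp
  ultimately have "AE y in \<nu>. I y = 0"
    using h(2) integral_nonneg_eq_0_iff_AE[of \<nu> I] by (simp add: I_def)
  then show ?thesis
    using h(1)
  proof eventually_elim
    case (elim y)
    then have "AE s in lborel. indicator (?S y) s *\<^sub>R (indicator N (\<Phi> y s) :: real) = 0"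
      unfolding I_def set_integrable_def set_lebesgue_integral_def
      by (subst integral_nonneg_eq_0_iff_AE[symmetric]) auto
    then show ?case by eventually_elim (auto simp: indicator_def split: if_splits)
  qed
qed

text \<open>Conversely, the characteristics that enter \<open>\<Omega>\<close> through a null set of the boundary fill only a null
set of \<open>\<Omega>\<close>: they form a set whose indicator vanishes along all other characteristics. Intersecting
with balls makes the indicator integrable.\<close>

lemma AE_exit_point:
  assumes "AE y in \<nu>. P y"
  shows "AE x in R. \<forall>T. \<tau> x = ereal T \<longrightarrow> P (\<Phi> x (- T))"
proof -
  let ?\<Gamma> = "exit_boundary \<Phi> \<Omega> (- 1)"
  let ?S = "\<lambda>y. {s. 0 < s \<and> ereal s < exit_time \<Phi> \<Omega> 1 y}"
  from assms obtain N where N: "{y \<in> space \<nu>. \<not> P y} \<subseteq> N" "emeasure \<nu> N = 0" "N \<in> sets \<nu>"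
    by (rule AE_E)
  from N(3) obtain B where B [measurable]: "B \<in> sets borel" and NB: "N = ?\<Gamma> \<inter> B"
    by (auto simp: sets_boundary sets_restrict_space)
  define E where "E = {x \<in> \<Omega>. \<tau> x < \<infinity> \<and> \<Phi> x (- real_of_ereal (\<tau> x)) \<in> B}"
  have [measurable]: "(\<lambda>x. x) \<in> borel_measurable R"
    by (rule measurable_restrict_space1) (simp cong: measurable_cong_sets)
  have "{x \<in> space R. \<tau> x < \<infinity> \<and> \<Phi> x (- real_of_ereal (\<tau> x)) \<in> B} \<in> sets R"
    by measurable
  then have E [measurable]: "E \<in> sets borel"
    by (subst (asm) sets_restrict_space_iff) (auto simp: E_def)
  have "emeasure M (E \<inter> cball 0 (real n)) = 0" for n
  proof -
    define En where "En = E \<inter> cball 0 (real n)"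
    have [measurable]: "En \<in> sets borel" by (simp add: En_def)
    have "emeasure M En \<le> emeasure M (cball 0 (real n))"
      by (intro emeasure_mono) (auto simp: En_def)
    then have fin: "emeasure M En < \<infinity>" using compact_finite[of "cball 0 (real n)"] by auto
    have En: "En \<subseteq> finite_exit \<Phi> \<Omega> (- 1)" "En \<subseteq> \<Omega>" by (auto simp: En_def E_def finite_exit_def)
    have "integrable R (indicator En :: _ \<Rightarrow> real)"
      using fin En(2) by (intro integrable_real_indicator) (auto simp: emeasure_restrict_space sets_restrict_space_iff)
    note h = boundary_formula[OF this]
    have "AE y in \<nu>. (LINT s:?S y|lborel. indicator En (\<Phi> y s) :: real) = 0"
    proof (rule AE_I')
      show "N \<in> null_sets \<nu>" using N by auto
      show "{y \<in> space \<nu>. (LINT s:?S y|lborel. indicator En (\<Phi> y s) :: real) \<noteq> 0} \<subseteq> N"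
      proof (clarsimp simp: space_boundary, rule ccontr)
        fix y assume y: "y \<in> ?\<Gamma>" and "y \<notin> N"
          and ne: "(LINT s:?S y|lborel. indicator En (\<Phi> y s) :: real) \<noteq> 0"
        have zero: "indicator (?S y) s *\<^sub>R (indicator En (\<Phi> y s) :: real) = 0" for s
          using entrance_time_eq[OF y, of s] y \<open>y \<notin> N\<close>
          by (auto simp: indicator_def En_def E_def NB)
        show False using ne unfolding set_lebesgue_integral_def zero by simp
      qed
    qed
    then have "(LINT x:finite_exit \<Phi> \<Omega> (- 1)|M. indicator En x :: real) = 0"
      using h(3) by (simp add: integral_eq_zero_AE)
    moreover have ind: "indicator (finite_exit \<Phi> \<Omega> (- 1)) x *\<^sub>R (indicator En x :: real) = indicator En x" for x
      using En(1) by (auto simp: indicator_def)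
    have "(LINT x:finite_exit \<Phi> \<Omega> (- 1)|M. indicator En x :: real) = measure M En"
      unfolding set_lebesgue_integral_def ind by simp
    ultimately have "measure M En = 0" by simp
    then show ?thesis using fin by (auto simp: En_def measure_def enn2real_eq_0_iff)
  qed
  then have "(\<Union>n. E \<inter> cball 0 (real n)) \<in> null_sets M"
    by (intro null_sets_UN) auto
  moreover have "(\<Union>n. E \<inter> cball 0 (real n)) = E"
    by (auto simp: real_arch_simple)
  ultimately have "AE x in M. x \<notin> E" using AE_not_in by metis
  then show ?thesis
    unfolding AE_R_iff
  proof eventually_elim
    case (elim x)
    then show ?case
      using exit_point_in_boundary[of x] N(1) by (auto simp: E_def space_boundary NB)
  qed
qed

text \<open>Before the exit time the equation is the absolute continuity of the representative. After the exit
time, follow the backward characteristic up to its entrance point, where the representative tends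
to 0; from then on \<open>U\<^sub>s g\<close> vanishes and the integral no longer changes.\<close>

lemma integral_equation_if_trace:
  assumes f: "f \<in> lp_space R p" and g: "g \<in> lp_space R p"
    and "has_trace \<Phi> \<Omega> M (- 1) \<nu> f g (\<lambda>_. 0)"
  shows "integral_equation f g"
  unfolding integral_equation_def
proof safe
  fix t :: real assume t: "0 < t"
  from assms(3) obtain fs where sharp: "sharp_representative \<Phi> \<Omega> M f g fs"
    and trace: "AE y in \<nu>. ((\<lambda>t. fs (\<Phi> y t)) \<longlongrightarrow> 0) (at_right 0)"
    by (auto simp: has_trace_def)
  have eq: "AE x in R. fs x = f x"
    and along: "AE x in R. \<forall>t1 t2. - \<tau> x < ereal t1 \<and> t1 \<le> t2 \<and> ereal t2 < exit_time \<Phi> \<Omega> 1 x \<longrightarrow>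
        set_integrable lborel {t1..t2} (\<lambda>s. g (\<Phi> x s)) \<and>
        fs (\<Phi> x t1) - fs (\<Phi> x t2) = (LINT s:{t1..t2}|lborel. g (\<Phi> x s))"
    using sharp by (auto simp: sharp_representative_def)
  show "AE x in R. U t f x - f x = (LINT s:{0..t}|lborel. U s g x)"
    using AE_space eq along AE_U[OF eq, of t] AE_exit_point[OF trace] AE_U_time_integrable[OF g t]
  proof eventually_elim
    case (elim x)
    have x: "x \<in> \<Omega>" using elim(1) by simp
    have backward: "fs (\<Phi> x (- r)) = fs x + (LINT s:{0..r}|lborel. U s g x)" if "0 \<le> r" "ereal r < \<tau> x" for r
      using elim(3) by (intro sharp_backward[OF x that]) auto
    show ?case
    proof (cases "ereal t < \<tau> x")
      case True
      then show ?thesis using backward[of t] elim(2,4) t by (simp add: U_eq)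
    next
      case False
      then obtain T where T: "\<tau> x = ereal T" "T \<le> t"
        using exit_time_pos[OF x, of "-1"] by (cases "\<tau> x") auto
      have T0: "0 < T" using exit_point_notin[OF x T(1)] by simp
      have "set_integrable lborel {0..T} (\<lambda>s. U s g x)"
        using T by (intro set_integrable_subset[OF elim(6)]) auto
      then have "((\<lambda>e. fs x + (LINT s:{0..T - e}|lborel. U s g x)) \<longlongrightarrow>
          fs x + (LINT s:{0..T}|lborel. U s g x)) (at_right 0)"
        using T0 by (intro tendsto_intros time_integral_left_limit)
      moreover have "\<forall>\<^sub>F e in at_right 0. fs x + (LINT s:{0..T - e}|lborel. U s g x) = fs (\<Phi> (\<Phi> x (- T)) e)"
      proof -
        have "fs x + (LINT s:{0..T - e}|lborel. U s g x) = fs (\<Phi> (\<Phi> x (- T)) e)" if "0 < e" "e < T" for e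
          using backward[of "T - e"] T(1) that by (simp add: flow_flow)
        then show ?thesis using T0 by (auto simp: eventually_at_right[of 0 1] intro!: exI[of _ T])
      qed
      ultimately have "((\<lambda>e. fs (\<Phi> (\<Phi> x (- T)) e)) \<longlongrightarrow> fs x + (LINT s:{0..T}|lborel. U s g x)) (at_right 0)"
        by (rule Lim_transform_eventually)
      moreover have "((\<lambda>e. fs (\<Phi> (\<Phi> x (- T)) e)) \<longlongrightarrow> 0) (at_right 0)"
        using elim(5) T(1) by blast
      ultimately have "fs x + (LINT s:{0..T}|lborel. U s g x) = 0"
        by (rule tendsto_unique[rotated]) simp
      then show ?thesis
        using False elim(2) time_integral_tail[OF x T, of g] by (simp add: U_eq_0)
    qed
  qed
qed

end

section \<open>The absolutely continuous representative\<close>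

context flow_domain
begin

text \<open>The integral of \<open>g\<close> over the piece of the backward characteristic of length \<open>r\<close>, cut off at the
entrance point.\<close>

abbreviation past_integral :: "(real ^ 'n \<Rightarrow> real) \<Rightarrow> real ^ 'n \<Rightarrow> real \<Rightarrow> real" where
  "past_integral g z r \<equiv> LINT s:{0..r}|lborel. U s g z"

text \<open>The integral equation is asked for almost every time only, so that Fubini's theorem makes almost
every point regular.\<close>

definition regular_point :: "(real ^ 'n \<Rightarrow> real) \<Rightarrow> (real ^ 'n \<Rightarrow> real) \<Rightarrow> real ^ 'n \<Rightarrow> bool" where
  "regular_point f g z \<longleftrightarrow>
     (\<forall>n. set_integrable lborel {0..real (Suc n)} (\<lambda>s. U s g z)) \<and>
     (AE r in lborel. 0 < r \<longrightarrow> U r f z - f z = past_integral g z r)"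

lemma AE_regular_point:
  assumes f: "f \<in> lp_space R p" and g: "g \<in> lp_space R p" and eq: "integral_equation f g"
  shows "AE z in R. regular_point f g z"
proof -
  have fm [measurable]: "f \<in> borel_measurable R" and gm: "g \<in> borel_measurable R"
    using f g by (auto simp: lp_space_iff_mass)
  have Uf [measurable]: "(\<lambda>w. indicator {0..} (fst w) *\<^sub>R U (fst w) f (snd w)) \<in> borel_measurable (lborel \<Otimes>\<^sub>M R)"
    using measurable_U_joint[OF fm] by (simp add: split_beta')
  note [measurable] = measurable_time_integral_joint[OF gm]
  define Q where "Q = (\<lambda>r z. 0 < r \<longrightarrow> indicator {0..} r *\<^sub>R U r f z - f z = past_integral g z r)"
  have "AE r in lborel. AE z in R. Q r z"
  proof (rule AE_I2)
    fix r :: real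
    show "AE z in R. Q r z"
    proof (cases "0 < r")
      case True
      then have "AE z in R. U r f z - f z = past_integral g z r" using eq by (simp add: integral_equation_def)
      then show ?thesis by eventually_elim (use True in \<open>simp add: Q_def\<close>)
    qed (simp add: Q_def)
  qed
  moreover have "{w \<in> space (lborel \<Otimes>\<^sub>M R). Q (fst w) (snd w)} \<in> sets (lborel \<Otimes>\<^sub>M R)"
    unfolding Q_def by measurable
  ultimately have "AE z in R. AE r in lborel. Q r z"
    using LR.AE_commute[of Q] by simp
  moreover have "AE z in R. \<forall>n. set_integrable lborel {0..real (Suc n)} (\<lambda>s. U s g z)"
    unfolding AE_all_countable using AE_U_time_integrable[OF g] by simp
  ultimately show ?thesis
  proof eventually_elim
    case (elim z)
    have "AE r in lborel. 0 < r \<longrightarrow> U r f z - f z = past_integral g z r"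
      using elim(1) by eventually_elim (auto simp: Q_def)
    then show ?case using elim(2) by (simp add: regular_point_def)
  qed
qed

lemma regular_point_integrable:
  assumes "regular_point f g z"
  shows "set_integrable lborel {0..r} (\<lambda>s. U s g z)"
proof -
  obtain n where n: "r \<le> real n" using real_arch_simple by blast
  have "set_integrable lborel {0..real (Suc n)} (\<lambda>s. U s g z)"
    using assms unfolding regular_point_def by blast
  then show ?thesis
    by (rule set_integrable_subset) (use n in auto)
qed

lemma continuous_on_past_integral:
  assumes "regular_point f g z"
  shows "continuous_on {0..r} (past_integral g z)"
  using regular_point_integrable[OF assms] by (rule continuous_on_set_integral_Icc)

text \<open>Averages of \<open>f\<close> over short backward pieces of the characteristic do not see null sets of times.
Where they diverge, \<open>lim\<close> takes an unspecified value, but it remains measurable in \<open>x\<close>.\<close>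

definition sharp :: "(real ^ 'n \<Rightarrow> real) \<Rightarrow> real ^ 'n \<Rightarrow> real" where
  "sharp f x = lim (\<lambda>n. real (Suc n) * (LINT s:{0..inverse (real (Suc n))}|lborel. U s f x))"

lemma measurable_sharp: "f \<in> borel_measurable R \<Longrightarrow> sharp f \<in> borel_measurable R"
  unfolding sharp_def[abs_def]
  by (intro borel_measurable_lim_metric borel_measurable_times borel_measurable_const measurable_time_integral)

text \<open>For almost every \<open>s > 0\<close> the value of \<open>f\<close> at time \<open>- r - s\<close> is given by the integral equation
at \<open>z\<close>, whose right-hand side is continuous in \<open>s\<close>; the averages therefore converge to its value at
\<open>s = 0\<close>.\<close>

lemma sharp_eq:
  assumes f: "f \<in> borel_measurable R" and reg: "regular_point f g z" and z: "z \<in> \<Omega>"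
    and r: "0 \<le> r" "ereal r < \<tau> z"
  shows "sharp f (\<Phi> z (- r)) = f z + past_integral g z r"
proof -
  let ?x = "\<Phi> z (- r)"
  define h where "h = (\<lambda>s. f z + past_integral g z (r + s))"
  have x: "?x \<in> \<Omega>" using flow_in_domain[OF z r] .
  have cont: "continuous_on {0..1} h"
  proof -
    have "continuous_on {0..1} (\<lambda>s. r + s)" by (intro continuous_intros)
    from continuous_on_compose2[OF continuous_on_past_integral[OF reg, of "r + 1"] this] r
    have "continuous_on {0..1} (\<lambda>s. past_integral g z (r + s))" by auto
    then show ?thesis unfolding h_def by (intro continuous_intros)
  qed
  have Uh: "AE s in lborel. 0 < s \<longrightarrow> U s f ?x = h s"
  proof -
    have "AE s in lborel. 0 < s \<longrightarrow> U s f z - f z = past_integral g z s"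
      using reg by (simp add: regular_point_def)
    from AE_lborel_shift[OF this, of r] show ?thesis
    proof eventually_elim
      case (elim s)
      show ?case
      proof
        assume s: "0 < s"
        then have "U (r + s) f z = U r (U s f) z" using U_add[OF z r(1)] by simp
        also have "\<dots> = U s f ?x" using r(2) by (rule U_eq)
        finally show "U s f ?x = h s" using elim s r by (simp add: h_def)
      qed
    qed
  qed
  have avg: "(LINT s:{0..a}|lborel. U s f ?x) = (LINT s:{0..a}|lborel. h s)" if a: "0 < a" "a \<le> 1" for a
    unfolding set_lebesgue_integral_def
  proof (rule integral_cong_AE)
    have "(\<lambda>s. indicator {0..} s *\<^sub>R U s f ?x) \<in> borel_measurable lborel"
      using measurable_compose[OF measurable_Pair2' measurable_U_joint[OF f], of ?x] x by simp
    then have "(\<lambda>s. indicator {0..a} s *\<^sub>R (indicator {0..} s *\<^sub>R U s f ?x)) \<in> borel_measurable lborel"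
      by measurable
    also have "(\<lambda>s. indicator {0..a} s *\<^sub>R (indicator {0..} s *\<^sub>R U s f ?x)) = (\<lambda>s. indicator {0..a} s *\<^sub>R U s f ?x)"
      by (auto simp: indicator_def fun_eq_iff)
    finally show "(\<lambda>s. indicator {0..a} s *\<^sub>R U s f ?x) \<in> borel_measurable lborel" .
    have "set_integrable lborel {0..a} h"
      using a by (intro borel_integrable_atLeastAtMost' continuous_on_subset[OF cont]) auto
    then show "(\<lambda>s. indicator {0..a} s *\<^sub>R h s) \<in> borel_measurable lborel"
      unfolding set_integrable_def by (rule borel_measurable_integrable)
    show "AE s in lborel. indicator {0..a} s *\<^sub>R U s f ?x = indicator {0..a} s *\<^sub>R h s"
      using Uh AE_lborel_singleton[of 0] by eventually_elim (auto simp: indicator_def)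
  qed
  have "(\<lambda>n. real (Suc n) * (LINT s:{0..inverse (real (Suc n))}|lborel. U s f ?x)) \<longlonglongrightarrow> h 0"
    using average_tendsto[OF cont] by (subst avg) (auto simp: field_simps)
  then show ?thesis
    unfolding sharp_def by (simp add: limI h_def)
qed

text \<open>Regularity of a point describes only its past. To control the whole characteristic through \<open>x\<close>, look
back from points \<open>\<Phi> x q\<close> in its future; the countably many rational \<open>q\<close> suffice, so only a null set
of \<open>x\<close> is lost.\<close>

lemma sharp_representative_sharp:
  assumes f: "f \<in> lp_space R p" and g: "g \<in> lp_space R p" and eq: "integral_equation f g"
  shows "sharp_representative \<Phi> \<Omega> M f g (sharp f)"
  unfolding sharp_representative_def
proof (intro conjI)
  have fm: "f \<in> borel_measurable R" using f by (simp add: lp_space_iff_mass)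
  note reg = AE_regular_point[OF f g eq]
  show "sharp f \<in> borel_measurable R" using fm by (rule measurable_sharp)
  show "AE x in R. sharp f x = f x"
    using reg AE_space
  proof eventually_elim
    case (elim x)
    then have x: "x \<in> \<Omega>" by simp
    have "past_integral g x 0 = 0"
      unfolding set_lebesgue_integral_def
      by (rule integral_eq_zero_AE) (use AE_lborel_singleton[of 0] in \<open>eventually_elim, auto\<close>)
    then show ?case
      using sharp_eq[OF fm elim(1) x, of 0] exit_time_pos[OF x, of "-1"] by (simp add: zero_ereal_def)
  qed
  have "AE x in R. \<forall>q::rat. \<Phi> x (of_rat q) \<in> \<Omega> \<longrightarrow> regular_point f g (\<Phi> x (of_rat q))"
    unfolding AE_all_countable
  proof
    fix q :: rat
    have "AE x in M. x \<in> \<Omega> \<longrightarrow> regular_point f g x" using reg unfolding AE_R_iff .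
    from AE_flow[OF this, of "of_rat q"]
    show "AE x in R. \<Phi> x (of_rat q) \<in> \<Omega> \<longrightarrow> regular_point f g (\<Phi> x (of_rat q))"
      unfolding AE_R_iff by eventually_elim simp
  qed
  then show "AE x in R. \<forall>t1 t2. - \<tau> x < ereal t1 \<and> t1 \<le> t2 \<and> ereal t2 < exit_time \<Phi> \<Omega> 1 x \<longrightarrow>
      set_integrable lborel {t1..t2} (\<lambda>s. g (\<Phi> x s)) \<and>
      sharp f (\<Phi> x t1) - sharp f (\<Phi> x t2) = (LINT s:{t1..t2}|lborel. g (\<Phi> x s))"
    using AE_space
  proof eventually_elim
    case (elim x)
    then have x: "x \<in> \<Omega>" by simp
    show ?case
    proof (intro allI impI, elim conjE)
      fix t1 t2 assume t: "- \<tau> x < ereal t1" "t1 \<le> t2" "ereal t2 < exit_time \<Phi> \<Omega> 1 x"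
      have "ereal (max t2 0) < exit_time \<Phi> \<Omega> 1 x"
        using t(3) exit_time_pos[OF x, of 1] by (auto simp: max_def zero_ereal_def)
      from ereal_dense3[OF this] obtain q' :: rat
        where "ereal (max t2 0) < ereal (of_rat q')" and q_exit: "ereal (of_rat q') < exit_time \<Phi> \<Omega> 1 x"
        by auto
      define q where "q = (of_rat q' :: real)"
      have q: "t2 \<le> q" "0 \<le> q" "ereal q < exit_time \<Phi> \<Omega> 1 x"
        using \<open>ereal (max t2 0) < ereal (of_rat q')\<close> q_exit by (auto simp: q_def)
      define z where "z = \<Phi> x q"
      have future: "\<Phi> x s \<in> \<Omega>" if "0 \<le> s" "s \<le> q" for s
        using less_exit_time_iff[OF x q(2), of 1] q(3) that by auto
      have past: "\<Phi> x s \<in> \<Omega>" if "t1 \<le> s" "s \<le> 0" for s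
      proof -
        have "ereal (- s) < \<tau> x"
          using t(1) that by (auto simp: ereal_uminus_less_reorder intro: le_less_trans[of _ "ereal (- t1)"])
        then show ?thesis using flow_in_domain[OF x, of "- s"] that by simp
      qed
      have z: "z \<in> \<Omega>" using future[of q] q by (simp add: z_def)
      have z_reg: "regular_point f g z" using elim(1) z by (simp add: z_def q_def)
      have z_flow: "\<Phi> z (- r) = \<Phi> x (q - r)" for r by (simp add: z_def flow_flow)
      have z_exit: "ereal r < \<tau> z" if "0 \<le> r" "r \<le> q - t1" for r
        using that
      proof (subst less_exit_time_iff[OF z], safe)
        fix s assume "s \<in> {0..r}"
        then show "\<Phi> z (- 1 * s) \<in> \<Omega>"
          using future[of "q - s"] past[of "q - s"] that by (cases "s \<le> q") (auto simp: z_flow)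
      qed
      define r1 r2 where "r1 = q - t1" and "r2 = q - t2"
      have r: "0 \<le> r2" "r2 \<le> r1" using t q by (auto simp: r1_def r2_def)
      have fs: "sharp f (\<Phi> x t1) = f z + past_integral g z r1" "sharp f (\<Phi> x t2) = f z + past_integral g z r2"
        using sharp_eq[OF fm z_reg z, of r1] sharp_eq[OF fm z_reg z, of r2] z_exit[of r1] z_exit[of r2] r t
        unfolding z_flow by (simp_all add: r1_def r2_def)
      have int: "set_integrable lborel {0..r2 + (t2 - t1)} (\<lambda>s. U s g z)"
        using z_reg by (rule regular_point_integrable)
      have U: "U (r2 + s) g z = g (\<Phi> x (t2 - s))" if "0 \<le> s" "s \<le> t2 - t1" for s
      proof -
        have "U (r2 + s) g z = g (\<Phi> z (- (r2 + s)))"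
          using that r by (intro U_eq z_exit) (auto simp: r2_def)
        then show ?thesis by (simp only: z_flow) (simp add: r2_def)
      qed
      have "set_integrable lborel {0..t2 - t1} (\<lambda>s. U (r2 + s) g z)"
        using int r t by (intro set_integrable_Icc_shift) auto
      also have "?this \<longleftrightarrow> set_integrable lborel {0..t2 - t1} (\<lambda>s. g (\<Phi> x (t2 - s)))"
        by (intro set_integrable_cong) (auto simp: U)
      also have "\<dots> \<longleftrightarrow> set_integrable lborel {t1..t2} (\<lambda>s. g (\<Phi> x s))"
        by (rule set_integrable_Icc_reflect)
      finally have "set_integrable lborel {t1..t2} (\<lambda>s. g (\<Phi> x s))" .
      moreover have "sharp f (\<Phi> x t1) - sharp f (\<Phi> x t2) = (LINT s:{t1..t2}|lborel. g (\<Phi> x s))"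
      proof -
        have "sharp f (\<Phi> x t1) - sharp f (\<Phi> x t2) = past_integral g z (r2 + (t2 - t1)) - past_integral g z r2"
          by (simp add: fs r1_def r2_def)
        also have "\<dots> = (LINT s:{0..t2 - t1}|lborel. U (r2 + s) g z)"
          using int r t by (intro set_integral_Icc_shift[symmetric]) auto
        also have "\<dots> = (LINT s:{0..t2 - t1}|lborel. g (\<Phi> x (t2 - s)))"
          by (intro set_lebesgue_integral_cong) (auto simp: U)
        also have "\<dots> = (LINT s:{t1..t2}|lborel. g (\<Phi> x s))"
          by (rule set_integral_Icc_reflect)
        finally show ?thesis .
      qed
      ultimately show "set_integrable lborel {t1..t2} (\<lambda>s. g (\<Phi> x s)) \<and>
        sharp f (\<Phi> x t1) - sharp f (\<Phi> x t2) = (LINT s:{t1..t2}|lborel. g (\<Phi> x s))" by blast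
    qed
  qed
qed

end

context flow_domain_boundary
begin

text \<open>Almost every characteristic that enters through the boundary contains a regular point \<open>z\<close>. The
integral equation at \<open>z\<close> for a time \<open>r\<close> beyond the entrance says that \<open>- f z\<close> is the
integral of \<open>g\<close> up to the entrance point, so the representative tends to 0 there.\<close>

lemma trace_if_integral_equation:
  assumes f: "f \<in> lp_space R p" and g: "g \<in> lp_space R p" and eq: "integral_equation f g"
  shows "has_trace \<Phi> \<Omega> M (- 1) \<nu> f g (\<lambda>_. 0)"
  unfolding has_trace_def
proof (intro exI conjI)
  have fm: "f \<in> borel_measurable R" using f by (simp add: lp_space_iff_mass)
  show "sharp_representative \<Phi> \<Omega> M f g (sharp f)"
    using f g eq by (rule sharp_representative_sharp)
  have "AE z in M. z \<in> \<Omega> \<longrightarrow> regular_point f g z"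
    using AE_regular_point[OF f g eq] unfolding AE_R_iff .
  then obtain N where N: "{z \<in> space M. \<not> (z \<in> \<Omega> \<longrightarrow> regular_point f g z)} \<subseteq> N"
    "emeasure M N = 0" "N \<in> sets M"
    by (rule AE_E)
  then have "N \<in> null_sets M" by auto
  show "AE y in \<nu>. ((\<lambda>t. sharp f (\<Phi> y (- (- 1) * t))) \<longlongrightarrow> 0) (at_right 0)"
    using AE_boundary_avoids_null_set[OF \<open>N \<in> null_sets M\<close>] AE_space
  proof eventually_elim
    case (elim y)
    then have y: "y \<in> exit_boundary \<Phi> \<Omega> (- 1)" by (simp add: space_boundary)
    obtain b where b: "0 < b" "ereal b < exit_time \<Phi> \<Omega> 1 y"
      using ereal_dense2[OF entrance_exit_time_pos[OF y]] by auto
    obtain s where s: "0 < s" "s < b" "\<Phi> y s \<notin> N"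
    proof -
      obtain s where s: "0 < s" "s < b" "0 < s \<and> ereal s < exit_time \<Phi> \<Omega> 1 y \<longrightarrow> \<Phi> y s \<notin> N"
        using AE_lborel_ex_between[OF elim(1) b(1)] .
      moreover have "ereal s < exit_time \<Phi> \<Omega> 1 y"
        using s(2) b(2) less_trans[of "ereal s" "ereal b"] by simp
      ultimately show ?thesis using that by blast
    qed
    have s_exit: "ereal s < exit_time \<Phi> \<Omega> 1 y"
      using s(2) b(2) less_trans[of "ereal s" "ereal b"] by simp
    define z where "z = \<Phi> y s"
    have z: "z \<in> \<Omega>" "\<tau> z = ereal s"
      using entrance_time_eq[OF y s(1) s_exit] by (auto simp: z_def)
    have reg: "regular_point f g z" using N(1) s(3) z by (auto simp: z_def)
    have fs: "sharp f (\<Phi> y t) = f z + past_integral g z (s - t)" if "0 < t" "t < s" for t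
    proof -
      have "sharp f (\<Phi> z (- (s - t))) = f z + past_integral g z (s - t)"
        using that z by (intro sharp_eq[OF fm reg]) auto
      then show ?thesis by (simp add: z_def flow_flow)
    qed
    have "AE r in lborel. 0 < r \<longrightarrow> U r f z - f z = past_integral g z r"
      using reg by (simp add: regular_point_def)
    then obtain r where r: "s < r" "0 < r \<longrightarrow> U r f z - f z = past_integral g z r"
      by (rule AE_lborel_ex_between[of _ s "s + 1"]) auto
    then have zero: "f z + past_integral g z s = 0"
      using time_integral_tail[OF z, of r g] s z by (simp add: U_eq_0)
    have lim: "((\<lambda>t. f z + past_integral g z (s - t)) \<longlongrightarrow> f z + past_integral g z s) (at_right 0)"
      using regular_point_integrable[OF reg, of s] s(1) by (intro tendsto_intros time_integral_left_limit)
    have ev: "\<forall>\<^sub>F t in at_right 0. f z + past_integral g z (s - t) = sharp f (\<Phi> y t)"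
      using s(1) by (auto simp: fs eventually_at_right[of 0 1] intro!: exI[of _ s])
    show ?case
      using Lim_transform_eventually[OF lim ev] by (simp add: zero)
  qed
qed

end

section \<open>Generation theorem\<close>

context flow_domain
begin

lemma lp_norm_U_le:
  assumes "f \<in> lp_space R p" "0 \<le> t"
  shows "lp_norm R p (U t f) \<le> lp_norm R p f"
proof -
  have "f \<in> borel_measurable R" using assms(1) by (simp add: lp_space_iff_mass)
  then show ?thesis
    using assms p_pos by (intro lp_norm_mono measurable_U lp_mass_U_le) auto
qed

lemma lp_contractive_U: "lp_contractive R p U"
  using lp_norm_U_le by (simp add: lp_contractive_def)

lemma lp_nonnegative_U: "lp_nonnegative R p U"
  unfolding lp_nonnegative_def
proof (intro allI ballI impI)
  fix t :: real and f :: "real ^ 'n \<Rightarrow> real" assume t: "0 \<le> t" and "AE x in R. 0 \<le> f x"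
  from AE_U[OF this(2), of t] show "AE x in R. 0 \<le> U t f x"
    by eventually_elim (use t in \<open>auto simp: U_zero_def indicator_def\<close>)
qed

lemma lp_bounded_operator_U:
  assumes t: "0 \<le> t"
  shows "lp_bounded_operator R p (U t)"
  unfolding lp_bounded_operator_def
proof (intro conjI ballI impI allI)
  fix f g :: "real ^ 'n \<Rightarrow> real" assume "AE x in R. f x = g x"
  from AE_U[OF this, of t] show "AE x in R. U t f x = U t g x"
    by eventually_elim (use t in \<open>auto simp: U_zero_def indicator_def\<close>)
next
  show "\<exists>C. \<forall>f\<in>lp_space R p. lp_norm R p (U t f) \<le> C * lp_norm R p f"
    using lp_norm_U_le t by (intro exI[of _ 1]) simp
qed (use t in \<open>auto simp: U_lin lp_space_U\<close>)

lemma c0_semigroup_U: "c0_semigroup_lp R p U"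
  unfolding c0_semigroup_lp_def
proof (intro conjI allI ballI impI)
  fix f assume f: "f \<in> lp_space R p"
  show "AE x in R. U 0 f x = f x" by (intro AE_I2) (simp add: U_0)
  have "\<forall>\<^sub>F t in at_right 0. (\<lambda>x. U t f x - f x) \<in> lp_space R p"
    using eventually_nonneg by eventually_elim (intro lp_space_diff lp_space_U f p_pos)
  from lp_norm_tendsto_0_iff[OF this p_pos] U_strongly_continuous[OF f]
  show "((\<lambda>t. lp_norm R p (\<lambda>x. U t f x - f x)) \<longlongrightarrow> 0) (at_right 0)" by simp
next
  fix s t :: real and f :: "real ^ 'n \<Rightarrow> real" assume "0 \<le> s" "0 \<le> t"
  then show "AE x in R. U (s + t) f x = U s (U t f) x"
    by (intro AE_I2 U_add) auto
qed (rule lp_bounded_operator_U)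

end

lemma (in flow_domain_boundary) generator_eq_T_zero:
  "generator_lp R p U = T_zero \<Phi> \<Omega> M \<nu> p"
proof (intro set_eqI iffI; clarify)
  fix f g assume gen: "(f, g) \<in> generator_lp R p U"
  then have "has_trace \<Phi> \<Omega> M (- 1) \<nu> f g (\<lambda>_. 0)"
    using integral_equation_if_generator by (intro trace_if_integral_equation) (auto simp: generator_lp_def)
  then show "(f, g) \<in> T_zero \<Phi> \<Omega> M \<nu> p"
    using gen generator_subset_T_max by (auto simp: T_zero_def)
next
  fix f g assume "(f, g) \<in> T_zero \<Phi> \<Omega> M \<nu> p"
  then have "f \<in> lp_space R p" "g \<in> lp_space R p" "has_trace \<Phi> \<Omega> M (- 1) \<nu> f g (\<lambda>_. 0)"
    by (auto simp: T_zero_def T_max_def)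
  then show "(f, g) \<in> generator_lp R p U"
    using integral_equation_if_trace generator_if_integral_equation by blast
qed

theorem theorem3p1:
  fixes M \<mu>_minus :: "(real ^ 'n) measure"
    and \<Omega> :: "(real ^ 'n) set"
    and F :: "real ^ 'n \<Rightarrow> real ^ 'n"
    and \<Phi> :: "real ^ 'n \<Rightarrow> real \<Rightarrow> real ^ 'n"
    and p :: real
  assumes "radon_measure M"
    and "open \<Omega>"
    and "\<exists>L. L-lipschitz_on UNIV F"
    and "is_flow F \<Phi>"
    and "\<And>A t. A \<in> sets M \<Longrightarrow> emeasure M ((\<lambda>x. \<Phi> x t) ` A) = emeasure M A"
    and "boundary_measure \<Phi> \<Omega> M (-1) \<mu>_minus"
    and "1 < p"
  shows "c0_semigroup_lp (restrict_space M \<Omega>) p (U_zero \<Phi> \<Omega>) \<and>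
    lp_contractive (restrict_space M \<Omega>) p (U_zero \<Phi> \<Omega>) \<and>
    lp_nonnegative (restrict_space M \<Omega>) p (U_zero \<Phi> \<Omega>) \<and>
    generator_lp (restrict_space M \<Omega>) p (U_zero \<Phi> \<Omega>) = T_zero \<Phi> \<Omega> M \<mu>_minus p"
proof -
  obtain L where "L-lipschitz_on UNIV F" using assms(3) ..
  with assms interpret flow_domain_boundary F \<Phi> L M \<Omega> p \<mu>_minus
    by unfold_locales auto
  show ?thesis
    using c0_semigroup_U lp_contractive_U lp_nonnegative_U generator_eq_T_zero by blast
qed

end
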